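(* Let $M$ be a graded $R$-module, let $f=(f_1,\ldots,f_r)$ be an $r$-tuple of homogeneous elements of $R$, let $I$ be the $R$-ideal generated by the $f_i$'s, and let $\mathbb{H}_j(f;M)$ be the $j$-th homology module of the Koszul complex $\mathbb{K}_\bullet(f;M)$. If $B\subset \sqrt{I+\mathrm{ann}_R(M)}$, then $$\mathrm{Supp}_G(\mathbb{H}_j(f;M))\subset \bigcup_{k\geq 0}\bigl(\mathrm{Supp}_G(H^{k}_B(M))+\mathscr{E}_{j+k}^f\bigr)$$ for all $j\geq 0$.
   Context: $G$ is a finitely generated abelian group, $S$ is a commutative ring, and $R=S[X_1,\ldots,X_n]$ is $G$-graded with $\deg(X_i)=\gamma_i\in G$ and $\deg(s)=0$ for $s\in S$. $B\subseteq (X_1,\ldots,X_n)$ is a finitely generated graded $R$-ideal. $H^i_B(M)$ denotes the $i$-th cohomology of the Čech complex of $M$ on a finite set of homogeneous generators of $B$. $\mathrm{Supp}_G(M):=\{\gamma\in G: M_\gamma\neq 0\}$. The Koszul complex and its homology carry their natural $G$-grading. Set $\delta_i:=\deg(f_i)$, $\mathscr{E}_0^f:=\{0\}$ and, for $i>0$, $\mathscr{E}_i^f:=\{\delta_{j_1}+\cdots+\delta_{j_i} : j_1<\cdots<j_i\}$ (so $\mathscr{E}_i^f=\emptyset$ for $i>r$). For subsets $A,A'$ of $G$, $A+A'=\{a+a'\}$ (empty if one of them is empty). *)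

theory Defs
  imports
    "HOL-Algebra.Algebra"
    "HOL-Computational_Algebra.Group_Closure"
    "HOL-Library.Set_Algebras"
begin

section \<open>The graded polynomial ring\<close>

text \<open>
  \<^theory>\<open>HOL-Algebra.Indexed_Polynomials\<close> represents \<open>S[X\<^sub>0, \<dots>, X\<^sub>n\<^sub>-\<^sub>1]\<close> as a set of functions from
  monomials (multisets of indices) to coefficients, but does not supply a multiplication.
\<close>

definition mpoly_ring :: "('s, 'z) ring_scheme \<Rightarrow> nat \<Rightarrow> (nat multiset \<Rightarrow> 's) ring" where
  "mpoly_ring S n =
    \<lparr> carrier = ring.indexed_pset S {..<n} (carrier S),
      monoid.mult = (\<lambda>p q m. \<Oplus>\<^bsub>S\<^esub>a\<in>{a. a \<subseteq># m}. p a \<otimes>\<^bsub>S\<^esub> q (m - a)),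
      one = ring.indexed_const S \<one>\<^bsub>S\<^esub>,
      ring.zero = ring.indexed_const S \<zero>\<^bsub>S\<^esub>,
      add = ring.indexed_padd S \<rparr>"

definition mpoly_grading ::
    "('s, 'z) ring_scheme \<Rightarrow> nat \<Rightarrow> (nat \<Rightarrow> 'g::ab_group_add) \<Rightarrow> 'g \<Rightarrow> (nat multiset \<Rightarrow> 's) set" where
  "mpoly_grading S n \<gamma> d =
    {p \<in> carrier (mpoly_ring S n). \<forall>m. p m \<noteq> \<zero>\<^bsub>S\<^esub> \<longrightarrow> (\<Sum>i\<in>#m. \<gamma> i) = d}"


section \<open>Graded modules\<close>

text \<open>
  A grading is the family \<open>d \<mapsto> M\<^sub>d\<close> of its homogeneous components; the last clause says that
  \<open>M\<close> is their internal direct sum.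
\<close>

definition graded_module ::
    "('r, 'a) ring_scheme \<Rightarrow> ('g::ab_group_add \<Rightarrow> 'r set) \<Rightarrow>
     ('r, 'm, 'b) module_scheme \<Rightarrow> ('g \<Rightarrow> 'm set) \<Rightarrow> bool" where
  "graded_module R RG M MG \<longleftrightarrow>
    module R M \<and>
    (\<forall>d. additive_subgroup (MG d) M) \<and>
    (\<forall>d e. \<forall>a\<in>RG d. \<forall>x\<in>MG e. a \<odot>\<^bsub>M\<^esub> x \<in> MG (d + e)) \<and>
    (\<forall>x\<in>carrier M. \<exists>!c. (\<forall>d. c d \<in> MG d) \<and> finite {d. c d \<noteq> \<zero>\<^bsub>M\<^esub>} \<and>
        x = (\<Oplus>\<^bsub>M\<^esub>d\<in>{d. c d \<noteq> \<zero>\<^bsub>M\<^esub>}. c d))"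

definition Supp :: "('m, 'b) ring_scheme \<Rightarrow> ('g \<Rightarrow> 'm set) \<Rightarrow> 'g set" where
  "Supp M MG = {d. MG d \<noteq> {\<zero>\<^bsub>M\<^esub>}}"

definition annihilator :: "('r, 'a) ring_scheme \<Rightarrow> ('r, 'm, 'b) module_scheme \<Rightarrow> 'r set" where
  "annihilator R M = {a \<in> carrier R. \<forall>x\<in>carrier M. a \<odot>\<^bsub>M\<^esub> x = \<zero>\<^bsub>M\<^esub>}"

definition ideal_radical :: "('r, 'a) ring_scheme \<Rightarrow> 'r set \<Rightarrow> 'r set" where
  "ideal_radical R I = {a \<in> carrier R. \<exists>k::nat. a [^]\<^bsub>R\<^esub> k \<in> I}"


section \<open>Products and subquotients of modules\<close>

text \<open>
  Module records extend ring records; the fields \<open>mult\<close> and \<open>one\<close> play no role in a module and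
  are left \<open>undefined\<close> below.
\<close>

definition prod_module :: "'i set \<Rightarrow> ('i \<Rightarrow> ('r, 'm, 'b) module_scheme) \<Rightarrow> ('r, 'i \<Rightarrow> 'm) module" where
  "prod_module I N =
    \<lparr> carrier = (\<Pi>\<^sub>E i\<in>I. carrier (N i)),
      monoid.mult = undefined, one = undefined,
      ring.zero = (\<lambda>i\<in>I. \<zero>\<^bsub>N i\<^esub>),
      add = (\<lambda>x y. \<lambda>i\<in>I. x i \<oplus>\<^bsub>N i\<^esub> y i),
      smult = (\<lambda>a x. \<lambda>i\<in>I. a \<odot>\<^bsub>N i\<^esub> x i) \<rparr>"

definition subquotient ::
    "('r, 'm, 'b) module_scheme \<Rightarrow> 'm set \<Rightarrow> 'm set \<Rightarrow> ('r, 'm set) module" where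
  "subquotient N Z U =
    \<lparr> carrier = (\<lambda>z. U +>\<^bsub>N\<^esub> z) ` Z,
      monoid.mult = undefined, one = undefined,
      ring.zero = U,
      add = set_add N,
      smult = (\<lambda>a V. \<Union>x\<in>V. U +>\<^bsub>N\<^esub> (a \<odot>\<^bsub>N\<^esub> x)) \<rparr>"

definition subquotient_grading ::
    "('r, 'm, 'b) module_scheme \<Rightarrow> ('g \<Rightarrow> 'm set) \<Rightarrow> 'm set \<Rightarrow> 'm set \<Rightarrow> 'g \<Rightarrow> 'm set set" where
  "subquotient_grading N NG Z U d = (\<lambda>z. U +>\<^bsub>N\<^esub> z) ` (Z \<inter> NG d)"

definition sgn_elt :: "('r, 'a) ring_scheme \<Rightarrow> nat \<Rightarrow> 'r" where
  "sgn_elt R k = (\<ominus>\<^bsub>R\<^esub> \<one>\<^bsub>R\<^esub>) [^]\<^bsub>R\<^esub> k"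


section \<open>The Koszul complex\<close>

text \<open>
  A chain of degree \<open>q\<close> is the family of coefficients of \<open>\<Sum>\<^sub>J c\<^sub>J e\<^sub>J\<close>, where \<open>J\<close> ranges over the
  \<open>q\<close>-element subsets of \<open>{..<r}\<close> and \<open>e\<^sub>J\<close> is the exterior product, in increasing order, of the
  basis vectors \<open>e\<^sub>j\<close> with \<open>j \<in> J\<close>. The vector \<open>e\<^sub>J\<close> has degree \<open>\<Sum>\<^sub>j\<^sub>\<in>\<^sub>J \<delta>\<^sub>j\<close>. The coefficient of \<open>e\<^sub>J\<close> in
  the boundary collects the terms of \<open>e\<^sub>J\<^sub>\<union>\<^sub>{\<^sub>t\<^sub>}\<close>, where \<open>t\<close> is preceded by \<open>card {u \<in> J. u < t}\<close> indices.
\<close>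

definition subsets_of_card :: "nat \<Rightarrow> nat \<Rightarrow> nat set set" where
  "subsets_of_card r q = {J. J \<subseteq> {..<r} \<and> card J = q}"

definition koszul :: "('r, 'm, 'b) module_scheme \<Rightarrow> nat \<Rightarrow> nat \<Rightarrow> ('r, nat set \<Rightarrow> 'm) module" where
  "koszul M r q = prod_module (subsets_of_card r q) (\<lambda>J. M)"

definition koszul_grading ::
    "('g::ab_group_add \<Rightarrow> 'm set) \<Rightarrow> (nat \<Rightarrow> 'g) \<Rightarrow> nat \<Rightarrow> nat \<Rightarrow> 'g \<Rightarrow> (nat set \<Rightarrow> 'm) set" where
  "koszul_grading MG \<delta> r q d = (\<Pi>\<^sub>E J\<in>subsets_of_card r q. MG (d - (\<Sum>j\<in>J. \<delta> j)))"

text \<open>The differential from degree \<open>q + 1\<close> to degree \<open>q\<close>.\<close>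

definition koszul_d ::
    "('r, 'a) ring_scheme \<Rightarrow> ('r, 'm, 'b) module_scheme \<Rightarrow> (nat \<Rightarrow> 'r) \<Rightarrow> nat \<Rightarrow> nat \<Rightarrow>
     (nat set \<Rightarrow> 'm) \<Rightarrow> nat set \<Rightarrow> 'm" where
  "koszul_d R M f r q c =
    (\<lambda>J\<in>subsets_of_card r q. \<Oplus>\<^bsub>M\<^esub>t\<in>{..<r} - J.
        (sgn_elt R (card {u\<in>J. u < t}) \<otimes>\<^bsub>R\<^esub> f t) \<odot>\<^bsub>M\<^esub> c (insert t J))"

definition koszul_cycles ::
    "('r, 'a) ring_scheme \<Rightarrow> ('r, 'm, 'b) module_scheme \<Rightarrow> (nat \<Rightarrow> 'r) \<Rightarrow> nat \<Rightarrow> nat \<Rightarrow>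
     (nat set \<Rightarrow> 'm) set" where
  "koszul_cycles R M f r q =
    (case q of
       0 \<Rightarrow> carrier (koszul M r 0)
     | Suc q' \<Rightarrow> {c \<in> carrier (koszul M r q). koszul_d R M f r q' c = \<zero>\<^bsub>koszul M r q'\<^esub>})"

definition koszul_boundaries ::
    "('r, 'a) ring_scheme \<Rightarrow> ('r, 'm, 'b) module_scheme \<Rightarrow> (nat \<Rightarrow> 'r) \<Rightarrow> nat \<Rightarrow> nat \<Rightarrow>
     (nat set \<Rightarrow> 'm) set" where
  "koszul_boundaries R M f r q = koszul_d R M f r q ` carrier (koszul M r (Suc q))"

definition koszul_homology ::
    "('r, 'a) ring_scheme \<Rightarrow> ('r, 'm, 'b) module_scheme \<Rightarrow> (nat \<Rightarrow> 'r) \<Rightarrow> nat \<Rightarrow> nat \<Rightarrow>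
     ('r, (nat set \<Rightarrow> 'm) set) module" where
  "koszul_homology R M f r q =
    subquotient (koszul M r q) (koszul_cycles R M f r q) (koszul_boundaries R M f r q)"

definition koszul_homology_grading ::
    "('r, 'a) ring_scheme \<Rightarrow> ('r, 'm, 'b) module_scheme \<Rightarrow> ('g::ab_group_add \<Rightarrow> 'm set) \<Rightarrow>
     (nat \<Rightarrow> 'r) \<Rightarrow> (nat \<Rightarrow> 'g) \<Rightarrow> nat \<Rightarrow> nat \<Rightarrow> 'g \<Rightarrow> (nat set \<Rightarrow> 'm) set set" where
  "koszul_homology_grading R M MG f \<delta> r q =
    subquotient_grading (koszul M r q) (koszul_grading MG \<delta> r q)
      (koszul_cycles R M f r q) (koszul_boundaries R M f r q)"

definition koszul_shifts :: "(nat \<Rightarrow> 'g::ab_group_add) \<Rightarrow> nat \<Rightarrow> nat \<Rightarrow> 'g set" where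
  "koszul_shifts \<delta> r i = {\<Sum>j\<in>J. \<delta> j | J. J \<in> subsets_of_card r i}"


section \<open>Localization at an element\<close>

text \<open>The fraction \<open>x / h\<^sup>k\<close> of \<open>M\<^sub>h\<close> is the equivalence class of the pair \<open>(x, k)\<close>.\<close>

definition loc_rel ::
    "('r, 'a) ring_scheme \<Rightarrow> ('r, 'm, 'b) module_scheme \<Rightarrow> 'r \<Rightarrow> (('m \<times> nat) \<times> ('m \<times> nat)) set" where
  "loc_rel R M h = {((x, k), (y, l)). x \<in> carrier M \<and> y \<in> carrier M \<and>
     (\<exists>e::nat. (h [^]\<^bsub>R\<^esub> (e + l)) \<odot>\<^bsub>M\<^esub> x = (h [^]\<^bsub>R\<^esub> (e + k)) \<odot>\<^bsub>M\<^esub> y)}"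

definition loc_frac ::
    "('r, 'a) ring_scheme \<Rightarrow> ('r, 'm, 'b) module_scheme \<Rightarrow> 'r \<Rightarrow> 'm \<Rightarrow> nat \<Rightarrow> ('m \<times> nat) set" where
  "loc_frac R M h x k = loc_rel R M h `` {(x, k)}"

text \<open>
  Operations on classes are written as unions over representatives, as in
  \<^theory>\<open>HOL.Equiv_Relations\<close>: all members of each union coincide.
\<close>

definition localization ::
    "('r, 'a) ring_scheme \<Rightarrow> ('r, 'm, 'b) module_scheme \<Rightarrow> 'r \<Rightarrow> ('r, ('m \<times> nat) set) module" where
  "localization R M h =
    \<lparr> carrier = {loc_frac R M h x k | x k. x \<in> carrier M},
      monoid.mult = undefined, one = undefined,
      ring.zero = loc_frac R M h \<zero>\<^bsub>M\<^esub> 0,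
      add = (\<lambda>V W. \<Union>(x, k)\<in>V. \<Union>(y, l)\<in>W.
               loc_frac R M h ((h [^]\<^bsub>R\<^esub> l) \<odot>\<^bsub>M\<^esub> x \<oplus>\<^bsub>M\<^esub> (h [^]\<^bsub>R\<^esub> k) \<odot>\<^bsub>M\<^esub> y) (k + l)),
      smult = (\<lambda>a V. \<Union>(x, k)\<in>V. loc_frac R M h (a \<odot>\<^bsub>M\<^esub> x) k) \<rparr>"

text \<open>
  For homogeneous \<open>h\<close>, the fraction \<open>x / h\<^sup>k\<close> has degree \<open>d\<close> if \<open>x\<close> has degree \<open>d + deg (h\<^sup>k)\<close>. If
  \<open>h\<^sup>k = 0\<close>, its degree \<open>e\<close> is not unique, but then \<open>M\<^sub>h = 0\<close>.
\<close>

definition localization_grading ::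
    "('r, 'a) ring_scheme \<Rightarrow> ('g::ab_group_add \<Rightarrow> 'r set) \<Rightarrow>
     ('r, 'm, 'b) module_scheme \<Rightarrow> ('g \<Rightarrow> 'm set) \<Rightarrow> 'r \<Rightarrow> 'g \<Rightarrow> ('m \<times> nat) set set" where
  "localization_grading R RG M MG h d =
    {loc_frac R M h x k | x k e. h [^]\<^bsub>R\<^esub> k \<in> RG e \<and> x \<in> MG (d + e)}"

text \<open>The localization map from \<open>M\<^sub>h\<close> to \<open>M\<^sub>h\<^sub>u\<close>, sending \<open>x / h\<^sup>k\<close> to \<open>u\<^sup>k x / (h u)\<^sup>k\<close>.\<close>

definition loc_map ::
    "('r, 'a) ring_scheme \<Rightarrow> ('r, 'm, 'b) module_scheme \<Rightarrow> 'r \<Rightarrow> 'r \<Rightarrow>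
     ('m \<times> nat) set \<Rightarrow> ('m \<times> nat) set" where
  "loc_map R M h u V = (\<Union>(x, k)\<in>V. loc_frac R M (h \<otimes>\<^bsub>R\<^esub> u) ((u [^]\<^bsub>R\<^esub> k) \<odot>\<^bsub>M\<^esub> x) k)"


section \<open>The Cech complex\<close>

text \<open>
  The Cech complex on \<open>g\<^sub>0, \<dots>, g\<^sub>s\<^sub>-\<^sub>1\<close> has in degree \<open>p\<close> the product of the localizations of \<open>M\<close> at
  \<open>\<Prod>\<^sub>i\<^sub>\<in>\<^sub>A g\<^sub>i\<close>, where \<open>A\<close> ranges over the \<open>p\<close>-element subsets of \<open>{..<s}\<close>. It begins with \<open>M\<^sub>1 = M\<close> in
  degree 0, so its cohomology in degree 0 is the torsion of \<open>M\<close> with respect to the \<open>g\<^sub>i\<close>, not the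
  sections on the complement of their zero set.
\<close>

definition cech_loc ::
    "('r, 'a) ring_scheme \<Rightarrow> ('r, 'm, 'b) module_scheme \<Rightarrow> (nat \<Rightarrow> 'r) \<Rightarrow> nat set \<Rightarrow>
     ('r, ('m \<times> nat) set) module" where
  "cech_loc R M g A = localization R M (\<Otimes>\<^bsub>R\<^esub>i\<in>A. g i)"

definition cech ::
    "('r, 'a) ring_scheme \<Rightarrow> ('r, 'm, 'b) module_scheme \<Rightarrow> (nat \<Rightarrow> 'r) \<Rightarrow> nat \<Rightarrow> nat \<Rightarrow>
     ('r, nat set \<Rightarrow> ('m \<times> nat) set) module" where
  "cech R M g s p = prod_module (subsets_of_card s p) (cech_loc R M g)"

definition cech_grading ::
    "('r, 'a) ring_scheme \<Rightarrow> ('g::ab_group_add \<Rightarrow> 'r set) \<Rightarrow>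
     ('r, 'm, 'b) module_scheme \<Rightarrow> ('g \<Rightarrow> 'm set) \<Rightarrow> (nat \<Rightarrow> 'r) \<Rightarrow> nat \<Rightarrow> nat \<Rightarrow>
     'g \<Rightarrow> (nat set \<Rightarrow> ('m \<times> nat) set) set" where
  "cech_grading R RG M MG g s p d =
    (\<Pi>\<^sub>E A\<in>subsets_of_card s p. localization_grading R RG M MG (\<Otimes>\<^bsub>R\<^esub>i\<in>A. g i) d)"

text \<open>The differential from degree \<open>p\<close> to degree \<open>p + 1\<close>.\<close>

definition cech_d ::
    "('r, 'a) ring_scheme \<Rightarrow> ('r, 'm, 'b) module_scheme \<Rightarrow> (nat \<Rightarrow> 'r) \<Rightarrow> nat \<Rightarrow> nat \<Rightarrow>
     (nat set \<Rightarrow> ('m \<times> nat) set) \<Rightarrow> nat set \<Rightarrow> ('m \<times> nat) set" where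
  "cech_d R M g s p c =
    (\<lambda>A\<in>subsets_of_card s (Suc p). \<Oplus>\<^bsub>cech_loc R M g A\<^esub>t\<in>A.
        sgn_elt R (card {u\<in>A. u < t}) \<odot>\<^bsub>cech_loc R M g A\<^esub>
          loc_map R M (\<Otimes>\<^bsub>R\<^esub>i\<in>A - {t}. g i) (g t) (c (A - {t})))"

definition cech_cocycles ::
    "('r, 'a) ring_scheme \<Rightarrow> ('r, 'm, 'b) module_scheme \<Rightarrow> (nat \<Rightarrow> 'r) \<Rightarrow> nat \<Rightarrow> nat \<Rightarrow>
     (nat set \<Rightarrow> ('m \<times> nat) set) set" where
  "cech_cocycles R M g s p =
    {c \<in> carrier (cech R M g s p). cech_d R M g s p c = \<zero>\<^bsub>cech R M g s (Suc p)\<^esub>}"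

definition cech_coboundaries ::
    "('r, 'a) ring_scheme \<Rightarrow> ('r, 'm, 'b) module_scheme \<Rightarrow> (nat \<Rightarrow> 'r) \<Rightarrow> nat \<Rightarrow> nat \<Rightarrow>
     (nat set \<Rightarrow> ('m \<times> nat) set) set" where
  "cech_coboundaries R M g s p =
    (case p of
       0 \<Rightarrow> {\<zero>\<^bsub>cech R M g s 0\<^esub>}
     | Suc p' \<Rightarrow> cech_d R M g s p' ` carrier (cech R M g s p'))"

definition cech_cohomology ::
    "('r, 'a) ring_scheme \<Rightarrow> ('r, 'm, 'b) module_scheme \<Rightarrow> (nat \<Rightarrow> 'r) \<Rightarrow> nat \<Rightarrow> nat \<Rightarrow>
     ('r, (nat set \<Rightarrow> ('m \<times> nat) set) set) module" where
  "cech_cohomology R M g s p =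
    subquotient (cech R M g s p) (cech_cocycles R M g s p) (cech_coboundaries R M g s p)"

definition cech_cohomology_grading ::
    "('r, 'a) ring_scheme \<Rightarrow> ('g::ab_group_add \<Rightarrow> 'r set) \<Rightarrow>
     ('r, 'm, 'b) module_scheme \<Rightarrow> ('g \<Rightarrow> 'm set) \<Rightarrow> (nat \<Rightarrow> 'r) \<Rightarrow> nat \<Rightarrow> nat \<Rightarrow>
     'g \<Rightarrow> (nat set \<Rightarrow> ('m \<times> nat) set) set set" where
  "cech_cohomology_grading R RG M MG g s p =
    subquotient_grading (cech R M g s p) (cech_grading R RG M MG g s p)
      (cech_cocycles R M g s p) (cech_coboundaries R M g s p)"

end

theory Submission
  imports Defs
begin

text \<open>
  The proof compares the two ways of computing the homology of the double complex that has at the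
  place \<open>(p, q)\<close> the Cech cochains of degree \<open>p\<close> with values in the Koszul chains of degree \<open>q\<close>,
  that is, the product of the localizations \<open>M\<^sub>g\<^sub>A\<close>, shifted by \<open>\<Sum>\<^sub>j\<^sub>\<in>\<^sub>J \<delta>\<^sub>j\<close>, over all \<open>A\<close> with \<open>p\<close> and
  \<open>J\<close> with \<open>q\<close> elements, where \<open>g\<^sub>A = \<Prod>\<^sub>i\<^sub>\<in>\<^sub>A g\<^sub>i\<close>. Only its part of a fixed degree \<open>d\<close> is considered.

  In the Koszul direction the columns with \<open>p > 0\<close> are exact: for non-empty \<open>A\<close> some power of \<open>g\<^sub>A\<close> lies
  in \<open>I + ann(M)\<close>, and multiplication by an element of this ideal maps Koszul cycles to boundaries
  (\<open>koszul_boundary_smult\<close>); but \<open>g\<^sub>A\<close> acts bijectively on \<open>M\<^sub>g\<^sub>A\<close>. The column \<open>p = 0\<close> is the Koszul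
  complex of \<open>M\<close>. Hence the total complex computes the Koszul homology of \<open>M\<close>.

  In the Cech direction the row \<open>q\<close> has at \<open>(p, q)\<close> the cohomology \<open>H\<^sup>p\<^sub>B(M)\<close> in the degrees
  \<open>d - \<Sum>\<^sub>j\<^sub>\<in>\<^sub>J \<delta>\<^sub>j\<close> with \<open>card J = q\<close>. The total degree \<open>j\<close> consists of the places \<open>(p, j + p)\<close>. If \<open>d\<close> is
  not in the union on the right hand side, all these cohomology groups vanish, so the total homology
  of degree \<open>j\<close> vanishes, and with it the component of degree \<open>d\<close> of the Koszul homology. Instead of
  spectral sequences, \<open>double_complex_cycle_is_boundary\<close> performs the underlying diagram chase.

  The chase needs preimages that are homogeneous, whereas exactness of the ungraded complexes provides
  arbitrary ones. They are replaced by their homogeneous components: a localization at a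
  homogeneous element has additive projections \<open>loc_hcomp\<close> onto its graded pieces, and these commute
  with both differentials (\<open>Lcomp_cech_d\<close>, \<open>Lcomp_koszul_d\<close>).
\<close>

section \<open>Homomorphisms and sums in abelian groups\<close>

lemma abelian_group_homI_add:
  assumes "abelian_group G" "abelian_group H"
    and "\<And>x. x \<in> carrier G \<Longrightarrow> h x \<in> carrier H"
    and "\<And>x y. x \<in> carrier G \<Longrightarrow> y \<in> carrier G \<Longrightarrow> h (x \<oplus>\<^bsub>G\<^esub> y) = h x \<oplus>\<^bsub>H\<^esub> h y"
  shows "abelian_group_hom G H h"
proof -
  interpret G: abelian_group G by fact
  interpret H: abelian_group H by fact
  show ?thesis
    by (intro abelian_group_homI assms(1,2) group_hom.intro group_hom_axioms.intro
        G.a_group H.a_group) (auto simp: hom_def assms)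
qed

lemma (in abelian_group_hom) hom_finsum:
  "u \<in> A \<rightarrow> carrier G \<Longrightarrow> h (\<Oplus>\<^bsub>G\<^esub>i\<in>A. u i) = (\<Oplus>\<^bsub>H\<^esub>i\<in>A. h (u i))"
  by (induction A rule: infinite_finite_induct)
    (simp_all add: Pi_def H.finsum_infinite G.finsum_infinite)

text \<open>
  Both squares of differentials vanish for this reason: they are sums over ordered pairs of
  distinct indices whose terms change sign when the pair is reversed. The terms are cancelled in
  pairs, so that 2 may be a zero divisor.
\<close>

lemma (in abelian_group) finsum_antisymmetric:
  assumes "finite A"
    and "\<And>t u. t \<in> A \<Longrightarrow> u \<in> A \<Longrightarrow> t \<noteq> u \<Longrightarrow> \<Phi> t u \<in> carrier G"
    and "\<And>t u. t \<in> A \<Longrightarrow> u \<in> A \<Longrightarrow> t \<noteq> u \<Longrightarrow> \<Phi> t u \<oplus> \<Phi> u t = \<zero>"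
  shows "(\<Oplus>t\<in>A. \<Oplus>u\<in>A - {t}. \<Phi> t u) = \<zero>"
  using assms
proof (induction A rule: finite_induct)
  case empty
  then show ?case by simp
next
  case (insert x A)
  have cl: "\<Phi> t u \<in> carrier G" if "t \<in> insert x A" "u \<in> insert x A" "t \<noteq> u" for t u
    using insert.prems(1) that by blast
  have IH: "(\<Oplus>t\<in>A. \<Oplus>u\<in>A - {t}. \<Phi> t u) = \<zero>"
    using insert by simp
  have row: "(\<Oplus>u\<in>insert x A - {t}. \<Phi> t u) = \<Phi> t x \<oplus> (\<Oplus>u\<in>A - {t}. \<Phi> t u)" if "t \<in> A" for t
  proof -
    have "insert x A - {t} = insert x (A - {t})" using that insert.hyps by auto
    then show ?thesis using insert.hyps that by (auto intro!: finsum_insert cl simp: Pi_def)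
  qed
  have "(\<Oplus>t\<in>insert x A. \<Oplus>u\<in>insert x A - {t}. \<Phi> t u)
      = (\<Oplus>u\<in>insert x A - {x}. \<Phi> x u) \<oplus> (\<Oplus>t\<in>A. \<Oplus>u\<in>insert x A - {t}. \<Phi> t u)"
    using insert.hyps by (intro finsum_insert) (auto intro!: finsum_closed cl simp: Pi_def)
  also have "insert x A - {x} = A" using insert.hyps by auto
  also have "(\<Oplus>t\<in>A. \<Oplus>u\<in>insert x A - {t}. \<Phi> t u) = (\<Oplus>t\<in>A. \<Phi> t x \<oplus> (\<Oplus>u\<in>A - {t}. \<Phi> t u))"
    using insert.hyps row by (intro finsum_cong') (auto intro!: a_closed finsum_closed cl simp: Pi_def)
  also have "\<dots> = (\<Oplus>t\<in>A. \<Phi> t x) \<oplus> (\<Oplus>t\<in>A. \<Oplus>u\<in>A - {t}. \<Phi> t u)"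
    using insert.hyps by (intro finsum_addf) (auto intro!: finsum_closed cl simp: Pi_def)
  also have "\<dots> = (\<Oplus>t\<in>A. \<Phi> t x)"
    unfolding IH using insert.hyps by (intro r_zero finsum_closed) (auto intro!: cl simp: Pi_def)
  also have "(\<Oplus>u\<in>A. \<Phi> x u) \<oplus> (\<Oplus>t\<in>A. \<Phi> t x) = (\<Oplus>u\<in>A. \<Phi> x u \<oplus> \<Phi> u x)"
    using insert.hyps by (intro finsum_addf[symmetric]) (auto intro!: cl simp: Pi_def)
  also have "\<dots> = (\<Oplus>u\<in>A. \<zero>)"
    using insert.hyps by (intro finsum_cong') (auto intro!: insert.prems(2))
  finally show ?case by simp
qed

lemma prod_module_simps [simp]:
  "carrier (prod_module I N) = (\<Pi>\<^sub>E i\<in>I. carrier (N i))"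
  "\<zero>\<^bsub>prod_module I N\<^esub> = (\<lambda>i\<in>I. \<zero>\<^bsub>N i\<^esub>)"
  "x \<oplus>\<^bsub>prod_module I N\<^esub> y = (\<lambda>i\<in>I. x i \<oplus>\<^bsub>N i\<^esub> y i)"
  by (simp_all add: prod_module_def)

lemma abelian_group_prod_module:
  assumes "\<And>i. i \<in> I \<Longrightarrow> abelian_group (N i)"
  shows "abelian_group (prod_module I N)"
proof (rule abelian_groupI)
  note G = abelian_groupE[OF assms]
  fix x assume x: "x \<in> carrier (prod_module I N)"
  then have x_in: "x i \<in> carrier (N i)" if "i \<in> I" for i
    using that by (auto dest: PiE_mem)
  show "\<zero>\<^bsub>prod_module I N\<^esub> \<oplus>\<^bsub>prod_module I N\<^esub> x = x"
  proof
    fix i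
    show "(\<zero>\<^bsub>prod_module I N\<^esub> \<oplus>\<^bsub>prod_module I N\<^esub> x) i = x i"
      using G(5) x_in PiE_arb[OF x[unfolded prod_module_simps]] by (cases "i \<in> I") simp_all
  qed
  have "\<forall>i\<in>I. \<exists>y. y \<in> carrier (N i) \<and> y \<oplus>\<^bsub>N i\<^esub> x i = \<zero>\<^bsub>N i\<^esub>"
    using x_in G(6) by blast
  from bchoice[OF this]
  obtain y where "\<forall>i\<in>I. y i \<in> carrier (N i) \<and> y i \<oplus>\<^bsub>N i\<^esub> x i = \<zero>\<^bsub>N i\<^esub>" by blast
  then show "\<exists>y\<in>carrier (prod_module I N). y \<oplus>\<^bsub>prod_module I N\<^esub> x = \<zero>\<^bsub>prod_module I N\<^esub>"
    by (intro bexI[of _ "restrict y I"]) (auto cong: restrict_cong)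
qed (use abelian_groupE(1-4)[OF assms] in \<open>auto simp: PiE_iff intro!: restrict_ext\<close>)

section \<open>Signs\<close>

lemma (in ring) sgn_elt_closed [simp]: "sgn_elt R k \<in> carrier R"
  by (simp add: sgn_elt_def)

lemma (in ring) sgn_elt_add: "sgn_elt R (k + l) = sgn_elt R k \<otimes> sgn_elt R l"
  by (simp add: sgn_elt_def nat_pow_mult)

lemma (in ring) sgn_elt_parity: "sgn_elt R k = (if even k then \<one> else \<ominus> \<one>)"
  by (induction k) (auto simp: sgn_elt_def l_minus)

lemma (in module) smult_sgn_elt:
  "x \<in> carrier M \<Longrightarrow> sgn_elt R k \<odot>\<^bsub>M\<^esub> x = (if even k then x else \<ominus>\<^bsub>M\<^esub> x)"
  by (simp add: R.sgn_elt_parity smult_l_minus)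

lemma hom_smult_sgn_elt:
  assumes "module R M" "module R N" "abelian_group_hom M N \<phi>" "x \<in> carrier M"
  shows "\<phi> (sgn_elt R k \<odot>\<^bsub>M\<^esub> x) = sgn_elt R k \<odot>\<^bsub>N\<^esub> \<phi> x"
proof -
  interpret abelian_group_hom M N \<phi> by fact
  show ?thesis using assms by (simp add: module.smult_sgn_elt)
qed

text \<open>
  With \<open>\<epsilon>\<^sub>J(t)\<close> the sign of the number of elements of \<open>J\<close> below \<open>t\<close>, adding \<open>t\<close> to \<open>J\<close> changes
  \<open>\<epsilon>(u)\<close> if \<open>t < u\<close>, and adding \<open>u\<close> changes \<open>\<epsilon>(t)\<close> if \<open>u < t\<close>: exactly one of the two happens.
\<close>

lemma (in ring) sgn_elt_swap:
  assumes "finite J" "t \<notin> J" "u \<notin> J" "t \<noteq> u"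
  shows "sgn_elt R (card {v\<in>J. v < t}) \<otimes> sgn_elt R (card {v\<in>insert t J. v < u})
    = \<ominus> (sgn_elt R (card {v\<in>J. v < u}) \<otimes> sgn_elt R (card {v\<in>insert u J. v < (t::nat)}))"
proof -
  have count: "card {v\<in>insert a J. v < b} = card {v\<in>J. v < b} + (if a < b then 1 else 0)"
    if "a \<notin> J" for a b
  proof -
    have "{v\<in>insert a J. v < b} = (if a < b then insert a {v\<in>J. v < b} else {v\<in>J. v < b})" by auto
    then show ?thesis using assms(1) that by simp
  qed
  show ?thesis
    unfolding sgn_elt_add[symmetric] count[OF assms(2)] count[OF assms(3)]
    using assms(4) by (cases "t < u") (auto simp: sgn_elt_parity)
qed

section \<open>The Koszul complex of a module\<close>

lemma subsets_of_cardD: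
  assumes "J \<in> subsets_of_card r q"
  shows "J \<subseteq> {..<r}" "finite J" "card J = q"
  using assms finite_subset[of J "{..<r}"] by (auto simp: subsets_of_card_def)

lemma subsets_of_card_insert:
  assumes "J \<in> subsets_of_card r q" "t \<in> {..<r} - J"
  shows "insert t J \<in> subsets_of_card r (Suc q)"
  using assms subsets_of_cardD[OF assms(1)] by (auto simp: subsets_of_card_def)

lemma subsets_of_card_remove:
  assumes "J \<in> subsets_of_card r (Suc q)" "t \<in> J"
  shows "J - {t} \<in> subsets_of_card r q"
  using assms subsets_of_cardD[OF assms(1)] by (auto simp: subsets_of_card_def)

locale koszul_module = module R M for R (structure) and M (structure) +
  fixes f :: "nat \<Rightarrow> 'a" and r :: nat
  assumes f_closed: "t < r \<Longrightarrow> f t \<in> carrier R"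
begin

lemma koszul_d_eq:
  assumes "J \<in> subsets_of_card r q" "\<forall>K\<in>subsets_of_card r (Suc q). c K \<in> carrier M"
  shows "koszul_d R M f r q c J
    = (\<Oplus>\<^bsub>M\<^esub>t\<in>{..<r} - J. sgn_elt R (card {u\<in>J. u < t}) \<odot>\<^bsub>M\<^esub> (f t \<odot>\<^bsub>M\<^esub> c (insert t J)))"
  unfolding koszul_d_def using assms subsets_of_card_insert[OF assms(1)]
  by (auto intro!: M.finsum_cong' simp: f_closed smult_assoc1)

lemma koszul_d_closed:
  assumes "J \<in> subsets_of_card r q" "\<forall>K\<in>subsets_of_card r (Suc q). c K \<in> carrier M"
  shows "koszul_d R M f r q c J \<in> carrier M"
  unfolding koszul_d_eq[OF assms] using assms subsets_of_card_insert[OF assms(1)]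
  by (auto intro!: M.finsum_closed simp: f_closed)

lemma koszul_d_cong:
  assumes "\<And>K. K \<in> subsets_of_card r (Suc q) \<Longrightarrow> c K = c' K"
    and "\<forall>K\<in>subsets_of_card r (Suc q). c K \<in> carrier M"
  shows "koszul_d R M f r q c = koszul_d R M f r q c'"
proof
  fix J
  show "koszul_d R M f r q c J = koszul_d R M f r q c' J"
  proof (cases "J \<in> subsets_of_card r q")
    case True
    then show ?thesis
      using assms subsets_of_card_insert[OF True]
      by (simp add: koszul_d_eq cong: if_cong) (auto intro!: M.finsum_cong' simp: f_closed)
  qed (simp add: koszul_d_def)
qed

lemma koszul_d_add:
  assumes "J \<in> subsets_of_card r q"
    and c: "\<forall>K\<in>subsets_of_card r (Suc q). c K \<in> carrier M"
    and c': "\<forall>K\<in>subsets_of_card r (Suc q). c' K \<in> carrier M"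
  shows "koszul_d R M f r q (\<lambda>K. c K \<oplus>\<^bsub>M\<^esub> c' K) J
    = koszul_d R M f r q c J \<oplus>\<^bsub>M\<^esub> koszul_d R M f r q c' J"
proof -
  have cl: "\<forall>K\<in>subsets_of_card r (Suc q). c K \<oplus>\<^bsub>M\<^esub> c' K \<in> carrier M"
    using c c' by simp
  have "koszul_d R M f r q (\<lambda>K. c K \<oplus>\<^bsub>M\<^esub> c' K) J
    = (\<Oplus>\<^bsub>M\<^esub>t\<in>{..<r} - J. sgn_elt R (card {u\<in>J. u < t}) \<odot>\<^bsub>M\<^esub> (f t \<odot>\<^bsub>M\<^esub> c (insert t J))
        \<oplus>\<^bsub>M\<^esub> sgn_elt R (card {u\<in>J. u < t}) \<odot>\<^bsub>M\<^esub> (f t \<odot>\<^bsub>M\<^esub> c' (insert t J)))"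
    unfolding koszul_d_eq[OF assms(1) cl] using c c' subsets_of_card_insert[OF assms(1)]
    by (intro M.finsum_cong') (auto simp: f_closed smult_r_distr)
  also have "\<dots> = koszul_d R M f r q c J \<oplus>\<^bsub>M\<^esub> koszul_d R M f r q c' J"
    unfolding koszul_d_eq[OF assms(1) c] koszul_d_eq[OF assms(1) c']
    using c c' subsets_of_card_insert[OF assms(1)]
    by (intro M.finsum_addf) (auto simp: f_closed)
  finally show ?thesis .
qed

lemma koszul_d_zero:
  assumes "J \<in> subsets_of_card r q"
  shows "koszul_d R M f r q (\<lambda>K. \<zero>\<^bsub>M\<^esub>) J = \<zero>\<^bsub>M\<^esub>"
  unfolding koszul_d_eq[OF assms, of "\<lambda>K. \<zero>\<^bsub>M\<^esub>", simplified] by (simp add: f_closed cong: M.finsum_cong)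

lemma koszul_d_finsum:
  assumes "J \<in> subsets_of_card r q" "finite A"
    and "\<And>i. i \<in> A \<Longrightarrow> \<forall>K\<in>subsets_of_card r (Suc q). c i K \<in> carrier M"
  shows "koszul_d R M f r q (\<lambda>K. \<Oplus>\<^bsub>M\<^esub>i\<in>A. c i K) J = (\<Oplus>\<^bsub>M\<^esub>i\<in>A. koszul_d R M f r q (c i) J)"
  using assms(2,3)
proof (induction A rule: finite_induct)
  case empty
  then show ?case by (simp add: koszul_d_zero[OF assms(1)])
next
  case (insert x A)
  have cl: "\<forall>K\<in>subsets_of_card r (Suc q). (\<Oplus>\<^bsub>M\<^esub>i\<in>A. c i K) \<in> carrier M"
    using insert.prems by (auto intro!: M.finsum_closed)
  have ins: "(\<Oplus>\<^bsub>M\<^esub>i\<in>insert x A. c i K) = c x K \<oplus>\<^bsub>M\<^esub> (\<Oplus>\<^bsub>M\<^esub>i\<in>A. c i K)"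
    if "K \<in> subsets_of_card r (Suc q)" for K
    using insert.hyps insert.prems that by (intro M.finsum_insert) auto
  have "koszul_d R M f r q (\<lambda>K. \<Oplus>\<^bsub>M\<^esub>i\<in>insert x A. c i K) J
      = koszul_d R M f r q (\<lambda>K. c x K \<oplus>\<^bsub>M\<^esub> (\<Oplus>\<^bsub>M\<^esub>i\<in>A. c i K)) J"
    using insert.prems cl by (intro fun_cong[OF koszul_d_cong] ballI) (simp_all add: ins)
  also have "\<dots> = koszul_d R M f r q (c x) J \<oplus>\<^bsub>M\<^esub> (\<Oplus>\<^bsub>M\<^esub>i\<in>A. koszul_d R M f r q (c i) J)"
    using insert cl by (simp add: koszul_d_add[OF assms(1)])
  also have "\<dots> = (\<Oplus>\<^bsub>M\<^esub>i\<in>insert x A. koszul_d R M f r q (c i) J)"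
    using insert.hyps insert.prems
    by (intro M.finsum_insert[symmetric]) (auto intro!: koszul_d_closed[OF assms(1)])
  finally show ?case .
qed

text \<open>
  The coefficients of a chain may be moved by a different map for each index set, as needed for
  the projections to homogeneous components, whose degree depends on the index set.
\<close>

lemma koszul_d_natural:
  assumes N: "module R N"
    and hom: "\<And>J. J \<subseteq> {..<r} \<Longrightarrow> abelian_group_hom M N (\<phi> J)"
    and lin: "\<And>J t x. J \<subseteq> {..<r} \<Longrightarrow> t \<in> {..<r} - J \<Longrightarrow> x \<in> carrier M \<Longrightarrow>
      \<phi> J (f t \<odot>\<^bsub>M\<^esub> x) = f t \<odot>\<^bsub>N\<^esub> \<phi> (insert t J) x"
    and J: "J \<in> subsets_of_card r q"
    and c: "\<forall>K\<in>subsets_of_card r (Suc q). c K \<in> carrier M"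
  shows "\<phi> J (koszul_d R M f r q c J) = koszul_d R N f r q (\<lambda>K. \<phi> K (c K)) J"
proof -
  interpret N: koszul_module R N f r
    by (intro koszul_module.intro N koszul_module_axioms.intro f_closed)
  have hom': "abelian_group_hom M N (\<phi> K)" if "K \<in> subsets_of_card r p" for K p
    using hom subsets_of_cardD(1)[OF that] .
  interpret \<phi>: abelian_group_hom M N "\<phi> J" using hom'[OF J] .
  have c': "\<forall>K\<in>subsets_of_card r (Suc q). \<phi> K (c K) \<in> carrier N"
    using c hom' abelian_group_hom.hom_closed by fastforce
  have ins: "insert t J \<in> subsets_of_card r (Suc q)" if "t \<in> {..<r} - J" for t
    using subsets_of_card_insert[OF J that] .
  have "\<phi> J (koszul_d R M f r q c J)
      = (\<Oplus>\<^bsub>N\<^esub>t\<in>{..<r} - J. \<phi> J (sgn_elt R (card {u\<in>J. u < t}) \<odot>\<^bsub>M\<^esub> (f t \<odot>\<^bsub>M\<^esub> c (insert t J))))"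
    unfolding koszul_d_eq[OF J c] using c ins
    by (intro \<phi>.hom_finsum) (auto simp: f_closed)
  also have "\<dots> = koszul_d R N f r q (\<lambda>K. \<phi> K (c K)) J"
    unfolding N.koszul_d_eq[OF J c']
  proof (intro N.M.finsum_cong')
    fix t assume t: "t \<in> {..<r} - J"
    have "c (insert t J) \<in> carrier M" using c ins[OF t] by blast
    then show "\<phi> J (sgn_elt R (card {u\<in>J. u < t}) \<odot>\<^bsub>M\<^esub> (f t \<odot>\<^bsub>M\<^esub> c (insert t J)))
        = sgn_elt R (card {u\<in>J. u < t}) \<odot>\<^bsub>N\<^esub> (f t \<odot>\<^bsub>N\<^esub> \<phi> (insert t J) (c (insert t J)))"
      using t lin[OF subsets_of_cardD(1)[OF J] t]
        hom_smult_sgn_elt[OF module_axioms N \<phi>.abelian_group_hom_axioms]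
      by (simp add: f_closed)
  qed (use c' ins f_closed in auto)
  finally show ?thesis .
qed

lemma koszul_d_smult:
  assumes "J \<in> subsets_of_card r q" "\<forall>K\<in>subsets_of_card r (Suc q). c K \<in> carrier M"
    and a: "a \<in> carrier R"
  shows "a \<odot>\<^bsub>M\<^esub> koszul_d R M f r q c J = koszul_d R M f r q (\<lambda>K. a \<odot>\<^bsub>M\<^esub> c K) J"
proof (rule koszul_d_natural[OF module_axioms _ _ assms(1,2), of "\<lambda>_ x. a \<odot>\<^bsub>M\<^esub> x"])
  show "abelian_group_hom M M (\<lambda>x. a \<odot>\<^bsub>M\<^esub> x)"
    using a by (intro abelian_group_homI_add M.abelian_group_axioms) (auto simp: smult_r_distr)
  show "a \<odot>\<^bsub>M\<^esub> (f t \<odot>\<^bsub>M\<^esub> x) = f t \<odot>\<^bsub>M\<^esub> (a \<odot>\<^bsub>M\<^esub> x)" if "t \<in> {..<r} - J" "x \<in> carrier M" for J t x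
    using that a f_closed[of t] by (simp add: smult_assoc1[symmetric] R.m_comm)
qed

lemma koszul_d_square:
  assumes J: "J \<in> subsets_of_card r q"
    and c: "\<forall>K\<in>subsets_of_card r (Suc (Suc q)). c K \<in> carrier M"
  shows "koszul_d R M f r q (koszul_d R M f r (Suc q) c) J = \<zero>\<^bsub>M\<^esub>"
proof -
  define \<epsilon> where "\<epsilon> K t = sgn_elt R (card {u\<in>K. u < t})" for K :: "nat set" and t
  define \<Phi> where "\<Phi> t u = (\<epsilon> J t \<otimes> \<epsilon> (insert t J) u) \<odot>\<^bsub>M\<^esub> ((f t \<otimes> f u) \<odot>\<^bsub>M\<^esub> c (insert u (insert t J)))"
    for t u
  let ?A = "{..<r} - J"
  have ins: "c (insert u (insert t J)) \<in> carrier M" if "t \<in> ?A" "u \<in> ?A" "t \<noteq> u" for t u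
    using subsets_of_card_insert[OF subsets_of_card_insert[OF J that(1)], of u] c that by blast
  have \<epsilon>: "\<epsilon> K t \<in> carrier R" for K t by (simp add: \<epsilon>_def)
  have \<Phi>: "\<Phi> t u \<in> carrier M" if "t \<in> ?A" "u \<in> ?A" "t \<noteq> u" for t u
    using ins[OF that] that by (simp add: \<Phi>_def f_closed \<epsilon>)
  have "koszul_d R M f r q (koszul_d R M f r (Suc q) c) J
    = (\<Oplus>\<^bsub>M\<^esub>t\<in>?A. \<epsilon> J t \<odot>\<^bsub>M\<^esub> (f t \<odot>\<^bsub>M\<^esub> koszul_d R M f r (Suc q) c (insert t J)))"
    unfolding \<epsilon>_def by (intro koszul_d_eq J ballI koszul_d_closed c)
  also have "\<dots> = (\<Oplus>\<^bsub>M\<^esub>t\<in>?A. \<Oplus>\<^bsub>M\<^esub>u\<in>?A - {t}. \<Phi> t u)"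
  proof (intro M.finsum_cong')
    fix t assume t: "t \<in> ?A"
    have eq: "{..<r} - insert t J = ?A - {t}" by auto
    have inner: "koszul_d R M f r (Suc q) c (insert t J)
      = (\<Oplus>\<^bsub>M\<^esub>u\<in>?A - {t}. \<epsilon> (insert t J) u \<odot>\<^bsub>M\<^esub> (f u \<odot>\<^bsub>M\<^esub> c (insert u (insert t J))))"
      unfolding \<epsilon>_def eq[symmetric] by (rule koszul_d_eq[OF subsets_of_card_insert[OF J t] c])
    have "\<epsilon> J t \<odot>\<^bsub>M\<^esub> (f t \<odot>\<^bsub>M\<^esub> koszul_d R M f r (Suc q) c (insert t J))
      = (\<epsilon> J t \<otimes> f t) \<odot>\<^bsub>M\<^esub> (\<Oplus>\<^bsub>M\<^esub>u\<in>?A - {t}. \<epsilon> (insert t J) u \<odot>\<^bsub>M\<^esub> (f u \<odot>\<^bsub>M\<^esub> c (insert u (insert t J))))"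
      unfolding inner[symmetric] using t koszul_d_closed[OF subsets_of_card_insert[OF J t] c]
      by (intro smult_assoc1[symmetric]) (auto simp: f_closed \<epsilon>)
    also have "\<dots> = (\<Oplus>\<^bsub>M\<^esub>u\<in>?A - {t}. (\<epsilon> J t \<otimes> f t) \<odot>\<^bsub>M\<^esub>
        (\<epsilon> (insert t J) u \<odot>\<^bsub>M\<^esub> (f u \<odot>\<^bsub>M\<^esub> c (insert u (insert t J)))))"
      using t ins[of t] by (intro finsum_smult_ldistr) (auto simp: f_closed \<epsilon>)
    also have "\<dots> = (\<Oplus>\<^bsub>M\<^esub>u\<in>?A - {t}. \<Phi> t u)"
    proof (intro M.finsum_cong')
      fix u assume u: "u \<in> ?A - {t}"
      then show "(\<epsilon> J t \<otimes> f t) \<odot>\<^bsub>M\<^esub> (\<epsilon> (insert t J) u \<odot>\<^bsub>M\<^esub> (f u \<odot>\<^bsub>M\<^esub> c (insert u (insert t J)))) = \<Phi> t u"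
        using t ins[of t u] f_closed[of t] f_closed[of u]
        by (simp add: \<Phi>_def \<epsilon> smult_assoc1[symmetric] R.m_ac)
    qed (use \<Phi> t in auto)
    finally show "\<epsilon> J t \<odot>\<^bsub>M\<^esub> (f t \<odot>\<^bsub>M\<^esub> koszul_d R M f r (Suc q) c (insert t J)) = \<dots>" .
  qed (use \<Phi> in \<open>auto intro!: M.finsum_closed\<close>)
  also have "\<dots> = \<zero>\<^bsub>M\<^esub>"
  proof (intro M.finsum_antisymmetric \<Phi>)
    fix t u assume t: "t \<in> ?A" and u: "u \<in> ?A" and tu: "t \<noteq> u"
    have "\<epsilon> J t \<otimes> \<epsilon> (insert t J) u = \<ominus> (\<epsilon> J u \<otimes> \<epsilon> (insert u J) t)"
      unfolding \<epsilon>_def using R.sgn_elt_swap[OF subsets_of_cardD(2)[OF J], of t u] t u tu by blast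
    moreover have "f t \<otimes> f u = f u \<otimes> f t" using t u f_closed by (simp add: R.m_comm)
    moreover have "insert u (insert t J) = insert t (insert u J)" by auto
    ultimately have "\<Phi> t u = \<ominus>\<^bsub>M\<^esub> \<Phi> u t"
      using ins[OF u t] tu t u by (simp add: \<Phi>_def smult_l_minus \<epsilon> f_closed)
    then show "\<Phi> t u \<oplus>\<^bsub>M\<^esub> \<Phi> u t = \<zero>\<^bsub>M\<^esub>" using \<Phi>[OF u t] tu by (simp add: M.l_neg)
  qed auto
  finally show ?thesis .
qed

text \<open>
  Both predicates look only at coefficients, so that they apply to the slices \<open>\<lambda>J. z (A, J)\<close> of families
  with two indices. Chains of degree 0 have no boundary to vanish: all of them are cycles.
\<close>

definition koszul_cycle :: "nat \<Rightarrow> (nat set \<Rightarrow> 'c) \<Rightarrow> bool" where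
  "koszul_cycle q c \<longleftrightarrow> (\<forall>J\<in>subsets_of_card r q. c J \<in> carrier M) \<and>
    (\<forall>p. q = Suc p \<longrightarrow> (\<forall>J\<in>subsets_of_card r p. koszul_d R M f r p c J = \<zero>\<^bsub>M\<^esub>))"

definition koszul_boundary :: "nat \<Rightarrow> (nat set \<Rightarrow> 'c) \<Rightarrow> bool" where
  "koszul_boundary q c \<longleftrightarrow> (\<exists>v. (\<forall>J\<in>subsets_of_card r (Suc q). v J \<in> carrier M) \<and>
    (\<forall>J\<in>subsets_of_card r q. koszul_d R M f r q v J = c J))"

text \<open>
  Exterior multiplication by \<open>e\<^sub>t\<close> is a homotopy between multiplication by \<open>f\<^sub>t\<close> and zero. At an
  index set \<open>J\<close> without \<open>t\<close> only the term \<open>J \<union> {t}\<close> contributes to the boundary of \<open>e\<^sub>t \<and> w\<close>; at an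
  index set with \<open>t\<close> the boundary of \<open>w\<close> at \<open>J - {t}\<close> appears.
\<close>

lemma koszul_boundary_f_smult:
  assumes t: "t < r" and w: "koszul_cycle q w"
  shows "koszul_boundary q (\<lambda>J. f t \<odot>\<^bsub>M\<^esub> w J)"
proof -
  define \<epsilon> where "\<epsilon> K t = sgn_elt R (card {u\<in>K. u < t})" for K :: "nat set" and t
  have \<epsilon>: "\<epsilon> K t \<in> carrier R" for K t by (simp add: \<epsilon>_def)
  have \<epsilon>2: "\<epsilon> K t \<odot>\<^bsub>M\<^esub> (\<epsilon> K t \<odot>\<^bsub>M\<^esub> x) = x" if "x \<in> carrier M" for K t x
    using that by (simp add: \<epsilon>_def smult_sgn_elt)
  have wc: "w J \<in> carrier M" if "J \<in> subsets_of_card r q" for J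
    using w that by (simp add: koszul_cycle_def)
  \<comment> \<open>the chain \<open>e\<^sub>t \<and> w\<close>\<close>
  define v where "v K = (if t \<in> K then \<epsilon> (K - {t}) t \<odot>\<^bsub>M\<^esub> w (K - {t}) else \<zero>\<^bsub>M\<^esub>)" for K
  have v: "\<forall>J\<in>subsets_of_card r (Suc q). v J \<in> carrier M"
    using wc subsets_of_card_remove by (auto simp: v_def \<epsilon>)
  have "koszul_d R M f r q v J = f t \<odot>\<^bsub>M\<^esub> w J" if J: "J \<in> subsets_of_card r q" for J
  proof (cases "t \<in> J")
    case False
    have "koszul_d R M f r q v J = (\<Oplus>\<^bsub>M\<^esub>u\<in>{..<r} - J. if t = u then f t \<odot>\<^bsub>M\<^esub> w J else \<zero>\<^bsub>M\<^esub>)"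
      unfolding koszul_d_eq[OF J v] \<epsilon>_def[symmetric]
    proof (intro M.finsum_cong')
      fix u assume u: "u \<in> {..<r} - J"
      show "\<epsilon> J u \<odot>\<^bsub>M\<^esub> (f u \<odot>\<^bsub>M\<^esub> v (insert u J)) = (if t = u then f t \<odot>\<^bsub>M\<^esub> w J else \<zero>\<^bsub>M\<^esub>)"
      proof (cases "t = u")
        case True
        have "f t \<odot>\<^bsub>M\<^esub> (\<epsilon> J t \<odot>\<^bsub>M\<^esub> w J) = \<epsilon> J t \<odot>\<^bsub>M\<^esub> (f t \<odot>\<^bsub>M\<^esub> w J)"
          using wc[OF J] t f_closed by (simp add: smult_assoc1[symmetric] \<epsilon> R.m_comm)
        then show ?thesis
          using True False wc[OF J] t by (simp add: v_def \<epsilon>2 f_closed)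
      next
        case neq: False
        then show ?thesis using False u by (simp add: v_def \<epsilon> f_closed)
      qed
    qed (use wc[OF J] t in \<open>auto simp: f_closed\<close>)
    also have "\<dots> = f t \<odot>\<^bsub>M\<^esub> w J"
      using False t wc[OF J] f_closed by (intro M.finsum_singleton) auto
    finally show ?thesis .
  next
    case True
    define K where "K = J - {t}"
    have J_eq: "J = insert t K" "t \<notin> K" using True by (auto simp: K_def)
    obtain p where p: "q = Suc p"
      using subsets_of_cardD[OF J] True by (cases q) auto
    have K: "K \<in> subsets_of_card r p"
      using subsets_of_card_remove[of J r p t] J True by (simp add: p K_def)
    have finK: "finite K" using subsets_of_cardD[OF K] by simp
    let ?B = "{..<r} - J"
    have wK: "w (insert u K) \<in> carrier M" if "u \<in> {..<r} - K" for u
      using wc subsets_of_card_insert[OF K that] by (simp add: p)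
    define \<Sigma> where "\<Sigma> = (\<Oplus>\<^bsub>M\<^esub>u\<in>?B. \<epsilon> K u \<odot>\<^bsub>M\<^esub> (f u \<odot>\<^bsub>M\<^esub> w (insert u K)))"
    have \<Sigma>: "\<Sigma> \<in> carrier M"
      unfolding \<Sigma>_def using wK J_eq by (intro M.finsum_closed) (auto simp: f_closed \<epsilon>)
    \<comment> \<open>The cycle condition at \<open>K\<close> expresses \<open>\<Sigma>\<close>, the terms with \<open>u \<noteq> t\<close>, by the term with \<open>u = t\<close>.\<close>
    have "{..<r} - K = insert t ?B" using J_eq t by auto
    then have "koszul_d R M f r p w K = (\<Oplus>\<^bsub>M\<^esub>u\<in>insert t ?B. \<epsilon> K u \<odot>\<^bsub>M\<^esub> (f u \<odot>\<^bsub>M\<^esub> w (insert u K)))"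
      using koszul_d_eq[OF K] wc by (simp add: p \<epsilon>_def)
    also have "\<dots> = \<epsilon> K t \<odot>\<^bsub>M\<^esub> (f t \<odot>\<^bsub>M\<^esub> w J) \<oplus>\<^bsub>M\<^esub> \<Sigma>"
      unfolding \<Sigma>_def J_eq(1) using wK J_eq t
      by (intro M.finsum_insert) (auto simp: f_closed \<epsilon>)
    finally have cyc: "\<epsilon> K t \<odot>\<^bsub>M\<^esub> (f t \<odot>\<^bsub>M\<^esub> w J) \<oplus>\<^bsub>M\<^esub> \<Sigma> = \<zero>\<^bsub>M\<^esub>"
      using w K by (simp add: koszul_cycle_def p)
    have fw: "f t \<odot>\<^bsub>M\<^esub> w J \<in> carrier M" using wc[OF J] t by (simp add: f_closed)
    have \<Sigma>_eq: "\<ominus>\<^bsub>M\<^esub> \<Sigma> = \<epsilon> K t \<odot>\<^bsub>M\<^esub> (f t \<odot>\<^bsub>M\<^esub> w J)"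
      using cyc \<Sigma> fw \<epsilon> by (intro M.minus_equality) auto
    have "koszul_d R M f r q v J = (\<Oplus>\<^bsub>M\<^esub>u\<in>?B. (\<ominus> \<epsilon> K t) \<odot>\<^bsub>M\<^esub> (\<epsilon> K u \<odot>\<^bsub>M\<^esub> (f u \<odot>\<^bsub>M\<^esub> w (insert u K))))"
      unfolding koszul_d_eq[OF J v] \<epsilon>_def[of J, symmetric]
    proof (intro M.finsum_cong')
      fix u assume u: "u \<in> ?B"
      then have ut: "u \<noteq> t" "u \<notin> K" "t \<in> insert u J" "insert u J - {t} = insert u K" using J_eq by auto
      have sgn: "\<epsilon> J u \<otimes> \<epsilon> (insert u K) t = \<ominus> (\<epsilon> K t \<otimes> \<epsilon> K u)"
      proof -
        have sq: "\<epsilon> K u \<otimes> \<epsilon> K u = \<one>" "\<epsilon> K t \<otimes> \<epsilon> K t = \<one>"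
          unfolding \<epsilon>_def R.sgn_elt_add[symmetric] by (simp_all add: R.sgn_elt_parity)
        have swap: "\<epsilon> K t \<otimes> \<epsilon> J u = \<ominus> (\<epsilon> K u \<otimes> \<epsilon> (insert u K) t)"
          unfolding \<epsilon>_def J_eq(1) using R.sgn_elt_swap[OF finK J_eq(2) ut(2)] ut(1) by blast
        have "\<epsilon> J u \<otimes> \<epsilon> (insert u K) t = (\<epsilon> K t \<otimes> \<epsilon> K t) \<otimes> (\<epsilon> K u \<otimes> \<epsilon> K u) \<otimes> (\<epsilon> J u \<otimes> \<epsilon> (insert u K) t)"
          using sq \<epsilon> by simp
        also have "\<dots> = (\<epsilon> K t \<otimes> \<epsilon> K u) \<otimes> ((\<epsilon> K t \<otimes> \<epsilon> J u) \<otimes> (\<epsilon> K u \<otimes> \<epsilon> (insert u K) t))"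
          using \<epsilon> by (simp add: R.m_ac)
        also have "(\<epsilon> K t \<otimes> \<epsilon> J u) \<otimes> (\<epsilon> K u \<otimes> \<epsilon> (insert u K) t)
            = \<ominus> ((\<epsilon> K u \<otimes> \<epsilon> K u) \<otimes> (\<epsilon> (insert u K) t \<otimes> \<epsilon> (insert u K) t))"
          unfolding swap using \<epsilon> by (simp add: R.l_minus R.r_minus R.m_ac)
        also have "\<epsilon> (insert u K) t \<otimes> \<epsilon> (insert u K) t = \<one>"
          unfolding \<epsilon>_def R.sgn_elt_add[symmetric] by (simp add: R.sgn_elt_parity)
        finally show ?thesis using sq \<epsilon> by (simp add: R.r_minus)
      qed
      have W: "w (insert u K) \<in> carrier M" using u J_eq wK by auto
      have "\<epsilon> J u \<odot>\<^bsub>M\<^esub> (f u \<odot>\<^bsub>M\<^esub> v (insert u J))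
          = (\<epsilon> J u \<otimes> \<epsilon> (insert u K) t) \<odot>\<^bsub>M\<^esub> (f u \<odot>\<^bsub>M\<^esub> w (insert u K))"
        using u ut W f_closed[of u] by (simp add: v_def smult_assoc1[symmetric] \<epsilon> R.m_ac)
      then show "\<epsilon> J u \<odot>\<^bsub>M\<^esub> (f u \<odot>\<^bsub>M\<^esub> v (insert u J))
          = (\<ominus> \<epsilon> K t) \<odot>\<^bsub>M\<^esub> (\<epsilon> K u \<odot>\<^bsub>M\<^esub> (f u \<odot>\<^bsub>M\<^esub> w (insert u K)))"
        unfolding sgn using u W f_closed[of u] by (simp add: smult_assoc1[symmetric] \<epsilon> R.l_minus R.m_assoc)
    qed (use wK J_eq f_closed \<epsilon> in auto)
    also have "\<dots> = (\<ominus> \<epsilon> K t) \<odot>\<^bsub>M\<^esub> \<Sigma>"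
      unfolding \<Sigma>_def using wK J_eq
      by (intro finsum_smult_ldistr[symmetric]) (auto simp: f_closed \<epsilon>)
    also have "\<dots> = \<epsilon> K t \<odot>\<^bsub>M\<^esub> (\<epsilon> K t \<odot>\<^bsub>M\<^esub> (f t \<odot>\<^bsub>M\<^esub> w J))"
      unfolding \<Sigma>_eq[symmetric] using \<Sigma> \<epsilon> by (simp add: smult_l_minus smult_r_minus)
    also have "\<dots> = f t \<odot>\<^bsub>M\<^esub> w J" using fw by (rule \<epsilon>2)
    finally show ?thesis .
  qed
  with v show ?thesis unfolding koszul_boundary_def by blast
qed

lemma koszul_boundary_zero:
  assumes "\<And>J. J \<in> subsets_of_card r q \<Longrightarrow> c J = \<zero>\<^bsub>M\<^esub>"
  shows "koszul_boundary q c"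
  unfolding koszul_boundary_def
  by (rule exI[of _ "\<lambda>_. \<zero>\<^bsub>M\<^esub>"]) (simp add: assms koszul_d_zero)

text \<open>
  The multipliers that turn cycles into boundaries form an ideal, which contains the \<open>f\<^sub>t\<close> by the
  homotopy above and clearly the annihilator.
\<close>

lemma koszul_boundary_smult:
  assumes "a \<in> set_add R (Idl (f ` {..<r})) (annihilator R M)" "koszul_cycle q w"
  shows "koszul_boundary q (\<lambda>J. a \<odot>\<^bsub>M\<^esub> w J)"
proof -
  define Q where "Q = {a \<in> carrier R. \<forall>w. koszul_cycle q w \<longrightarrow> koszul_boundary q (\<lambda>J. a \<odot>\<^bsub>M\<^esub> w J)}"
  have wc: "w J \<in> carrier M" if "J \<in> subsets_of_card r q" "koszul_cycle q w" for J w
    using that by (simp add: koszul_cycle_def)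
  have add: "a \<oplus> b \<in> Q" if a: "a \<in> Q" and b: "b \<in> Q" for a b
  proof -
    have "koszul_boundary q (\<lambda>J. (a \<oplus> b) \<odot>\<^bsub>M\<^esub> w J)" if w: "koszul_cycle q w" for w
    proof -
      obtain x y where x: "\<forall>J\<in>subsets_of_card r (Suc q). x J \<in> carrier M"
          "\<forall>J\<in>subsets_of_card r q. koszul_d R M f r q x J = a \<odot>\<^bsub>M\<^esub> w J"
        and y: "\<forall>J\<in>subsets_of_card r (Suc q). y J \<in> carrier M"
          "\<forall>J\<in>subsets_of_card r q. koszul_d R M f r q y J = b \<odot>\<^bsub>M\<^esub> w J"
        using a b w unfolding Q_def koszul_boundary_def by blast
      then show ?thesis
        unfolding koszul_boundary_def using a b w
        by (intro exI[of _ "\<lambda>J. x J \<oplus>\<^bsub>M\<^esub> y J"]) (simp add: koszul_d_add smult_l_distr wc Q_def)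
    qed
    then show ?thesis using a b by (simp add: Q_def)
  qed
  have mult: "b \<otimes> a \<in> Q" if a: "a \<in> Q" and b: "b \<in> carrier R" for a b
  proof -
    have "koszul_boundary q (\<lambda>J. (b \<otimes> a) \<odot>\<^bsub>M\<^esub> w J)" if w: "koszul_cycle q w" for w
    proof -
      obtain x where x: "\<forall>J\<in>subsets_of_card r (Suc q). x J \<in> carrier M"
          "\<forall>J\<in>subsets_of_card r q. koszul_d R M f r q x J = a \<odot>\<^bsub>M\<^esub> w J"
        using a w unfolding Q_def koszul_boundary_def by blast
      then show ?thesis
        unfolding koszul_boundary_def using a b w
        by (intro exI[of _ "\<lambda>J. b \<odot>\<^bsub>M\<^esub> x J"])
          (simp add: koszul_d_smult[symmetric] smult_assoc1 wc Q_def)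
    qed
    then show ?thesis using a b by (simp add: Q_def)
  qed
  have zero: "\<zero> \<in> Q" by (auto simp: Q_def wc intro!: koszul_boundary_zero)
  have "ideal Q R"
  proof (intro idealI R.ring_axioms subgroup.intro)
    show "inv\<^bsub>add_monoid R\<^esub> a \<in> Q" if "a \<in> Q" for a
    proof -
      have "\<ominus> \<one> \<otimes> a = \<ominus> a" using that by (simp add: Q_def R.l_minus)
      then have "\<ominus> a \<in> Q" using mult[OF that, of "\<ominus> \<one>"] by simp
      then show ?thesis by (simp add: a_inv_def)
    qed
    show "a \<otimes> x \<in> Q" if "a \<in> Q" "x \<in> carrier R" for a x
      using mult[OF that] that by (simp add: Q_def R.m_comm)
  qed (use add mult zero in \<open>auto simp: Q_def\<close>)
  moreover have "f ` {..<r} \<subseteq> Q"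
    using koszul_boundary_f_smult by (auto simp: Q_def f_closed)
  ultimately have "Idl (f ` {..<r}) \<subseteq> Q" by (rule R.genideal_minimal)
  moreover have "annihilator R M \<subseteq> Q"
    by (auto simp: Q_def annihilator_def wc intro!: koszul_boundary_zero)
  ultimately have "a \<in> Q"
    using assms(1) add unfolding set_add_def' by blast
  then show ?thesis using assms(2) by (simp add: Q_def)
qed

text \<open>
  A cycle multiplied by \<open>a\<close> is a boundary, and both the multiplication and the differential are linear, so
  that \<open>a\<close> can be cancelled.
\<close>

lemma koszul_exact:
  assumes a: "a \<in> carrier R" "a \<in> set_add R (Idl (f ` {..<r})) (annihilator R M)"
    and bij: "bij_betw (\<lambda>x. a \<odot>\<^bsub>M\<^esub> x) (carrier M) (carrier M)"
    and w: "koszul_cycle q w"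
  shows "koszul_boundary q w"
proof -
  obtain v where v: "\<forall>J\<in>subsets_of_card r (Suc q). v J \<in> carrier M"
      "\<forall>J\<in>subsets_of_card r q. koszul_d R M f r q v J = a \<odot>\<^bsub>M\<^esub> w J"
    using koszul_boundary_smult[OF a(2) w] unfolding koszul_boundary_def by blast
  have "\<forall>J\<in>subsets_of_card r (Suc q). \<exists>x. x \<in> carrier M \<and> a \<odot>\<^bsub>M\<^esub> x = v J"
    using v(1) bij unfolding bij_betw_def by (metis imageE)
  from bchoice[OF this] obtain u
    where u: "\<forall>J\<in>subsets_of_card r (Suc q). u J \<in> carrier M \<and> a \<odot>\<^bsub>M\<^esub> u J = v J" by blast
  have "koszul_d R M f r q u J = w J" if J: "J \<in> subsets_of_card r q" for J
  proof -
    have "a \<odot>\<^bsub>M\<^esub> koszul_d R M f r q u J = koszul_d R M f r q (\<lambda>K. a \<odot>\<^bsub>M\<^esub> u K) J"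
      using u by (intro koszul_d_smult J a) blast
    also have "\<dots> = koszul_d R M f r q v J"
      using u v by (intro fun_cong[OF koszul_d_cong]) auto
    finally have "a \<odot>\<^bsub>M\<^esub> koszul_d R M f r q u J = a \<odot>\<^bsub>M\<^esub> w J" using v J by simp
    moreover have "koszul_d R M f r q u J \<in> carrier M"
      using u by (intro koszul_d_closed J) blast
    moreover have "w J \<in> carrier M" using w J by (simp add: koszul_cycle_def)
    ultimately show ?thesis using bij unfolding bij_betw_def inj_on_def by blast
  qed
  then show ?thesis using u unfolding koszul_boundary_def by blast
qed

end

section \<open>Localization of a module at an element\<close>

context module
begin

lemma pow_smult_pow:
  assumes "h \<in> carrier R" "x \<in> carrier M"
  shows "h [^] (k::nat) \<odot>\<^bsub>M\<^esub> (h [^] (l::nat) \<odot>\<^bsub>M\<^esub> x) = h [^] (k + l) \<odot>\<^bsub>M\<^esub> x"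
  using assms by (simp add: smult_assoc1[symmetric] R.nat_pow_mult)

lemma smult_lcomm:
  assumes "a \<in> carrier R" "b \<in> carrier R" "x \<in> carrier M"
  shows "a \<odot>\<^bsub>M\<^esub> (b \<odot>\<^bsub>M\<^esub> x) = b \<odot>\<^bsub>M\<^esub> (a \<odot>\<^bsub>M\<^esub> x)"
  using assms by (simp add: smult_assoc1[symmetric] R.m_comm)

lemma equiv_loc_rel:
  assumes h: "h \<in> carrier R"
  shows "equiv (carrier M \<times> UNIV) (loc_rel R M h)"
proof (rule equivI)
  show "trans (loc_rel R M h)"
  proof (rule transI)
    fix p q s assume pq: "(p, q) \<in> loc_rel R M h" and qs: "(q, s) \<in> loc_rel R M h"
    obtain x k y l z m where p: "p = (x, k)" and q: "q = (y, l)" and s: "s = (z, m)"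
      by (cases p, cases q, cases s)
    obtain d where d: "h [^] (d + l) \<odot>\<^bsub>M\<^esub> x = h [^] (d + k) \<odot>\<^bsub>M\<^esub> y"
      and xy: "x \<in> carrier M" "y \<in> carrier M"
      using pq by (auto simp: loc_rel_def p q)
    obtain e where e: "h [^] (e + m) \<odot>\<^bsub>M\<^esub> y = h [^] (e + l) \<odot>\<^bsub>M\<^esub> z" and z: "z \<in> carrier M"
      using qs by (auto simp: loc_rel_def q s)
    have "h [^] (d + e + l + m) \<odot>\<^bsub>M\<^esub> x = h [^] (e + m) \<odot>\<^bsub>M\<^esub> (h [^] (d + l) \<odot>\<^bsub>M\<^esub> x)"
      using h xy by (simp add: pow_smult_pow ac_simps)
    also have "\<dots> = h [^] (d + k) \<odot>\<^bsub>M\<^esub> (h [^] (e + m) \<odot>\<^bsub>M\<^esub> y)"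
      unfolding d using h xy by (simp add: pow_smult_pow ac_simps)
    also have "\<dots> = h [^] (d + e + l + k) \<odot>\<^bsub>M\<^esub> z"
      unfolding e using h z by (simp add: pow_smult_pow ac_simps)
    finally show "(p, s) \<in> loc_rel R M h"
      using xy z by (auto simp: loc_rel_def p s)
  qed
qed (auto simp: refl_on_def sym_def loc_rel_def, metis)

lemma loc_frac_eq_iff:
  assumes "h \<in> carrier R" "x \<in> carrier M" "y \<in> carrier M"
  shows "loc_frac R M h x k = loc_frac R M h y l
    \<longleftrightarrow> (\<exists>e::nat. h [^] (e + l) \<odot>\<^bsub>M\<^esub> x = h [^] (e + k) \<odot>\<^bsub>M\<^esub> y)"
  unfolding loc_frac_def using assms
  by (subst eq_equiv_class_iff[OF equiv_loc_rel]) (auto simp: loc_rel_def)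

lemma loc_frac_cancel:
  assumes "h \<in> carrier R" "x \<in> carrier M"
  shows "loc_frac R M h (h [^] m \<odot>\<^bsub>M\<^esub> x) (k + m) = loc_frac R M h x k"
  using assms by (subst loc_frac_eq_iff) (auto simp: pow_smult_pow ac_simps)

text \<open>
  Every operation on fractions is defined by a union over all representatives; if it is well defined
  on them, it may be computed with the representative at hand.
\<close>

lemma UN_loc_frac:
  assumes h: "h \<in> carrier R" and x: "x \<in> carrier M"
    and F: "\<And>x y k l. x \<in> carrier M \<Longrightarrow> y \<in> carrier M \<Longrightarrow>
      loc_frac R M h x k = loc_frac R M h y l \<Longrightarrow> F x k = F y l"
  shows "(\<Union>(x, k)\<in>loc_frac R M h x k. F x k) = F x k"
proof -
  have mem: "F y l = F x k" if "(y, l) \<in> loc_frac R M h x k" for y l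
  proof -
    have rel: "((x, k), (y, l)) \<in> loc_rel R M h" using that by (simp add: loc_frac_def)
    then have "y \<in> carrier M" by (simp add: loc_rel_def)
    moreover have "loc_frac R M h x k = loc_frac R M h y l"
      unfolding loc_frac_def by (rule equiv_class_eq[OF equiv_loc_rel[OF h] rel])
    ultimately show ?thesis using F[OF x] by simp
  qed
  have "(\<Union>(x, k)\<in>loc_frac R M h x k. F x k) = (\<Union>p\<in>loc_frac R M h x k. F x k)"
    by (intro SUP_cong refl) (use mem in \<open>auto split: prod.split\<close>)
  moreover have "(x, k) \<in> loc_frac R M h x k"
    using x by (auto simp: loc_frac_def loc_rel_def)
  ultimately show ?thesis by auto
qed

lemma localization_simps [simp]:
  "carrier (localization R M h) = {loc_frac R M h x k | x k. x \<in> carrier M}"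
  "\<zero>\<^bsub>localization R M h\<^esub> = loc_frac R M h \<zero>\<^bsub>M\<^esub> 0"
  by (simp_all add: localization_def)

lemma loc_frac_add:
  assumes h: "h \<in> carrier R" and "x \<in> carrier M" "y \<in> carrier M"
  shows "loc_frac R M h x k \<oplus>\<^bsub>localization R M h\<^esub> loc_frac R M h y l
    = loc_frac R M h (h [^] l \<odot>\<^bsub>M\<^esub> x \<oplus>\<^bsub>M\<^esub> h [^] k \<odot>\<^bsub>M\<^esub> y) (k + l)"
proof -
  let ?s = "\<lambda>x k y l. loc_frac R M h (h [^] l \<odot>\<^bsub>M\<^esub> x \<oplus>\<^bsub>M\<^esub> h [^] k \<odot>\<^bsub>M\<^esub> y) (k + l)"
  have step: "?s x k y l = ?s x' k' y l"
    if xs: "x \<in> carrier M" "x' \<in> carrier M" "y \<in> carrier M"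
      and eq: "loc_frac R M h x k = loc_frac R M h x' k'" for x x' y k k' l
  proof -
    obtain e where e: "h [^] (e + k') \<odot>\<^bsub>M\<^esub> x = h [^] (e + k) \<odot>\<^bsub>M\<^esub> x'"
      using loc_frac_eq_iff[OF h xs(1,2)] eq by blast
    have "h [^] (e + (k' + l)) \<odot>\<^bsub>M\<^esub> (h [^] l \<odot>\<^bsub>M\<^esub> x)
        = h [^] (l + l) \<odot>\<^bsub>M\<^esub> (h [^] (e + k') \<odot>\<^bsub>M\<^esub> x)"
      using h xs by (simp add: pow_smult_pow ac_simps)
    also have "\<dots> = h [^] (e + (k + l)) \<odot>\<^bsub>M\<^esub> (h [^] l \<odot>\<^bsub>M\<^esub> x')"
      unfolding e using h xs by (simp add: pow_smult_pow ac_simps)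
    finally have "h [^] (e + (k' + l)) \<odot>\<^bsub>M\<^esub> (h [^] l \<odot>\<^bsub>M\<^esub> x \<oplus>\<^bsub>M\<^esub> h [^] k \<odot>\<^bsub>M\<^esub> y)
        = h [^] (e + (k + l)) \<odot>\<^bsub>M\<^esub> (h [^] l \<odot>\<^bsub>M\<^esub> x' \<oplus>\<^bsub>M\<^esub> h [^] k' \<odot>\<^bsub>M\<^esub> y)"
      using h xs by (simp add: smult_r_distr pow_smult_pow ac_simps)
    then show ?thesis using h xs by (subst loc_frac_eq_iff) auto
  qed
  have comm: "?s x k y l = ?s y l x k" if "x \<in> carrier M" "y \<in> carrier M" for x y k l
    using h that by (simp add: M.a_comm add.commute)
  have step': "?s x k y l = ?s x k y' l'"
    if "x \<in> carrier M" "y \<in> carrier M" "y' \<in> carrier M"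
      "loc_frac R M h y l = loc_frac R M h y' l'" for x y y' k l l'
    using step[OF that(2,3,1,4), of k] comm that by metis
  have inner: "(\<Union>(y, l)\<in>loc_frac R M h y l. ?s x k y l) = ?s x k y l" if "x \<in> carrier M" for x k
    by (rule UN_loc_frac[OF h assms(3)]) (rule step'[OF that])
  have "loc_frac R M h x k \<oplus>\<^bsub>localization R M h\<^esub> loc_frac R M h y l
    = (\<Union>(x, k)\<in>loc_frac R M h x k. \<Union>(y, l)\<in>loc_frac R M h y l. ?s x k y l)"
    by (simp add: localization_def)
  also have "\<dots> = (\<Union>(y, l)\<in>loc_frac R M h y l. ?s x k y l)"
  proof (rule UN_loc_frac[OF h assms(2)])
    fix x x' k k' assume x: "x \<in> carrier M" and x': "x' \<in> carrier M"
      and eq: "loc_frac R M h x k = loc_frac R M h x' k'"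
    show "(\<Union>(y, l)\<in>loc_frac R M h y l. ?s x k y l) = (\<Union>(y, l)\<in>loc_frac R M h y l. ?s x' k' y l)"
      unfolding inner[OF x] inner[OF x'] by (rule step[OF x x' assms(3) eq])
  qed
  also have "\<dots> = ?s x k y l" by (rule inner[OF assms(2)])
  finally show ?thesis .
qed

lemma loc_frac_add_same:
  assumes "h \<in> carrier R" "x \<in> carrier M" "y \<in> carrier M"
  shows "loc_frac R M h x k \<oplus>\<^bsub>localization R M h\<^esub> loc_frac R M h y k
    = loc_frac R M h (x \<oplus>\<^bsub>M\<^esub> y) k"
  using assms loc_frac_cancel[OF assms(1), of "x \<oplus>\<^bsub>M\<^esub> y" k k]
  by (simp add: loc_frac_add smult_r_distr)

lemma loc_frac_smult:
  assumes h: "h \<in> carrier R" and a: "a \<in> carrier R" and x: "x \<in> carrier M"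
  shows "a \<odot>\<^bsub>localization R M h\<^esub> loc_frac R M h x k = loc_frac R M h (a \<odot>\<^bsub>M\<^esub> x) k"
proof -
  have "loc_frac R M h (a \<odot>\<^bsub>M\<^esub> x) k = loc_frac R M h (a \<odot>\<^bsub>M\<^esub> y) l"
    if xy: "x \<in> carrier M" "y \<in> carrier M" and eq: "loc_frac R M h x k = loc_frac R M h y l" for x y k l
  proof -
    obtain e where e: "h [^] (e + l) \<odot>\<^bsub>M\<^esub> x = h [^] (e + k) \<odot>\<^bsub>M\<^esub> y"
      using loc_frac_eq_iff[OF h xy] eq by blast
    have "h [^] (e + l) \<odot>\<^bsub>M\<^esub> (a \<odot>\<^bsub>M\<^esub> x) = a \<odot>\<^bsub>M\<^esub> (h [^] (e + l) \<odot>\<^bsub>M\<^esub> x)"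
      using h a xy by (intro smult_lcomm) auto
    also have "\<dots> = h [^] (e + k) \<odot>\<^bsub>M\<^esub> (a \<odot>\<^bsub>M\<^esub> y)"
      unfolding e using h a xy by (intro smult_lcomm) auto
    finally show ?thesis using h a xy by (subst loc_frac_eq_iff) auto
  qed
  then have "(\<Union>(x, k)\<in>loc_frac R M h x k. loc_frac R M h (a \<odot>\<^bsub>M\<^esub> x) k)
      = loc_frac R M h (a \<odot>\<^bsub>M\<^esub> x) k"
    by (rule UN_loc_frac[OF h x])
  then show ?thesis by (simp add: localization_def)
qed

text \<open>
  Computations in the localization reduce to computations in \<open>M\<close> once all fractions involved have
  the same denominator; every sufficiently large exponent will do.
\<close>

lemma localization_denominator:
  assumes "h \<in> carrier R" "V \<in> carrier (localization R M h)"
  shows "\<exists>m. \<forall>k\<ge>m. \<exists>x\<in>carrier M. V = loc_frac R M h x k"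
proof -
  obtain x m where x: "x \<in> carrier M" "V = loc_frac R M h x m" using assms by auto
  have "\<exists>y\<in>carrier M. V = loc_frac R M h y k" if "k \<ge> m" for k
    using loc_frac_cancel[OF assms(1) x(1), of "k - m" m] that x assms(1)
    by (intro bexI[of _ "h [^] (k - m) \<odot>\<^bsub>M\<^esub> x"]) simp_all
  then show ?thesis by blast
qed

lemma localization_common_denominator:
  assumes h: "h \<in> carrier R"
    and "U \<in> carrier (localization R M h)" "V \<in> carrier (localization R M h)"
      "W \<in> carrier (localization R M h)"
  obtains x y z k where "x \<in> carrier M" "y \<in> carrier M" "z \<in> carrier M"
    "U = loc_frac R M h x k" "V = loc_frac R M h y k" "W = loc_frac R M h z k"
proof -
  obtain k where k: "\<forall>i\<ge>k. \<exists>x\<in>carrier M. U = loc_frac R M h x i"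
    using localization_denominator[OF h assms(2)] by blast
  obtain l where l: "\<forall>i\<ge>l. \<exists>x\<in>carrier M. V = loc_frac R M h x i"
    using localization_denominator[OF h assms(3)] by blast
  obtain m where m: "\<forall>i\<ge>m. \<exists>x\<in>carrier M. W = loc_frac R M h x i"
    using localization_denominator[OF h assms(4)] by blast
  obtain x where "x \<in> carrier M" "U = loc_frac R M h x (k + l + m)"
    using k[rule_format, of "k + l + m"] by auto
  moreover obtain y where "y \<in> carrier M" "V = loc_frac R M h y (k + l + m)"
    using l[rule_format, of "k + l + m"] by auto
  moreover obtain z where "z \<in> carrier M" "W = loc_frac R M h z (k + l + m)"
    using m[rule_format, of "k + l + m"] by auto
  ultimately show ?thesis using that by blast
qed

lemma loc_frac_zero: "h \<in> carrier R \<Longrightarrow> loc_frac R M h \<zero>\<^bsub>M\<^esub> k = loc_frac R M h \<zero>\<^bsub>M\<^esub> 0"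
  by (subst loc_frac_eq_iff) auto

lemma loc_frac_in_localization [simp]:
  "x \<in> carrier M \<Longrightarrow> loc_frac R M h x k \<in> carrier (localization R M h)"
  by auto

lemma module_localization:
  assumes h: "h \<in> carrier R"
  shows "module R (localization R M h)"
proof -
  let ?L = "localization R M h"
  note frac_simps = loc_frac_add_same[OF h] loc_frac_smult[OF h] loc_frac_in_localization
  have zero: "\<zero>\<^bsub>?L\<^esub> = loc_frac R M h \<zero>\<^bsub>M\<^esub> k" for k
    using loc_frac_zero[OF h, of k] by simp
  show ?thesis
  proof (rule moduleI[OF R.is_cring abelian_groupI])
    fix x y z assume x: "x \<in> carrier ?L" and y: "y \<in> carrier ?L" and z: "z \<in> carrier ?L"
    then obtain u v w k where *: "u \<in> carrier M" "v \<in> carrier M" "w \<in> carrier M"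
      "x = loc_frac R M h u k" "y = loc_frac R M h v k" "z = loc_frac R M h w k"
      by (rule localization_common_denominator[OF h])
    show "x \<oplus>\<^bsub>?L\<^esub> y \<oplus>\<^bsub>?L\<^esub> z = x \<oplus>\<^bsub>?L\<^esub> (y \<oplus>\<^bsub>?L\<^esub> z)"
      using * by (simp add: frac_simps M.a_assoc del: localization_simps)
  next
    fix x y assume x: "x \<in> carrier ?L" and y: "y \<in> carrier ?L"
    then obtain u v w k where *: "u \<in> carrier M" "v \<in> carrier M"
      "x = loc_frac R M h u k" "y = loc_frac R M h v k"
      using localization_common_denominator[OF h x y y] by metis
    show "x \<oplus>\<^bsub>?L\<^esub> y \<in> carrier ?L" "x \<oplus>\<^bsub>?L\<^esub> y = y \<oplus>\<^bsub>?L\<^esub> x"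
      using * by (simp_all add: frac_simps M.a_comm del: localization_simps)
    show "a \<odot>\<^bsub>?L\<^esub> (x \<oplus>\<^bsub>?L\<^esub> y) = a \<odot>\<^bsub>?L\<^esub> x \<oplus>\<^bsub>?L\<^esub> a \<odot>\<^bsub>?L\<^esub> y" if "a \<in> carrier R" for a
      using * that by (simp add: frac_simps smult_r_distr del: localization_simps)
  next
    fix x assume "x \<in> carrier ?L"
    then obtain u k where *: "u \<in> carrier M" "x = loc_frac R M h u k" by auto
    have "\<zero>\<^bsub>?L\<^esub> \<oplus>\<^bsub>?L\<^esub> x = loc_frac R M h \<zero>\<^bsub>M\<^esub> k \<oplus>\<^bsub>?L\<^esub> loc_frac R M h u k"
      using zero * by metis
    then show "\<zero>\<^bsub>?L\<^esub> \<oplus>\<^bsub>?L\<^esub> x = x"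
      using * by (simp add: frac_simps del: localization_simps)
    have "loc_frac R M h (\<ominus>\<^bsub>M\<^esub> u) k \<oplus>\<^bsub>?L\<^esub> x = \<zero>\<^bsub>?L\<^esub>"
      using * by (simp add: frac_simps zero[of k] M.l_neg del: localization_simps)
    then show "\<exists>y\<in>carrier ?L. y \<oplus>\<^bsub>?L\<^esub> x = \<zero>\<^bsub>?L\<^esub>"
      using * by (intro bexI[of _ "loc_frac R M h (\<ominus>\<^bsub>M\<^esub> u) k"])
        (simp_all add: frac_simps del: localization_simps)
    show "\<one> \<odot>\<^bsub>?L\<^esub> x = x" using * by (simp add: frac_simps del: localization_simps)
    fix a assume a: "a \<in> carrier R"
    show "a \<odot>\<^bsub>?L\<^esub> x \<in> carrier ?L" using * a by (simp add: frac_simps del: localization_simps)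
    fix b assume b: "b \<in> carrier R"
    show "(a \<oplus> b) \<odot>\<^bsub>?L\<^esub> x = a \<odot>\<^bsub>?L\<^esub> x \<oplus>\<^bsub>?L\<^esub> b \<odot>\<^bsub>?L\<^esub> x"
      using * a b by (simp add: frac_simps smult_l_distr del: localization_simps)
    show "(a \<otimes> b) \<odot>\<^bsub>?L\<^esub> x = a \<odot>\<^bsub>?L\<^esub> (b \<odot>\<^bsub>?L\<^esub> x)"
      using * a b by (simp add: frac_simps smult_assoc1 del: localization_simps)
  next
    show "\<zero>\<^bsub>?L\<^esub> \<in> carrier ?L"
      by (subst zero[of 0]) (simp add: frac_simps del: localization_simps)
  qed
qed

lemma abelian_group_localization: "h \<in> carrier R \<Longrightarrow> abelian_group (localization R M h)"
  by (rule module.axioms(2)[OF module_localization])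

lemma annihilator_localization:
  assumes h: "h \<in> carrier R"
  shows "annihilator R M \<subseteq> annihilator R (localization R M h)"
proof
  fix a assume a: "a \<in> annihilator R M"
  have "a \<odot>\<^bsub>localization R M h\<^esub> loc_frac R M h x k = \<zero>\<^bsub>localization R M h\<^esub>"
    if "x \<in> carrier M" for x k
    using a that loc_frac_smult[OF h, of a x k] loc_frac_zero[OF h, of k] by (simp add: annihilator_def)
  then show "a \<in> annihilator R (localization R M h)"
    using a by (auto simp: annihilator_def)
qed

text \<open>
  Division by \<open>h\<^sup>N\<close> adds \<open>N\<close> to the exponent of the denominator.
\<close>

lemma bij_betw_smult_pow_localization:
  assumes h: "h \<in> carrier R"
  shows "bij_betw (\<lambda>V. h [^] (N::nat) \<odot>\<^bsub>localization R M h\<^esub> V)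
    (carrier (localization R M h)) (carrier (localization R M h))"
proof (rule bij_betwI')
  fix V W assume VW: "V \<in> carrier (localization R M h)" "W \<in> carrier (localization R M h)"
  then obtain x y k where *: "x \<in> carrier M" "y \<in> carrier M"
    "V = loc_frac R M h x k" "W = loc_frac R M h y k"
    using localization_common_denominator[OF h VW(1,2,2)] by metis
  show "h [^] N \<odot>\<^bsub>localization R M h\<^esub> V = h [^] N \<odot>\<^bsub>localization R M h\<^esub> W \<longleftrightarrow> V = W"
  proof
    assume "h [^] N \<odot>\<^bsub>localization R M h\<^esub> V = h [^] N \<odot>\<^bsub>localization R M h\<^esub> W"
    then obtain e :: nat where "h [^] (e + k) \<odot>\<^bsub>M\<^esub> (h [^] N \<odot>\<^bsub>M\<^esub> x) = h [^] (e + k) \<odot>\<^bsub>M\<^esub> (h [^] N \<odot>\<^bsub>M\<^esub> y)"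
      using h * by (auto simp: loc_frac_smult loc_frac_eq_iff)
    then have "h [^] (e + N + k) \<odot>\<^bsub>M\<^esub> x = h [^] (e + N + k) \<odot>\<^bsub>M\<^esub> y"
      using h * by (simp add: pow_smult_pow ac_simps)
    then show "V = W" using h * by (auto simp: loc_frac_eq_iff)
  qed simp
next
  fix V assume "V \<in> carrier (localization R M h)"
  then obtain x k where *: "x \<in> carrier M" "V = loc_frac R M h x k" by auto
  then show "h [^] N \<odot>\<^bsub>localization R M h\<^esub> V \<in> carrier (localization R M h)"
    using h by (simp add: loc_frac_smult del: localization_simps)
  show "\<exists>W\<in>carrier (localization R M h). V = h [^] N \<odot>\<^bsub>localization R M h\<^esub> W"
    using * h loc_frac_cancel[of h x N k]
    by (intro bexI[of _ "loc_frac R M h x (k + N)"])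
      (simp_all add: loc_frac_smult del: localization_simps)
qed

lemma loc_map_frac:
  assumes h: "h \<in> carrier R" and u: "u \<in> carrier R" and x: "x \<in> carrier M"
  shows "loc_map R M h u (loc_frac R M h x k) = loc_frac R M (h \<otimes> u) (u [^] k \<odot>\<^bsub>M\<^esub> x) k"
proof -
  have "loc_frac R M (h \<otimes> u) (u [^] k \<odot>\<^bsub>M\<^esub> x) k = loc_frac R M (h \<otimes> u) (u [^] l \<odot>\<^bsub>M\<^esub> y) l"
    if xy: "x \<in> carrier M" "y \<in> carrier M" and eq: "loc_frac R M h x k = loc_frac R M h y l" for x y k l
  proof -
    obtain e where e: "h [^] (e + l) \<odot>\<^bsub>M\<^esub> x = h [^] (e + k) \<odot>\<^bsub>M\<^esub> y"
      using loc_frac_eq_iff[OF h xy] eq by blast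
    have split: "(h \<otimes> u) [^] (e + l) \<odot>\<^bsub>M\<^esub> (u [^] k \<odot>\<^bsub>M\<^esub> x)
        = u [^] (e + k + l) \<odot>\<^bsub>M\<^esub> (h [^] (e + l) \<odot>\<^bsub>M\<^esub> x)"
      if "x \<in> carrier M" for x k l
    proof -
      have "(h \<otimes> u) [^] (e + l) \<odot>\<^bsub>M\<^esub> (u [^] k \<odot>\<^bsub>M\<^esub> x)
          = h [^] (e + l) \<odot>\<^bsub>M\<^esub> (u [^] (e + l) \<odot>\<^bsub>M\<^esub> (u [^] k \<odot>\<^bsub>M\<^esub> x))"
        using h u that by (simp add: R.nat_pow_distrib smult_assoc1)
      also have "u [^] (e + l) \<odot>\<^bsub>M\<^esub> (u [^] k \<odot>\<^bsub>M\<^esub> x) = u [^] (e + k + l) \<odot>\<^bsub>M\<^esub> x"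
        using u that by (simp add: pow_smult_pow ac_simps)
      also have "h [^] (e + l) \<odot>\<^bsub>M\<^esub> (u [^] (e + k + l) \<odot>\<^bsub>M\<^esub> x)
          = u [^] (e + k + l) \<odot>\<^bsub>M\<^esub> (h [^] (e + l) \<odot>\<^bsub>M\<^esub> x)"
        using h u that by (intro smult_lcomm) auto
      finally show ?thesis .
    qed
    have "(h \<otimes> u) [^] (e + l) \<odot>\<^bsub>M\<^esub> (u [^] k \<odot>\<^bsub>M\<^esub> x) = (h \<otimes> u) [^] (e + k) \<odot>\<^bsub>M\<^esub> (u [^] l \<odot>\<^bsub>M\<^esub> y)"
      using split[OF xy(1), of l k] split[OF xy(2), of k l] by (simp add: e ac_simps)
    then show ?thesis using h u xy by (subst loc_frac_eq_iff) auto
  qed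
  then show ?thesis unfolding loc_map_def by (rule UN_loc_frac[OF h x])
qed

lemma loc_map_hom:
  assumes h: "h \<in> carrier R" and u: "u \<in> carrier R"
  shows "abelian_group_hom (localization R M h) (localization R M (h \<otimes> u)) (loc_map R M h u)"
proof (intro abelian_group_homI_add)
  show "abelian_group (localization R M h)" "abelian_group (localization R M (h \<otimes> u))"
    using h u by (simp_all add: abelian_group_localization)
  show "loc_map R M h u V \<in> carrier (localization R M (h \<otimes> u))"
    if V: "V \<in> carrier (localization R M h)" for V
  proof -
    obtain x k where "x \<in> carrier M" "V = loc_frac R M h x k" using V by auto
    then show ?thesis using h u by (simp add: loc_map_frac del: localization_simps)
  qed
  fix V W assume VW: "V \<in> carrier (localization R M h)" "W \<in> carrier (localization R M h)"
  then obtain x y k where *: "x \<in> carrier M" "y \<in> carrier M"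
    "V = loc_frac R M h x k" "W = loc_frac R M h y k"
    using localization_common_denominator[OF h VW(1,2,2)] by metis
  then show "loc_map R M h u (V \<oplus>\<^bsub>localization R M h\<^esub> W)
      = loc_map R M h u V \<oplus>\<^bsub>localization R M (h \<otimes> u)\<^esub> loc_map R M h u W"
    using h u by (simp add: loc_frac_add_same loc_map_frac smult_r_distr)
qed

lemma loc_map_smult:
  assumes "h \<in> carrier R" "u \<in> carrier R" "a \<in> carrier R" "V \<in> carrier (localization R M h)"
  shows "loc_map R M h u (a \<odot>\<^bsub>localization R M h\<^esub> V)
    = a \<odot>\<^bsub>localization R M (h \<otimes> u)\<^esub> loc_map R M h u V"
  using assms by (auto simp: loc_map_frac loc_frac_smult smult_lcomm)

lemma loc_map_commute:
  assumes "h \<in> carrier R" "u \<in> carrier R" "v \<in> carrier R" "V \<in> carrier (localization R M h)"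
  shows "loc_map R M (h \<otimes> u) v (loc_map R M h u V) = loc_map R M (h \<otimes> v) u (loc_map R M h v V)"
  using assms by (auto simp: loc_map_frac smult_lcomm R.m_ac)

text \<open>
  The degree 0 term of the Cech complex is the localization at \<open>1\<close> and not \<open>M\<close> itself; the exponent
  of the denominator \<open>1\<close> is irrelevant there.
\<close>

lemma loc_frac_one_eq_iff:
  assumes "x \<in> carrier M" "y \<in> carrier M"
  shows "loc_frac R M \<one> x k = loc_frac R M \<one> y l \<longleftrightarrow> x = y"
  using assms by (subst loc_frac_eq_iff) auto

lemma localization_one_hom: "abelian_group_hom M (localization R M \<one>) (\<lambda>x. loc_frac R M \<one> x 0)"
  using abelian_group_localization
  by (intro abelian_group_homI_add M.abelian_group_axioms) (auto simp: loc_frac_add_same)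

end

section \<open>Homogeneous components\<close>

lemma sum_const_lessThan_add:
  fixes e :: "'g::ab_group_add" and k l :: nat
  shows "(\<Sum>i<k + l. e) = (\<Sum>i<k. e) + (\<Sum>i<l. e)"
  by (induction l) (simp_all add: add.assoc)

lemma (in abelian_group) abelian_group_restrict_carrier:
  assumes "H \<subseteq> carrier G" "\<zero> \<in> H" "\<And>x y. x \<in> H \<Longrightarrow> y \<in> H \<Longrightarrow> x \<oplus> y \<in> H"
    "\<And>x. x \<in> H \<Longrightarrow> \<ominus> x \<in> H"
  shows "abelian_group (G\<lparr>carrier := H\<rparr>)"
proof (rule abelian_groupI, simp_all)
  have in_G: "x \<in> carrier G" if "x \<in> H" for x using that assms(1) by blast
  show "x \<oplus> y \<in> H" if "x \<in> H" "y \<in> H" for x y using assms(3) that .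
  show "\<zero> \<in> H" by (fact assms(2))
  show "x \<oplus> y \<oplus> z = x \<oplus> (y \<oplus> z)" if "x \<in> H" "y \<in> H" "z \<in> H" for x y z
    using that in_G by (simp add: a_assoc)
  show "x \<oplus> y = y \<oplus> x" if "x \<in> H" "y \<in> H" for x y
    using that in_G by (simp add: a_comm)
  show "\<zero> \<oplus> x = x" if "x \<in> H" for x
    using that in_G by simp
  show "\<exists>y\<in>H. y \<oplus> x = \<zero>" if "x \<in> H" for x
    using that in_G assms(4) by (intro bexI[of _ "\<ominus> x"]) (simp_all add: l_neg)
qed

text \<open>
  A non-zero element of \<open>R\<close> has at most one degree. The degree of \<open>h\<^sup>k\<close>, by which the degree of a
  fraction \<open>x / h\<^sup>k\<close> is defined, is therefore \<open>k\<close> times that of \<open>h\<close>, unless \<open>h\<^sup>k = 0\<close>.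
\<close>

locale module_over_graded_ring = module R M for R (structure) and M (structure) +
  fixes RG :: "'g::ab_group_add \<Rightarrow> 'a set" and MG :: "'g \<Rightarrow> 'c set"
  assumes graded: "graded_module R RG M MG"
    and RG_closed: "a \<in> RG d \<Longrightarrow> a \<in> carrier R"
    and one_RG: "\<one> \<in> RG 0"
    and mult_RG: "a \<in> RG d \<Longrightarrow> b \<in> RG e \<Longrightarrow> a \<otimes> b \<in> RG (d + e)"
    and RG_unique: "a \<in> RG d \<Longrightarrow> a \<in> RG e \<Longrightarrow> a \<noteq> \<zero> \<Longrightarrow> d = e"
begin

lemma MG_subgroup: "additive_subgroup (MG d) M"
  using graded by (simp add: graded_module_def)

lemma MG_closed: "x \<in> MG d \<Longrightarrow> x \<in> carrier M"
  using additive_subgroup.a_subset[OF MG_subgroup] by blast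

lemma zero_MG: "\<zero>\<^bsub>M\<^esub> \<in> MG d"
  using additive_subgroup.zero_closed[OF MG_subgroup] .

lemma add_MG: "x \<in> MG d \<Longrightarrow> y \<in> MG d \<Longrightarrow> x \<oplus>\<^bsub>M\<^esub> y \<in> MG d"
  using additive_subgroup.a_closed[OF MG_subgroup] .

lemma smult_MG: "a \<in> RG d \<Longrightarrow> x \<in> MG e \<Longrightarrow> a \<odot>\<^bsub>M\<^esub> x \<in> MG (d + e)"
  using graded by (simp add: graded_module_def)

lemma pow_RG: "a \<in> RG e \<Longrightarrow> a [^] (k::nat) \<in> RG (\<Sum>i<k. e)"
  by (induction k) (simp_all add: one_RG mult_RG)

lemma finprod_RG:
  "finite A \<Longrightarrow> (\<And>i. i \<in> A \<Longrightarrow> u i \<in> RG (\<epsilon> i)) \<Longrightarrow> (\<Otimes>i\<in>A. u i) \<in> RG (\<Sum>i\<in>A. \<epsilon> i)"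
proof (induction A rule: finite_induct)
  case (insert i A)
  then have "(\<Otimes>i\<in>insert i A. u i) = u i \<otimes> (\<Otimes>i\<in>A. u i)"
    by (intro R.finprod_insert) (auto intro: RG_closed)
  then show ?case using insert by (simp add: mult_RG)
qed (simp add: one_RG)

definition hcomp :: "'g \<Rightarrow> 'c \<Rightarrow> 'c" where
  "hcomp d x = (THE c. (\<forall>d. c d \<in> MG d) \<and> finite {d. c d \<noteq> \<zero>\<^bsub>M\<^esub>} \<and>
    x = (\<Oplus>\<^bsub>M\<^esub>d\<in>{d. c d \<noteq> \<zero>\<^bsub>M\<^esub>}. c d)) d"

lemma hcomp_decomposition:
  assumes "x \<in> carrier M"
  shows "hcomp d x \<in> MG d" "finite {d. hcomp d x \<noteq> \<zero>\<^bsub>M\<^esub>}"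
    "x = (\<Oplus>\<^bsub>M\<^esub>d\<in>{d. hcomp d x \<noteq> \<zero>\<^bsub>M\<^esub>}. hcomp d x)"
proof -
  have "\<exists>!c. (\<forall>d. c d \<in> MG d) \<and> finite {d. c d \<noteq> \<zero>\<^bsub>M\<^esub>} \<and>
      x = (\<Oplus>\<^bsub>M\<^esub>d\<in>{d. c d \<noteq> \<zero>\<^bsub>M\<^esub>}. c d)"
    using graded assms by (simp add: graded_module_def)
  from theI'[OF this, folded hcomp_def]
  show "hcomp d x \<in> MG d" "finite {d. hcomp d x \<noteq> \<zero>\<^bsub>M\<^esub>}"
    "x = (\<Oplus>\<^bsub>M\<^esub>d\<in>{d. hcomp d x \<noteq> \<zero>\<^bsub>M\<^esub>}. hcomp d x)" by blast+
qed

lemma hcomp_closed: "x \<in> carrier M \<Longrightarrow> hcomp d x \<in> carrier M"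
  using hcomp_decomposition(1) MG_closed by blast

text \<open>
  Any way of writing an element as a finite sum of homogeneous elements of distinct degrees yields its
  components. Additivity and the behaviour under homogeneous scalars follow by summing up
  suitable decompositions.
\<close>

lemma hcomp_finsum:
  assumes D: "finite D" and c: "\<And>d. d \<in> D \<Longrightarrow> c d \<in> MG d"
  shows "hcomp e (\<Oplus>\<^bsub>M\<^esub>d\<in>D. c d) = (if e \<in> D then c e else \<zero>\<^bsub>M\<^esub>)"
proof -
  define c' where "c' d = (if d \<in> D then c d else \<zero>\<^bsub>M\<^esub>)" for d
  let ?x = "\<Oplus>\<^bsub>M\<^esub>d\<in>D. c d"
  have x: "?x \<in> carrier M" using c MG_closed by (intro M.finsum_closed) blast
  have c'_MG: "c' d \<in> MG d" for d using c zero_MG by (simp add: c'_def)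
  have sub: "{d. c' d \<noteq> \<zero>\<^bsub>M\<^esub>} \<subseteq> D" by (auto simp: c'_def)
  have "(\<Oplus>\<^bsub>M\<^esub>d\<in>{d. c' d \<noteq> \<zero>\<^bsub>M\<^esub>}. c' d) = ?x"
    using sub D c MG_closed by (intro M.add.finprod_mono_neutral_cong_left) (auto simp: c'_def)
  then have "(\<forall>d. c' d \<in> MG d) \<and> finite {d. c' d \<noteq> \<zero>\<^bsub>M\<^esub>} \<and>
      ?x = (\<Oplus>\<^bsub>M\<^esub>d\<in>{d. c' d \<noteq> \<zero>\<^bsub>M\<^esub>}. c' d)"
    using c'_MG finite_subset[OF sub D] by simp
  moreover have "\<exists>!c. (\<forall>d. c d \<in> MG d) \<and> finite {d. c d \<noteq> \<zero>\<^bsub>M\<^esub>} \<and>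
      ?x = (\<Oplus>\<^bsub>M\<^esub>d\<in>{d. c d \<noteq> \<zero>\<^bsub>M\<^esub>}. c d)"
    using graded x by (simp add: graded_module_def)
  ultimately have "(THE c. (\<forall>d. c d \<in> MG d) \<and> finite {d. c d \<noteq> \<zero>\<^bsub>M\<^esub>} \<and>
      ?x = (\<Oplus>\<^bsub>M\<^esub>d\<in>{d. c d \<noteq> \<zero>\<^bsub>M\<^esub>}. c d)) = c'"
    by (intro the1_equality)
  then show ?thesis by (simp add: hcomp_def c'_def)
qed

lemma finsum_hcomp:
  assumes "x \<in> carrier M" "finite D" "{d. hcomp d x \<noteq> \<zero>\<^bsub>M\<^esub>} \<subseteq> D"
  shows "x = (\<Oplus>\<^bsub>M\<^esub>d\<in>D. hcomp d x)"
proof -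
  have "(\<Oplus>\<^bsub>M\<^esub>d\<in>{d. hcomp d x \<noteq> \<zero>\<^bsub>M\<^esub>}. hcomp d x) = (\<Oplus>\<^bsub>M\<^esub>d\<in>D. hcomp d x)"
    using assms by (intro M.add.finprod_mono_neutral_cong_left) (auto simp: hcomp_closed)
  then show ?thesis using hcomp_decomposition(3)[OF assms(1)] by simp
qed

lemma hcomp_MG: "x \<in> MG d \<Longrightarrow> hcomp d x = x"
  using hcomp_finsum[of "{d}" "\<lambda>_. x" d] MG_closed by simp

lemma hcomp_add:
  assumes x: "x \<in> carrier M" and y: "y \<in> carrier M"
  shows "hcomp d (x \<oplus>\<^bsub>M\<^esub> y) = hcomp d x \<oplus>\<^bsub>M\<^esub> hcomp d y"
proof -
  let ?D = "{d. hcomp d x \<noteq> \<zero>\<^bsub>M\<^esub>} \<union> {d. hcomp d y \<noteq> \<zero>\<^bsub>M\<^esub>}"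
  have fin: "finite ?D" using hcomp_decomposition(2) x y by simp
  have "x \<oplus>\<^bsub>M\<^esub> y = (\<Oplus>\<^bsub>M\<^esub>d\<in>?D. hcomp d x) \<oplus>\<^bsub>M\<^esub> (\<Oplus>\<^bsub>M\<^esub>d\<in>?D. hcomp d y)"
    using finsum_hcomp[OF x fin] finsum_hcomp[OF y fin] by auto
  also have "\<dots> = (\<Oplus>\<^bsub>M\<^esub>d\<in>?D. hcomp d x \<oplus>\<^bsub>M\<^esub> hcomp d y)"
    using x y by (intro M.finsum_addf[symmetric]) (auto simp: hcomp_closed)
  finally have "hcomp d (x \<oplus>\<^bsub>M\<^esub> y) = (if d \<in> ?D then hcomp d x \<oplus>\<^bsub>M\<^esub> hcomp d y else \<zero>\<^bsub>M\<^esub>)"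
    using hcomp_finsum[OF fin, of "\<lambda>d. hcomp d x \<oplus>\<^bsub>M\<^esub> hcomp d y" d] hcomp_decomposition(1) x y add_MG
    by simp
  then show ?thesis by auto
qed

lemma hcomp_smult:
  assumes a: "a \<in> RG e" and x: "x \<in> carrier M"
  shows "hcomp (e + d) (a \<odot>\<^bsub>M\<^esub> x) = a \<odot>\<^bsub>M\<^esub> hcomp d x"
proof -
  let ?D = "{d. hcomp d x \<noteq> \<zero>\<^bsub>M\<^esub>}"
  note aR = RG_closed[OF a]
  have fin: "finite ?D" using hcomp_decomposition(2) x by simp
  have "a \<odot>\<^bsub>M\<^esub> x = a \<odot>\<^bsub>M\<^esub> (\<Oplus>\<^bsub>M\<^esub>d\<in>?D. hcomp d x)"
    using hcomp_decomposition(3)[OF x] by simp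
  also have "\<dots> = (\<Oplus>\<^bsub>M\<^esub>d\<in>?D. a \<odot>\<^bsub>M\<^esub> hcomp (e + d - e) x)"
    using x aR fin by (subst finsum_smult_ldistr) (auto simp: hcomp_closed)
  also have "\<dots> = (\<Oplus>\<^bsub>M\<^esub>d\<in>(+) e ` ?D. a \<odot>\<^bsub>M\<^esub> hcomp (d - e) x)"
    using x aR by (intro M.finsum_reindex[symmetric]) (auto simp: hcomp_closed)
  finally have eq: "a \<odot>\<^bsub>M\<^esub> x = (\<Oplus>\<^bsub>M\<^esub>d\<in>(+) e ` ?D. a \<odot>\<^bsub>M\<^esub> hcomp (d - e) x)" .
  have MG: "a \<odot>\<^bsub>M\<^esub> hcomp (d - e) x \<in> MG d" for d
    using smult_MG[OF a hcomp_decomposition(1)[OF x, of "d - e"]] by simp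
  have "hcomp (e + d) (a \<odot>\<^bsub>M\<^esub> x) = (if e + d \<in> (+) e ` ?D then a \<odot>\<^bsub>M\<^esub> hcomp (e + d - e) x else \<zero>\<^bsub>M\<^esub>)"
    unfolding eq using fin MG by (intro hcomp_finsum) auto
  then show ?thesis using aR by (auto simp: image_iff)
qed

section \<open>Homogeneous components of a localization\<close>

text \<open>
  For \<open>h\<close> of degree \<open>e\<close> the component of degree \<open>d\<close> of \<open>x / h\<^sup>k\<close> has as numerator the component of
  \<open>x\<close> of degree \<open>d + k e\<close>.
\<close>

definition loc_hcomp :: "'a \<Rightarrow> 'g \<Rightarrow> 'g \<Rightarrow> ('c \<times> nat) set \<Rightarrow> ('c \<times> nat) set" where
  "loc_hcomp h e d V = (\<Union>(x, k)\<in>V. loc_frac R M h (hcomp (d + (\<Sum>i<k. e)) x) k)"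

context
  fixes h e
  assumes h_RG: "h \<in> RG e"
begin

lemma h_closed: "h \<in> carrier R"
  using h_RG by (rule RG_closed)

lemma loc_hcomp_frac:
  assumes x: "x \<in> carrier M"
  shows "loc_hcomp h e d (loc_frac R M h x k) = loc_frac R M h (hcomp (d + (\<Sum>i<k. e)) x) k"
  unfolding loc_hcomp_def
proof (rule UN_loc_frac[OF h_closed x])
  fix x y k l assume xy: "x \<in> carrier M" "y \<in> carrier M"
    and eq: "loc_frac R M h x k = loc_frac R M h y l"
  obtain m where m: "h [^] (m + l) \<odot>\<^bsub>M\<^esub> x = h [^] (m + k) \<odot>\<^bsub>M\<^esub> y"
    using eq loc_frac_eq_iff[OF h_closed xy] by blast
  have shift: "(\<Sum>i<m + l. e) + (d + (\<Sum>i<k. e)) = (\<Sum>i<m + k. e) + (d + (\<Sum>i<l. e))"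
    unfolding sum_const_lessThan_add by (simp add: algebra_simps)
  have "h [^] (m + l) \<odot>\<^bsub>M\<^esub> hcomp (d + (\<Sum>i<k. e)) x = h [^] (m + k) \<odot>\<^bsub>M\<^esub> hcomp (d + (\<Sum>i<l. e)) y"
    using hcomp_smult[OF pow_RG[OF h_RG] xy(1), of "m + l" "d + (\<Sum>i<k. e)"]
      hcomp_smult[OF pow_RG[OF h_RG] xy(2), of "m + k" "d + (\<Sum>i<l. e)"]
    unfolding shift m by simp
  then show "loc_frac R M h (hcomp (d + (\<Sum>i<k. e)) x) k = loc_frac R M h (hcomp (d + (\<Sum>i<l. e)) y) l"
    using xy by (subst loc_frac_eq_iff) (auto simp: h_closed hcomp_closed)
qed

lemma loc_hcomp_closed:
  "V \<in> carrier (localization R M h) \<Longrightarrow> loc_hcomp h e d V \<in> carrier (localization R M h)"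
proof -
  assume "V \<in> carrier (localization R M h)"
  then obtain x k where "x \<in> carrier M" "V = loc_frac R M h x k" by auto
  then show ?thesis by (simp add: loc_hcomp_frac hcomp_closed del: localization_simps)
qed

lemma loc_hcomp_hom:
  "abelian_group_hom (localization R M h) (localization R M h) (loc_hcomp h e d)"
proof (intro abelian_group_homI_add abelian_group_localization h_closed loc_hcomp_closed)
  fix V W assume VW: "V \<in> carrier (localization R M h)" "W \<in> carrier (localization R M h)"
  obtain x y k where *: "x \<in> carrier M" "y \<in> carrier M"
    "V = loc_frac R M h x k" "W = loc_frac R M h y k"
    using localization_common_denominator[OF h_closed VW(1,2,2)] by metis
  then show "loc_hcomp h e d (V \<oplus>\<^bsub>localization R M h\<^esub> W)
      = loc_hcomp h e d V \<oplus>\<^bsub>localization R M h\<^esub> loc_hcomp h e d W"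
    by (simp add: loc_frac_add_same h_closed loc_hcomp_frac hcomp_add hcomp_closed)
qed

lemma loc_hcomp_mem:
  assumes "V \<in> carrier (localization R M h)"
  shows "loc_hcomp h e d V \<in> localization_grading R RG M MG h d"
proof -
  obtain x k where x: "x \<in> carrier M" "V = loc_frac R M h x k" using assms by auto
  then show ?thesis
    using pow_RG[OF h_RG, of k] hcomp_decomposition(1)[OF x(1)]
    by (auto simp: loc_hcomp_frac localization_grading_def)
qed

lemma localization_grading_closed:
  "V \<in> localization_grading R RG M MG h d \<Longrightarrow> V \<in> carrier (localization R M h)"
  using MG_closed by (auto simp: localization_grading_def)

text \<open>
  The degree of \<open>h\<^sup>k\<close> is determined unless \<open>h\<^sup>k = 0\<close>; in that case all fractions are equal.
\<close>

lemma loc_hcomp_eq: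
  assumes "V \<in> localization_grading R RG M MG h d"
  shows "loc_hcomp h e d V = V"
proof -
  obtain x k e' where V: "V = loc_frac R M h x k" and e': "h [^] k \<in> RG e'" and x: "x \<in> MG (d + e')"
    using assms by (auto simp: localization_grading_def)
  note xM = MG_closed[OF x]
  show ?thesis
  proof (cases "h [^] k = \<zero>")
    case True
    have kill: "h [^] (k + k) \<odot>\<^bsub>M\<^esub> y = \<zero>\<^bsub>M\<^esub>" if "y \<in> carrier M" for y
      using that True h_closed by (simp add: R.nat_pow_mult[symmetric])
    have "loc_frac R M h (hcomp (d + (\<Sum>i<k. e)) x) k = loc_frac R M h x k"
      unfolding loc_frac_eq_iff[OF h_closed hcomp_closed[OF xM] xM] using kill xM hcomp_closed by metis
    then show ?thesis by (simp add: V loc_hcomp_frac xM)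
  next
    case False
    then have "(\<Sum>i<k. e) = e'" using RG_unique[OF pow_RG[OF h_RG] e'] by blast
    then show ?thesis using hcomp_MG[OF x] by (simp add: V loc_hcomp_frac xM)
  qed
qed

lemma abelian_group_localization_grading:
  "abelian_group ((localization R M h)\<lparr>carrier := localization_grading R RG M MG h d\<rparr>)"
proof -
  interpret L: abelian_group "localization R M h" by (intro abelian_group_localization h_closed)
  interpret p: abelian_group_hom "localization R M h" "localization R M h" "loc_hcomp h e d"
    by (rule loc_hcomp_hom)
  have memI: "V \<in> localization_grading R RG M MG h d"
    if "loc_hcomp h e d V = V" "V \<in> carrier (localization R M h)" for V
    using loc_hcomp_mem[OF that(2), of d] that(1) by simp
  show ?thesis
  proof (rule L.abelian_group_restrict_carrier)
    show "\<zero>\<^bsub>localization R M h\<^esub> \<in> localization_grading R RG M MG h d"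
      by (rule memI[OF p.hom_zero L.zero_closed])
    show "V \<oplus>\<^bsub>localization R M h\<^esub> W \<in> localization_grading R RG M MG h d"
      if "V \<in> localization_grading R RG M MG h d" "W \<in> localization_grading R RG M MG h d" for V W
      using that localization_grading_closed
      by (intro memI L.a_closed) (simp_all only: p.hom_add loc_hcomp_eq)
    show "\<ominus>\<^bsub>localization R M h\<^esub> V \<in> localization_grading R RG M MG h d"
      if "V \<in> localization_grading R RG M MG h d" for V
      using that localization_grading_closed
      by (intro memI L.a_inv_closed) (simp_all only: p.hom_a_inv loc_hcomp_eq)
  qed (auto dest: localization_grading_closed simp del: localization_simps)
qed

lemma loc_hcomp_smult:
  assumes a: "a \<in> RG c" and V: "V \<in> carrier (localization R M h)"
  shows "loc_hcomp h e (c + d) (a \<odot>\<^bsub>localization R M h\<^esub> V)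
    = a \<odot>\<^bsub>localization R M h\<^esub> loc_hcomp h e d V"
proof -
  obtain x k where x: "x \<in> carrier M" "V = loc_frac R M h x k" using V by auto
  then show ?thesis
    using hcomp_smult[OF a x(1), of "d + (\<Sum>i<k. e)"] RG_closed[OF a]
    by (simp add: loc_frac_smult h_closed loc_hcomp_frac hcomp_closed add.assoc)
qed

end

lemma loc_hcomp_loc_map:
  assumes h: "h \<in> RG e" and u: "u \<in> RG e'" and V: "V \<in> carrier (localization R M h)"
  shows "loc_hcomp (h \<otimes> u) (e + e') d (loc_map R M h u V) = loc_map R M h u (loc_hcomp h e d V)"
proof -
  obtain x k where x: "x \<in> carrier M" "V = loc_frac R M h x k" using V by auto
  have "d + (\<Sum>i<k. e + e') = (\<Sum>i<k. e') + (d + (\<Sum>i<k. e))"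
    by (simp only: sum.distrib) (simp add: algebra_simps)
  then have "hcomp (d + (\<Sum>i<k. e + e')) (u [^] k \<odot>\<^bsub>M\<^esub> x) = u [^] k \<odot>\<^bsub>M\<^esub> hcomp (d + (\<Sum>i<k. e)) x"
    using hcomp_smult[OF pow_RG[OF u] x(1), of k "d + (\<Sum>i<k. e)"] by metis
  then show ?thesis
    using x RG_closed[OF h] RG_closed[OF u]
    by (simp add: loc_map_frac loc_hcomp_frac[OF h] loc_hcomp_frac[OF mult_RG[OF h u]] hcomp_closed)
qed

end

section \<open>A vanishing lemma for double complexes\<close>

text \<open>
  The double complex has commuting differentials \<open>dC\<close>, which raises \<open>p\<close>, and \<open>dK\<close>, which lowers \<open>q\<close>.
  The columns \<open>p > 0\<close> are exact for \<open>dK\<close>, and \<open>dC\<close> is exact at the places \<open>(p, j + p)\<close>, which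
  form the total degree \<open>j\<close>. The claim, proved by descending induction on \<open>p\<close>, is that an element
  \<open>z\<close> at such a place for which \<open>dC z\<close> is a \<open>dK\<close>-cycle has the form \<open>dK y + dC y'\<close>: one lifts
  \<open>dC z = dK z'\<close>, applies the claim to \<open>z' = dK y + dC y'\<close>, and corrects \<open>z\<close> by \<open>dK y'\<close>, which makes
  it a \<open>dC\<close>-cocycle. For \<open>p = 0\<close> there is no \<open>y'\<close>.
\<close>

lemma double_complex_cycle_is_boundary:
  fixes C :: "nat \<Rightarrow> nat \<Rightarrow> ('x, 'y) ring_scheme"
  assumes dC: "\<And>p q. abelian_group_hom (C p q) (C (Suc p) q) (dC p q)"
    and dK: "\<And>p q. abelian_group_hom (C p (Suc q)) (C p q) (dK p q)"
    and comm: "\<And>p q z. z \<in> carrier (C p (Suc q)) \<Longrightarrow>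
      dC p q (dK p q z) = dK (Suc p) q (dC p (Suc q) z)"
    and dC2: "\<And>p q z. z \<in> carrier (C p q) \<Longrightarrow> dC (Suc p) q (dC p q z) = \<zero>\<^bsub>C (Suc (Suc p)) q\<^esub>"
    and dK2: "\<And>p q z. z \<in> carrier (C p (Suc (Suc q))) \<Longrightarrow> dK p q (dK p (Suc q) z) = \<zero>\<^bsub>C p q\<^esub>"
    and K_exact: "\<And>p q z. z \<in> carrier (C (Suc p) q) \<Longrightarrow>
      (\<And>q'. q = Suc q' \<Longrightarrow> dK (Suc p) q' z = \<zero>\<^bsub>C (Suc p) q'\<^esub>) \<Longrightarrow>
      z \<in> dK (Suc p) q ` carrier (C (Suc p) (Suc q))"
    and C_exact_0: "\<And>z. z \<in> carrier (C 0 j) \<Longrightarrow> dC 0 j z = \<zero>\<^bsub>C 1 j\<^esub> \<Longrightarrow> z = \<zero>\<^bsub>C 0 j\<^esub>"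
    and C_exact: "\<And>p z. z \<in> carrier (C (Suc p) (j + Suc p)) \<Longrightarrow>
      dC (Suc p) (j + Suc p) z = \<zero>\<^bsub>C (Suc (Suc p)) (j + Suc p)\<^esub> \<Longrightarrow>
      z \<in> dC p (j + Suc p) ` carrier (C p (j + Suc p))"
    and bounded: "\<And>p q z. p > s \<Longrightarrow> z \<in> carrier (C p q) \<Longrightarrow> z = \<zero>\<^bsub>C p q\<^esub>"
    and z: "z \<in> carrier (C 0 j)" and cycle: "\<And>q. j = Suc q \<Longrightarrow> dK 0 q z = \<zero>\<^bsub>C 0 q\<^esub>"
  shows "z \<in> dK 0 j ` carrier (C 0 (Suc j))"
proof -
  interpret dC: abelian_group_hom "C p q" "C (Suc p) q" "dC p q" for p q by (rule dC)
  interpret dK: abelian_group_hom "C p (Suc q)" "C p q" "dK p q" for p q by (rule dK)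
  define claim where "claim p \<longleftrightarrow> (\<forall>z\<in>carrier (C p (j + p)).
      (\<forall>q. j + p = Suc q \<longrightarrow> dK (Suc p) q (dC p (j + p) z) = \<zero>\<^bsub>C (Suc p) q\<^esub>) \<longrightarrow>
      (\<exists>y\<in>carrier (C p (Suc (j + p))). \<exists>y'\<in>carrier (C p (j + p)).
        z = dK p (j + p) y \<oplus>\<^bsub>C p (j + p)\<^esub> y' \<and> (case p of 0 \<Rightarrow> y' = \<zero>\<^bsub>C p (j + p)\<^esub>
          | Suc p' \<Rightarrow> y' \<in> dC p' (j + p) ` carrier (C p' (j + p)))))" for p
  have step: "claim p" if IH: "claim (Suc p)" for p
    unfolding claim_def
  proof (intro ballI impI)
    fix z assume z: "z \<in> carrier (C p (j + p))"
      and cyc: "\<forall>q. j + p = Suc q \<longrightarrow> dK (Suc p) q (dC p (j + p) z) = \<zero>\<^bsub>C (Suc p) q\<^esub>"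
    have "dC p (j + p) z \<in> dK (Suc p) (j + p) ` carrier (C (Suc p) (Suc (j + p)))"
      using z cyc by (intro K_exact) auto
    then obtain z' where z': "z' \<in> carrier (C (Suc p) (j + Suc p))"
      and dz: "dC p (j + p) z = dK (Suc p) (j + p) z'" by auto
    have "dK (Suc (Suc p)) (j + p) (dC (Suc p) (j + Suc p) z') = dC (Suc p) (j + p) (dK (Suc p) (j + p) z')"
      using comm z' by simp
    also have "\<dots> = \<zero>\<^bsub>C (Suc (Suc p)) (j + p)\<^esub>" unfolding dz[symmetric] by (rule dC2[OF z])
    finally obtain y v where y: "y \<in> carrier (C (Suc p) (Suc (j + Suc p)))"
      and v: "v \<in> carrier (C p (j + Suc p))"
      and z'_eq: "z' = dK (Suc p) (j + Suc p) y \<oplus>\<^bsub>C (Suc p) (j + Suc p)\<^esub> dC p (j + Suc p) v"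
      using IH[unfolded claim_def, rule_format, OF z'] by auto
    \<comment> \<open>\<open>v\<close> is the Cech primitive of \<open>z' - dK y\<close>, so this correction makes \<open>z\<close> a Cech cocycle.\<close>
    define w where "w = z \<ominus>\<^bsub>C p (j + p)\<^esub> dK p (j + p) v"
    have v': "v \<in> carrier (C p (Suc (j + p)))" using v by simp
    have w: "w \<in> carrier (C p (j + p))"
      unfolding w_def using z v' by (intro dC.G.minus_closed dK.hom_closed)
    have "dK (Suc p) (j + p) z' = dK (Suc p) (j + p) (dC p (j + Suc p) v)"
      unfolding z'_eq using y v dK2[of y "Suc p" "j + p"] by simp
    also have "\<dots> = dC p (j + p) (dK p (j + p) v)" using comm[OF v'] by simp
    finally have "dC p (j + p) z = dC p (j + p) (dK p (j + p) v)" using dz by simp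
    then have dw: "dC p (j + p) w = \<zero>\<^bsub>C (Suc p) (j + p)\<^esub>"
      unfolding w_def a_minus_def using z v' by (simp add: dC.G.r_neg)
    have z_eq: "z = dK p (j + p) v \<oplus>\<^bsub>C p (j + p)\<^esub> w"
      unfolding w_def a_minus_def using z v' dK.hom_closed[OF v']
      by (subst dC.G.a_lcomm) (simp_all add: dC.G.r_neg)
    have "case p of 0 \<Rightarrow> w = \<zero>\<^bsub>C p (j + p)\<^esub> | Suc p' \<Rightarrow> w \<in> dC p' (j + p) ` carrier (C p' (j + p))"
      using C_exact_0[of w] C_exact[of w] w dw by (cases p) auto
    with z_eq v' w show "\<exists>y\<in>carrier (C p (Suc (j + p))). \<exists>y'\<in>carrier (C p (j + p)).
        z = dK p (j + p) y \<oplus>\<^bsub>C p (j + p)\<^esub> y' \<and> (case p of 0 \<Rightarrow> y' = \<zero>\<^bsub>C p (j + p)\<^esub>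
          | Suc p' \<Rightarrow> y' \<in> dC p' (j + p) ` carrier (C p' (j + p)))" by blast
  qed
  have top: "claim (Suc s)"
    unfolding claim_def
  proof (intro ballI impI)
    fix z assume "z \<in> carrier (C (Suc s) (j + Suc s))"
    then have z: "z = \<zero>\<^bsub>C (Suc s) (j + Suc s)\<^esub>" by (rule bounded[rotated]) simp
    have "\<zero>\<^bsub>C (Suc s) (j + Suc s)\<^esub> \<in> dC s (j + Suc s) ` carrier (C s (j + Suc s))"
      by (rule image_eqI[of _ _ "\<zero>\<^bsub>C s (j + Suc s)\<^esub>"]) (simp_all only: dC.hom_zero dC.G.zero_closed)
    moreover have "z = dK (Suc s) (j + Suc s) \<zero>\<^bsub>C (Suc s) (Suc (j + Suc s))\<^esub>
        \<oplus>\<^bsub>C (Suc s) (j + Suc s)\<^esub> \<zero>\<^bsub>C (Suc s) (j + Suc s)\<^esub>"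
      unfolding z by simp
    ultimately show "\<exists>y\<in>carrier (C (Suc s) (Suc (j + Suc s))). \<exists>y'\<in>carrier (C (Suc s) (j + Suc s)).
        z = dK (Suc s) (j + Suc s) y \<oplus>\<^bsub>C (Suc s) (j + Suc s)\<^esub> y' \<and>
        (case Suc s of 0 \<Rightarrow> y' = \<zero>\<^bsub>C (Suc s) (j + Suc s)\<^esub>
          | Suc p' \<Rightarrow> y' \<in> dC p' (j + Suc s) ` carrier (C p' (j + Suc s)))"
      unfolding nat.case using dC.G.zero_closed by blast
  qed
  have "claim 0" by (rule inc_induct[of 0 "Suc s" claim, OF _ top]) (auto intro: step)
  moreover have "dK 1 q (dC 0 j z) = \<zero>\<^bsub>C 1 q\<^esub>" if "j = Suc q" for q
    using comm[of z 0 q] z cycle[OF that] that by simp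
  ultimately show ?thesis using z by (auto simp: claim_def)
qed

section \<open>The Cech complex\<close>

locale koszul_cech = module_over_graded_ring R M RG MG
    for R (structure) and M (structure) and RG :: "'g::ab_group_add \<Rightarrow> 'a set" and MG :: "'g \<Rightarrow> 'c set" +
  fixes f :: "nat \<Rightarrow> 'a" and r :: nat and \<delta> :: "nat \<Rightarrow> 'g"
    and g :: "nat \<Rightarrow> 'a" and s :: nat and \<epsilon> :: "nat \<Rightarrow> 'g"
  assumes f_RG: "t < r \<Longrightarrow> f t \<in> RG (\<delta> t)"
    and g_RG: "i < s \<Longrightarrow> g i \<in> RG (\<epsilon> i)"
begin

abbreviation "gprod A \<equiv> (\<Otimes>i\<in>A. g i)"

abbreviation "L A \<equiv> cech_loc R M g A"

abbreviation "LG A d \<equiv> localization_grading R RG M MG (gprod A) d"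

abbreviation "\<rho> A t \<equiv> loc_map R M (gprod (A - {t})) (g t)"

abbreviation "Lcomp A d \<equiv> loc_hcomp (gprod A) (\<Sum>i\<in>A. \<epsilon> i) d"

lemma g_closed: "i < s \<Longrightarrow> g i \<in> carrier R"
  using g_RG RG_closed by blast

lemma gprod_RG:
  assumes "A \<subseteq> {..<s}"
  shows "gprod A \<in> RG (\<Sum>i\<in>A. \<epsilon> i)"
  using assms finite_subset[OF assms] by (intro finprod_RG) (auto intro: g_RG)

lemma gprod_closed: "A \<subseteq> {..<s} \<Longrightarrow> gprod A \<in> carrier R"
  using gprod_RG RG_closed by blast

lemma gprod_factors_closed:
  assumes "A \<subseteq> {..<s}" "t \<in> A"
  shows "gprod (A - {t}) \<in> carrier R" "g t \<in> carrier R"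
  using assms by (auto intro!: gprod_closed g_closed)

lemma gprod_remove:
  assumes A: "A \<subseteq> {..<s}" and t: "t \<in> A"
  shows "gprod (A - {t}) \<otimes> g t = gprod A"
proof -
  have "gprod (insert t (A - {t})) = g t \<otimes> gprod (A - {t})"
    using A t finite_subset[OF A] by (intro R.finprod_insert) (auto intro: g_closed)
  moreover have "insert t (A - {t}) = A" using t by auto
  ultimately show ?thesis
    using gprod_factors_closed[OF A t] by (simp add: R.m_comm)
qed

lemma module_L: "A \<subseteq> {..<s} \<Longrightarrow> module R (L A)"
  unfolding cech_loc_def by (intro module_localization gprod_closed)

lemma koszul_module_L: "A \<subseteq> {..<s} \<Longrightarrow> koszul_module R (L A) f r"
  by (intro koszul_module.intro koszul_module_axioms.intro module_L RG_closed[OF f_RG])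

lemma koszul_module_M: "koszul_module R M f r"
  by (intro koszul_module.intro koszul_module_axioms.intro module_axioms RG_closed[OF f_RG])

lemma \<rho>_hom:
  assumes "A \<subseteq> {..<s}" "t \<in> A"
  shows "abelian_group_hom (L (A - {t})) (L A) (\<rho> A t)"
  using loc_map_hom[OF gprod_factors_closed[OF assms]]
  unfolding cech_loc_def gprod_remove[OF assms] .

lemma \<rho>_smult:
  assumes "A \<subseteq> {..<s}" "t \<in> A" "a \<in> carrier R" "V \<in> carrier (L (A - {t}))"
  shows "\<rho> A t (a \<odot>\<^bsub>L (A - {t})\<^esub> V) = a \<odot>\<^bsub>L A\<^esub> \<rho> A t V"
  using loc_map_smult[OF gprod_factors_closed[OF assms(1,2)] assms(3)] assms(4)
  unfolding cech_loc_def gprod_remove[OF assms(1,2)] by blast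

lemma \<rho>_commute:
  assumes A: "A \<subseteq> {..<s}" and t: "t \<in> A" and u: "u \<in> A" and tu: "t \<noteq> u"
    and V: "V \<in> carrier (L (A - {t} - {u}))"
  shows "\<rho> A t (\<rho> (A - {t}) u V) = \<rho> A u (\<rho> (A - {u}) t V)"
proof -
  have swap: "A - {u} - {t} = A - {t} - {u}" by auto
  have "A - {t} \<subseteq> {..<s}" "A - {u} \<subseteq> {..<s}" "A - {t} - {u} \<subseteq> {..<s}" using A by auto
  moreover have "u \<in> A - {t}" "t \<in> A - {u}" "u < s" "t < s" using t u tu A by auto
  ultimately show ?thesis
    using loc_map_commute[of "gprod (A - {t} - {u})" "g u" "g t" V] V
      gprod_remove[of "A - {t}" u] gprod_remove[of "A - {u}" t]
    unfolding cech_loc_def swap by (simp add: gprod_closed g_closed)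
qed

lemma Lcomp_hom: "A \<subseteq> {..<s} \<Longrightarrow> abelian_group_hom (L A) (L A) (Lcomp A d)"
  unfolding cech_loc_def by (intro loc_hcomp_hom gprod_RG)

lemma Lcomp_mem: "A \<subseteq> {..<s} \<Longrightarrow> V \<in> carrier (L A) \<Longrightarrow> Lcomp A d V \<in> LG A d"
  unfolding cech_loc_def by (intro loc_hcomp_mem gprod_RG)

lemma LG_closed: "A \<subseteq> {..<s} \<Longrightarrow> V \<in> LG A d \<Longrightarrow> V \<in> carrier (L A)"
  unfolding cech_loc_def by (rule localization_grading_closed[OF gprod_RG])

lemma Lcomp_eq: "A \<subseteq> {..<s} \<Longrightarrow> V \<in> LG A d \<Longrightarrow> Lcomp A d V = V"
  by (intro loc_hcomp_eq gprod_RG)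

lemma LG_I: "A \<subseteq> {..<s} \<Longrightarrow> V \<in> carrier (L A) \<Longrightarrow> Lcomp A d V = V \<Longrightarrow> V \<in> LG A d"
  using Lcomp_mem by metis

lemma Lcomp_\<rho>:
  assumes A: "A \<subseteq> {..<s}" and t: "t \<in> A" and V: "V \<in> carrier (L (A - {t}))"
  shows "Lcomp A d (\<rho> A t V) = \<rho> A t (Lcomp (A - {t}) d V)"
proof -
  have At: "A - {t} \<subseteq> {..<s}" and ts: "t < s" using A t by auto
  have "(\<Sum>i\<in>A. \<epsilon> i) = (\<Sum>i\<in>A - {t}. \<epsilon> i) + \<epsilon> t"
    using finite_subset[OF A] t by (simp add: sum.remove add.commute)
  then show ?thesis
    using loc_hcomp_loc_map[OF gprod_RG[OF At] g_RG[OF ts] V[unfolded cech_loc_def], of d]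
    unfolding gprod_remove[OF A t] by simp
qed

lemma cech_term_closed:
  assumes "A \<in> subsets_of_card s (Suc p)" "t \<in> A"
    and "\<forall>B\<in>subsets_of_card s p. c B \<in> carrier (L B)"
  shows "\<rho> A t (c (A - {t})) \<in> carrier (L A)"
  using assms subsets_of_card_remove[OF assms(1,2)]
  by (intro abelian_group_hom.hom_closed[OF \<rho>_hom] subsets_of_cardD(1)) auto

lemma cech_d_eq:
  "A \<in> subsets_of_card s (Suc p) \<Longrightarrow> cech_d R M g s p c A =
    (\<Oplus>\<^bsub>L A\<^esub>t\<in>A. sgn_elt R (card {u\<in>A. u < t}) \<odot>\<^bsub>L A\<^esub> \<rho> A t (c (A - {t})))"
  by (simp add: cech_d_def)

lemma cech_d_cong:
  assumes "\<And>B. B \<in> subsets_of_card s p \<Longrightarrow> c B = c' B"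
    and "\<forall>B\<in>subsets_of_card s p. c B \<in> carrier (L B)"
    and A: "A \<in> subsets_of_card s (Suc p)"
  shows "cech_d R M g s p c A = cech_d R M g s p c' A"
proof -
  interpret LA: module R "L A" using module_L subsets_of_cardD(1)[OF A] .
  show ?thesis
    unfolding cech_d_eq[OF A] using assms subsets_of_card_remove[OF A] cech_term_closed[OF A]
    by (intro LA.M.finsum_cong') auto
qed

lemma cech_d_closed:
  assumes A: "A \<in> subsets_of_card s (Suc p)"
    and c: "\<forall>B\<in>subsets_of_card s p. c B \<in> carrier (L B)"
  shows "cech_d R M g s p c A \<in> carrier (L A)"
proof -
  interpret LA: module R "L A" using module_L subsets_of_cardD(1)[OF A] .
  show ?thesis
    unfolding cech_d_eq[OF A] using cech_term_closed[OF A _ c] by (intro LA.M.finsum_closed) auto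
qed

lemma cech_d_add:
  assumes A: "A \<in> subsets_of_card s (Suc p)"
    and c: "\<forall>B\<in>subsets_of_card s p. c B \<in> carrier (L B)"
    and c': "\<forall>B\<in>subsets_of_card s p. c' B \<in> carrier (L B)"
  shows "cech_d R M g s p (\<lambda>B. c B \<oplus>\<^bsub>L B\<^esub> c' B) A
    = cech_d R M g s p c A \<oplus>\<^bsub>L A\<^esub> cech_d R M g s p c' A"
proof -
  note As = subsets_of_cardD(1)[OF A]
  interpret LA: module R "L A" using module_L[OF As] .
  have "cech_d R M g s p (\<lambda>B. c B \<oplus>\<^bsub>L B\<^esub> c' B) A
    = (\<Oplus>\<^bsub>L A\<^esub>t\<in>A. sgn_elt R (card {u\<in>A. u < t}) \<odot>\<^bsub>L A\<^esub> \<rho> A t (c (A - {t}))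
        \<oplus>\<^bsub>L A\<^esub> sgn_elt R (card {u\<in>A. u < t}) \<odot>\<^bsub>L A\<^esub> \<rho> A t (c' (A - {t})))"
    unfolding cech_d_eq[OF A]
  proof (intro LA.M.finsum_cong')
    fix t assume t: "t \<in> A"
    interpret \<rho>: abelian_group_hom "L (A - {t})" "L A" "\<rho> A t" by (rule \<rho>_hom[OF As t])
    have "c (A - {t}) \<in> carrier (L (A - {t}))" "c' (A - {t}) \<in> carrier (L (A - {t}))"
      using c c' subsets_of_card_remove[OF A t] by auto
    then show "sgn_elt R (card {u\<in>A. u < t}) \<odot>\<^bsub>L A\<^esub> \<rho> A t (c (A - {t}) \<oplus>\<^bsub>L (A - {t})\<^esub> c' (A - {t}))
      = sgn_elt R (card {u\<in>A. u < t}) \<odot>\<^bsub>L A\<^esub> \<rho> A t (c (A - {t}))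
        \<oplus>\<^bsub>L A\<^esub> sgn_elt R (card {u\<in>A. u < t}) \<odot>\<^bsub>L A\<^esub> \<rho> A t (c' (A - {t}))"
      by (simp add: LA.smult_r_distr)
  qed (use cech_term_closed[OF A _ c] cech_term_closed[OF A _ c'] in auto)
  also have "\<dots> = cech_d R M g s p c A \<oplus>\<^bsub>L A\<^esub> cech_d R M g s p c' A"
    unfolding cech_d_eq[OF A] using cech_term_closed[OF A _ c] cech_term_closed[OF A _ c']
    by (intro LA.M.finsum_addf) auto
  finally show ?thesis .
qed

text \<open>
  The composition of two localization maps does not depend on their order. The sign of the term
  that omits \<open>t\<close> and then \<open>u\<close> is that of \<open>sgn_elt_swap\<close> for the remaining set \<open>D = A - {t, u}\<close>.
\<close>

lemma cech_d_square:
  assumes A: "A \<in> subsets_of_card s (Suc (Suc p))"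
    and c: "\<forall>B\<in>subsets_of_card s p. c B \<in> carrier (L B)"
  shows "cech_d R M g s (Suc p) (cech_d R M g s p c) A = \<zero>\<^bsub>L A\<^esub>"
proof -
  note As = subsets_of_cardD(1)[OF A]
  interpret LA: module R "L A" using module_L[OF As] .
  define \<sigma> where "\<sigma> K t = sgn_elt R (card {u\<in>K. u < t})" for K :: "nat set" and t
  have \<sigma>: "\<sigma> K t \<in> carrier R" for K t by (simp add: \<sigma>_def)
  define \<Phi> where "\<Phi> t u = (\<sigma> A t \<otimes> \<sigma> (A - {t}) u) \<odot>\<^bsub>L A\<^esub> \<rho> A t (\<rho> (A - {t}) u (c (A - {t} - {u})))" for t u
  have c1: "\<forall>B\<in>subsets_of_card s (Suc p). cech_d R M g s p c B \<in> carrier (L B)"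
    using cech_d_closed c by blast
  have inner: "\<rho> A t (\<rho> (A - {t}) u (c (A - {t} - {u}))) \<in> carrier (L A)"
    if "t \<in> A" "u \<in> A" "t \<noteq> u" for t u
    using that cech_term_closed[OF subsets_of_card_remove[OF A that(1)] _ c, of u]
    by (intro abelian_group_hom.hom_closed[OF \<rho>_hom[OF As]]) auto
  then have \<Phi>: "\<Phi> t u \<in> carrier (L A)" if "t \<in> A" "u \<in> A" "t \<noteq> u" for t u
    using that by (simp add: \<Phi>_def \<sigma>)
  have "cech_d R M g s (Suc p) (cech_d R M g s p c) A = (\<Oplus>\<^bsub>L A\<^esub>t\<in>A. \<Oplus>\<^bsub>L A\<^esub>u\<in>A - {t}. \<Phi> t u)"
    unfolding cech_d_eq[OF A]
  proof (intro LA.M.finsum_cong')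
    fix t assume t: "t \<in> A"
    note At = subsets_of_card_remove[OF A t]
    note Ats = subsets_of_cardD(1)[OF At]
    interpret \<rho>: abelian_group_hom "L (A - {t})" "L A" "\<rho> A t" by (rule \<rho>_hom[OF As t])
    interpret LAt: module R "L (A - {t})" using module_L[OF Ats] .
    note cl = cech_term_closed[OF At _ c]
    have "sgn_elt R (card {u\<in>A. u < t}) \<odot>\<^bsub>L A\<^esub> \<rho> A t (cech_d R M g s p c (A - {t}))
      = \<sigma> A t \<odot>\<^bsub>L A\<^esub> (\<Oplus>\<^bsub>L A\<^esub>u\<in>A - {t}. \<rho> A t (\<sigma> (A - {t}) u \<odot>\<^bsub>L (A - {t})\<^esub> \<rho> (A - {t}) u (c (A - {t} - {u}))))"
      unfolding cech_d_eq[OF At] \<sigma>_def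
      by (subst \<rho>.hom_finsum) (use cl in auto)
    also have "\<dots> = (\<Oplus>\<^bsub>L A\<^esub>u\<in>A - {t}. \<sigma> A t \<odot>\<^bsub>L A\<^esub> \<rho> A t (\<sigma> (A - {t}) u \<odot>\<^bsub>L (A - {t})\<^esub> \<rho> (A - {t}) u (c (A - {t} - {u}))))"
      using cl subsets_of_cardD(2)[OF At] by (intro LA.finsum_smult_ldistr) (auto simp: \<sigma>)
    also have "\<dots> = (\<Oplus>\<^bsub>L A\<^esub>u\<in>A - {t}. \<Phi> t u)"
      using cl \<Phi> t inner
      by (intro LA.M.finsum_cong') (auto simp: \<rho>_smult[OF As t] \<sigma> \<Phi>_def LA.smult_assoc1)
    finally show "sgn_elt R (card {u\<in>A. u < t}) \<odot>\<^bsub>L A\<^esub> \<rho> A t (cech_d R M g s p c (A - {t})) = \<dots>" .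
  qed (use \<Phi> in \<open>auto intro!: LA.M.finsum_closed\<close>)
  also have "\<dots> = \<zero>\<^bsub>L A\<^esub>"
  proof (intro LA.M.finsum_antisymmetric \<Phi> subsets_of_cardD(2)[OF A])
    fix t u assume t: "t \<in> A" and u: "u \<in> A" and tu: "t \<noteq> u"
    define D where "D = A - {t} - {u}"
    have D: "finite D" "t \<notin> D" "u \<notin> D" using subsets_of_cardD(2)[OF A] by (auto simp: D_def)
    have eq: "A - {t} = insert u D" "A - {u} = insert t D" "A - {u} - {t} = D"
      using t u tu by (auto simp: D_def)
    have A_eq: "A = insert t (insert u D)" using t u by (auto simp: D_def)
    have skip: "\<sigma> (insert a K) a = \<sigma> K a" for a K
      unfolding \<sigma>_def by (rule arg_cong[where f = "\<lambda>Y. sgn_elt R (card Y)"]) auto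
    have \<sigma>_eq: "\<sigma> A t = \<sigma> (insert u D) t" "\<sigma> (A - {t}) u = \<sigma> D u"
      "\<sigma> A u = \<sigma> (insert t D) u" "\<sigma> (A - {u}) t = \<sigma> D t"
      using skip[of t "insert u D"] skip[of u D] skip[of u "insert t D"] skip[of t D]
      by (simp_all add: eq A_eq[symmetric] insert_commute[of u t])
    have sgn: "\<sigma> A t \<otimes> \<sigma> (A - {t}) u = \<ominus> (\<sigma> A u \<otimes> \<sigma> (A - {u}) t)"
      using R.sgn_elt_swap[OF D(1,3,2)] tu unfolding \<sigma>_eq by (simp add: \<sigma>_def R.m_comm)
    have "D \<in> subsets_of_card s p"
      using subsets_of_card_remove[OF subsets_of_card_remove[OF A t], of u] u tu by (simp add: D_def)
    then have "c D \<in> carrier (L (A - {t} - {u}))" using c by (simp add: D_def)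
    then have "\<rho> A t (\<rho> (A - {t}) u (c (A - {t} - {u}))) = \<rho> A u (\<rho> (A - {u}) t (c (A - {u} - {t})))"
      using \<rho>_commute[OF As t u tu] unfolding eq(3) D_def by blast
    then have "\<Phi> t u = \<ominus>\<^bsub>L A\<^esub> \<Phi> u t"
      unfolding \<Phi>_def sgn using inner[OF u t] tu by (simp add: LA.smult_l_minus \<sigma>)
    then show "\<Phi> t u \<oplus>\<^bsub>L A\<^esub> \<Phi> u t = \<zero>\<^bsub>L A\<^esub>" using \<Phi>[OF u t] tu by (simp add: LA.M.l_neg)
  qed
  finally show ?thesis .
qed

lemma Lcomp_cech_d:
  assumes A: "A \<in> subsets_of_card s (Suc p)"
    and c: "\<forall>B\<in>subsets_of_card s p. c B \<in> carrier (L B)"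
  shows "Lcomp A d (cech_d R M g s p c A) = cech_d R M g s p (\<lambda>B. Lcomp B d (c B)) A"
proof -
  note As = subsets_of_cardD(1)[OF A]
  note mod = module_L[OF As]
  interpret LA: module R "L A" using mod .
  interpret \<phi>: abelian_group_hom "L A" "L A" "Lcomp A d" by (rule Lcomp_hom[OF As])
  have c': "\<forall>B\<in>subsets_of_card s p. Lcomp B d (c B) \<in> carrier (L B)"
    using c abelian_group_hom.hom_closed[OF Lcomp_hom[OF subsets_of_cardD(1)]] by blast
  have "Lcomp A d (cech_d R M g s p c A)
      = (\<Oplus>\<^bsub>L A\<^esub>t\<in>A. Lcomp A d (sgn_elt R (card {u\<in>A. u < t}) \<odot>\<^bsub>L A\<^esub> \<rho> A t (c (A - {t}))))"
    unfolding cech_d_eq[OF A] using cech_term_closed[OF A _ c] by (intro \<phi>.hom_finsum) auto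
  also have "\<dots> = cech_d R M g s p (\<lambda>B. Lcomp B d (c B)) A"
    unfolding cech_d_eq[OF A]
  proof (intro LA.M.finsum_cong')
    fix t assume t: "t \<in> A"
    have "c (A - {t}) \<in> carrier (L (A - {t}))" using c subsets_of_card_remove[OF A t] by blast
    then show "Lcomp A d (sgn_elt R (card {u\<in>A. u < t}) \<odot>\<^bsub>L A\<^esub> \<rho> A t (c (A - {t})))
        = sgn_elt R (card {u\<in>A. u < t}) \<odot>\<^bsub>L A\<^esub> \<rho> A t (Lcomp (A - {t}) d (c (A - {t})))"
      using hom_smult_sgn_elt[OF mod mod \<phi>.abelian_group_hom_axioms cech_term_closed[OF A t c]]
      by (simp add: Lcomp_\<rho>[OF As t])
  qed (use cech_term_closed[OF A _ c'] in auto)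
  finally show ?thesis .
qed

text \<open>
  The shifts are chosen for this: \<open>f\<^sub>t\<close> raises the degree by \<open>\<delta>\<^sub>t\<close>, and the coefficient at \<open>J \<union> {t}\<close>
  has degree lower by \<open>\<delta>\<^sub>t\<close> than the one at \<open>J\<close>.
\<close>

lemma Lcomp_koszul_d:
  assumes A: "A \<subseteq> {..<s}" and J: "J \<in> subsets_of_card r q"
    and c: "\<forall>K\<in>subsets_of_card r (Suc q). c K \<in> carrier (L A)"
  shows "Lcomp A (d - (\<Sum>j\<in>J. \<delta> j)) (koszul_d R (L A) f r q c J)
    = koszul_d R (L A) f r q (\<lambda>K. Lcomp A (d - (\<Sum>j\<in>K. \<delta> j)) (c K)) J"
proof (rule koszul_module.koszul_d_natural[OF koszul_module_L[OF A] module_L[OF A] _ _ J c])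
  show "abelian_group_hom (L A) (L A) (Lcomp A (d - (\<Sum>j\<in>K. \<delta> j)))" for K
    by (rule Lcomp_hom[OF A])
  fix K t V assume K: "K \<subseteq> {..<r}" and t: "t \<in> {..<r} - K" and V: "V \<in> carrier (L A)"
  have "d - (\<Sum>j\<in>K. \<delta> j) = \<delta> t + (d - (\<Sum>j\<in>insert t K. \<delta> j))"
    using t finite_subset[OF K] by simp
  moreover have "f t \<in> RG (\<delta> t)" using t f_RG by blast
  ultimately show "Lcomp A (d - (\<Sum>j\<in>K. \<delta> j)) (f t \<odot>\<^bsub>L A\<^esub> V)
      = f t \<odot>\<^bsub>L A\<^esub> Lcomp A (d - (\<Sum>j\<in>insert t K. \<delta> j)) V"
    using loc_hcomp_smult[OF gprod_RG[OF A]] V unfolding cech_loc_def by metis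
qed

text \<open>
  The localization maps are linear, hence morphisms between the Koszul complexes of the
  localizations, and the Koszul differential may be exchanged with the sum over \<open>t \<in> A\<close>.
\<close>

lemma cech_d_koszul_d:
  assumes A: "A \<in> subsets_of_card s (Suc p)" and J: "J \<in> subsets_of_card r q"
    and z: "\<forall>B\<in>subsets_of_card s p. \<forall>K\<in>subsets_of_card r (Suc q). z B K \<in> carrier (L B)"
  shows "cech_d R M g s p (\<lambda>B. koszul_d R (L B) f r q (z B) J) A
    = koszul_d R (L A) f r q (\<lambda>K. cech_d R M g s p (\<lambda>B. z B K) A) J"
proof -
  note As = subsets_of_cardD(1)[OF A]
  interpret LA: koszul_module R "L A" f r by (rule koszul_module_L[OF As])
  have closed: "\<forall>K\<in>subsets_of_card r (Suc q). \<rho> A t (z (A - {t}) K) \<in> carrier (L A)"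
    if "t \<in> A" for t
    using cech_term_closed[OF A that, of "\<lambda>B. z B K" for K] z by simp
  have "cech_d R M g s p (\<lambda>B. koszul_d R (L B) f r q (z B) J) A
    = (\<Oplus>\<^bsub>L A\<^esub>t\<in>A. koszul_d R (L A) f r q
        (\<lambda>K. sgn_elt R (card {u\<in>A. u < t}) \<odot>\<^bsub>L A\<^esub> \<rho> A t (z (A - {t}) K)) J)"
    unfolding cech_d_eq[OF A]
  proof (intro LA.M.finsum_cong')
    fix t assume t: "t \<in> A"
    note At = subsets_of_card_remove[OF A t]
    note Ats = subsets_of_cardD(1)[OF At]
    have "\<rho> A t (koszul_d R (L (A - {t})) f r q (z (A - {t})) J)
        = koszul_d R (L A) f r q (\<lambda>K. \<rho> A t (z (A - {t}) K)) J"
    proof (rule koszul_module.koszul_d_natural[OF koszul_module_L[OF Ats] LA.module_axioms _ _ J,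
          of "\<lambda>_. \<rho> A t"])
      show "\<rho> A t (f u \<odot>\<^bsub>L (A - {t})\<^esub> V) = f u \<odot>\<^bsub>L A\<^esub> \<rho> A t V"
        if "u \<in> {..<r} - K" "V \<in> carrier (L (A - {t}))" for u V K
        using that LA.f_closed by (intro \<rho>_smult[OF As t]) auto
    qed (use \<rho>_hom[OF As t] z At in auto)
    then show "sgn_elt R (card {u\<in>A. u < t}) \<odot>\<^bsub>L A\<^esub> \<rho> A t (koszul_d R (L (A - {t})) f r q (z (A - {t})) J)
      = koszul_d R (L A) f r q (\<lambda>K. sgn_elt R (card {u\<in>A. u < t}) \<odot>\<^bsub>L A\<^esub> \<rho> A t (z (A - {t}) K)) J"
      using LA.koszul_d_smult[OF J closed[OF t]] by simp
  qed (use closed in \<open>auto intro!: LA.koszul_d_closed[OF J]\<close>)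
  also have "\<dots> = koszul_d R (L A) f r q
      (\<lambda>K. \<Oplus>\<^bsub>L A\<^esub>t\<in>A. sgn_elt R (card {u\<in>A. u < t}) \<odot>\<^bsub>L A\<^esub> \<rho> A t (z (A - {t}) K)) J"
    using closed by (intro LA.koszul_d_finsum[symmetric] J subsets_of_cardD(2)[OF A]) auto
  also have "\<dots> = koszul_d R (L A) f r q (\<lambda>K. cech_d R M g s p (\<lambda>B. z B K) A) J"
    unfolding cech_d_eq[OF A] ..
  finally show ?thesis .
qed

end

section \<open>The Koszul-Cech double complex\<close>

context koszul_cech
begin

text \<open>
  The place \<open>(p, q)\<close> holds the elements of degree \<open>d\<close> of the Cech cochains of degree \<open>p\<close> with
  values in the Koszul chains of degree \<open>q\<close>.
\<close>

definition double_complex :: "'g \<Rightarrow> nat \<Rightarrow> nat \<Rightarrow> ('a, nat set \<times> nat set \<Rightarrow> ('c \<times> nat) set) module" where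
  "double_complex d p q = prod_module (subsets_of_card s p \<times> subsets_of_card r q)
    (\<lambda>(A, J). (L A)\<lparr>carrier := LG A (d - (\<Sum>j\<in>J. \<delta> j))\<rparr>)"

definition cech_diff ::
    "nat \<Rightarrow> nat \<Rightarrow> (nat set \<times> nat set \<Rightarrow> ('c \<times> nat) set) \<Rightarrow> nat set \<times> nat set \<Rightarrow> ('c \<times> nat) set" where
  "cech_diff p q z = (\<lambda>(A, J)\<in>subsets_of_card s (Suc p) \<times> subsets_of_card r q.
    cech_d R M g s p (\<lambda>B. z (B, J)) A)"

definition koszul_diff ::
    "nat \<Rightarrow> nat \<Rightarrow> (nat set \<times> nat set \<Rightarrow> ('c \<times> nat) set) \<Rightarrow> nat set \<times> nat set \<Rightarrow> ('c \<times> nat) set" where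
  "koszul_diff p q z = (\<lambda>(A, J)\<in>subsets_of_card s p \<times> subsets_of_card r q.
    koszul_d R (L A) f r q (\<lambda>K. z (A, K)) J)"

lemma double_complex_carrier:
  "z \<in> carrier (double_complex d p q) \<longleftrightarrow>
    z \<in> extensional (subsets_of_card s p \<times> subsets_of_card r q) \<and>
    (\<forall>A\<in>subsets_of_card s p. \<forall>J\<in>subsets_of_card r q. z (A, J) \<in> LG A (d - (\<Sum>j\<in>J. \<delta> j)))"
  by (auto simp: double_complex_def PiE_iff)

lemma double_complex_zero:
  "\<zero>\<^bsub>double_complex d p q\<^esub> = (\<lambda>(A, J)\<in>subsets_of_card s p \<times> subsets_of_card r q. \<zero>\<^bsub>L A\<^esub>)"
  by (auto simp: double_complex_def intro!: restrict_ext)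

lemma double_complex_add:
  "x \<oplus>\<^bsub>double_complex d p q\<^esub> y
    = (\<lambda>(A, J)\<in>subsets_of_card s p \<times> subsets_of_card r q. x (A, J) \<oplus>\<^bsub>L A\<^esub> y (A, J))"
  by (auto simp: double_complex_def intro!: restrict_ext)

lemma double_complex_closed:
  assumes "z \<in> carrier (double_complex d p q)" "A \<in> subsets_of_card s p" "J \<in> subsets_of_card r q"
  shows "z (A, J) \<in> carrier (L A)"
  using assms LG_closed[OF subsets_of_cardD(1)[OF assms(2)]] by (auto simp: double_complex_carrier)

lemma abelian_group_double_complex: "abelian_group (double_complex d p q)"
  unfolding double_complex_def
proof (rule abelian_group_prod_module)
  fix i assume "i \<in> subsets_of_card s p \<times> subsets_of_card r q"
  then obtain A J where i: "i = (A, J)" and "A \<in> subsets_of_card s p" by blast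
  then have A: "A \<subseteq> {..<s}" by (simp add: subsets_of_cardD(1))
  show "abelian_group (case i of (A, J) \<Rightarrow> (L A)\<lparr>carrier := LG A (d - (\<Sum>j\<in>J. \<delta> j))\<rparr>)"
    unfolding i prod.case cech_loc_def
    by (rule abelian_group_localization_grading[OF gprod_RG[OF A]])
qed

lemma cech_d_mem:
  assumes A: "A \<in> subsets_of_card s (Suc p)"
    and c: "\<forall>B\<in>subsets_of_card s p. c B \<in> LG B d"
  shows "cech_d R M g s p c A \<in> LG A d"
proof -
  have c': "\<forall>B\<in>subsets_of_card s p. c B \<in> carrier (L B)"
    using c LG_closed subsets_of_cardD(1) by blast
  have "Lcomp A d (cech_d R M g s p c A) = cech_d R M g s p (\<lambda>B. Lcomp B d (c B)) A"
    by (rule Lcomp_cech_d[OF A c'])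
  also have "\<dots> = cech_d R M g s p c A"
    using c c' Lcomp_eq subsets_of_cardD(1) by (intro cech_d_cong[OF _ _ A]) auto
  finally show ?thesis
    using LG_I[OF subsets_of_cardD(1)[OF A] cech_d_closed[OF A c']] by simp
qed

lemma koszul_d_mem:
  assumes A: "A \<subseteq> {..<s}" and J: "J \<in> subsets_of_card r q"
    and c: "\<forall>K\<in>subsets_of_card r (Suc q). c K \<in> LG A (d - (\<Sum>j\<in>K. \<delta> j))"
  shows "koszul_d R (L A) f r q c J \<in> LG A (d - (\<Sum>j\<in>J. \<delta> j))"
proof -
  interpret LA: koszul_module R "L A" f r by (rule koszul_module_L[OF A])
  have c': "\<forall>K\<in>subsets_of_card r (Suc q). c K \<in> carrier (L A)"
    using c LG_closed[OF A] by blast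
  have "Lcomp A (d - (\<Sum>j\<in>J. \<delta> j)) (koszul_d R (L A) f r q c J)
      = koszul_d R (L A) f r q (\<lambda>K. Lcomp A (d - (\<Sum>j\<in>K. \<delta> j)) (c K)) J"
    by (rule Lcomp_koszul_d[OF A J c'])
  also have "\<dots> = koszul_d R (L A) f r q c J"
    using c c' Lcomp_eq[OF A] by (intro fun_cong[OF LA.koszul_d_cong]) auto
  finally show ?thesis
    using LG_I[OF A LA.koszul_d_closed[OF J c']] by simp
qed

lemma cech_diff_hom:
  "abelian_group_hom (double_complex d p q) (double_complex d (Suc p) q) (cech_diff p q)"
proof (intro abelian_group_homI_add abelian_group_double_complex)
  show "cech_diff p q z \<in> carrier (double_complex d (Suc p) q)"
    if "z \<in> carrier (double_complex d p q)" for z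
    using that by (auto simp: double_complex_carrier cech_diff_def intro!: cech_d_mem)
  fix x y assume x: "x \<in> carrier (double_complex d p q)" and y: "y \<in> carrier (double_complex d p q)"
  have "cech_d R M g s p (\<lambda>B. (x \<oplus>\<^bsub>double_complex d p q\<^esub> y) (B, J)) A
      = cech_d R M g s p (\<lambda>B. x (B, J)) A \<oplus>\<^bsub>L A\<^esub> cech_d R M g s p (\<lambda>B. y (B, J)) A"
    if A: "A \<in> subsets_of_card s (Suc p)" and J: "J \<in> subsets_of_card r q" for A J
  proof -
    have cl: "\<forall>B\<in>subsets_of_card s p. x (B, J) \<in> carrier (L B)"
      "\<forall>B\<in>subsets_of_card s p. y (B, J) \<in> carrier (L B)"
      using double_complex_closed x y J by blast+
    have "\<forall>B\<in>subsets_of_card s p. x (B, J) \<oplus>\<^bsub>L B\<^esub> y (B, J) \<in> carrier (L B)"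
    proof
      fix B assume B: "B \<in> subsets_of_card s p"
      interpret LB: module R "L B" using module_L[OF subsets_of_cardD(1)[OF B]] .
      show "x (B, J) \<oplus>\<^bsub>L B\<^esub> y (B, J) \<in> carrier (L B)" using cl B by simp
    qed
    then have "cech_d R M g s p (\<lambda>B. (x \<oplus>\<^bsub>double_complex d p q\<^esub> y) (B, J)) A
      = cech_d R M g s p (\<lambda>B. x (B, J) \<oplus>\<^bsub>L B\<^esub> y (B, J)) A"
      using J by (intro cech_d_cong[OF _ _ A]) (simp_all add: double_complex_add)
    then show ?thesis using cech_d_add[OF A cl] by simp
  qed
  then show "cech_diff p q (x \<oplus>\<^bsub>double_complex d p q\<^esub> y)
      = cech_diff p q x \<oplus>\<^bsub>double_complex d (Suc p) q\<^esub> cech_diff p q y"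
    unfolding double_complex_add[of d "Suc p"] by (auto simp: cech_diff_def intro!: restrict_ext)
qed

lemma koszul_diff_hom:
  "abelian_group_hom (double_complex d p (Suc q)) (double_complex d p q) (koszul_diff p q)"
proof (intro abelian_group_homI_add abelian_group_double_complex)
  show "koszul_diff p q z \<in> carrier (double_complex d p q)"
    if "z \<in> carrier (double_complex d p (Suc q))" for z
    using that subsets_of_cardD(1)
    by (auto simp: double_complex_carrier koszul_diff_def intro!: koszul_d_mem)
  fix x y assume x: "x \<in> carrier (double_complex d p (Suc q))"
    and y: "y \<in> carrier (double_complex d p (Suc q))"
  have "koszul_d R (L A) f r q (\<lambda>K. (x \<oplus>\<^bsub>double_complex d p (Suc q)\<^esub> y) (A, K)) J
      = koszul_d R (L A) f r q (\<lambda>K. x (A, K)) J \<oplus>\<^bsub>L A\<^esub> koszul_d R (L A) f r q (\<lambda>K. y (A, K)) J"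
    if A: "A \<in> subsets_of_card s p" and J: "J \<in> subsets_of_card r q" for A J
  proof -
    interpret LA: koszul_module R "L A" f r
      by (rule koszul_module_L[OF subsets_of_cardD(1)[OF A]])
    have cl: "\<forall>K\<in>subsets_of_card r (Suc q). x (A, K) \<in> carrier (L A)"
      "\<forall>K\<in>subsets_of_card r (Suc q). y (A, K) \<in> carrier (L A)"
      using double_complex_closed x y A by blast+
    then have "koszul_d R (L A) f r q (\<lambda>K. (x \<oplus>\<^bsub>double_complex d p (Suc q)\<^esub> y) (A, K)) J
      = koszul_d R (L A) f r q (\<lambda>K. x (A, K) \<oplus>\<^bsub>L A\<^esub> y (A, K)) J"
      using A by (intro fun_cong[OF LA.koszul_d_cong]) (simp_all add: double_complex_add)
    then show ?thesis using LA.koszul_d_add[OF J cl] by simp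
  qed
  then show "koszul_diff p q (x \<oplus>\<^bsub>double_complex d p (Suc q)\<^esub> y)
      = koszul_diff p q x \<oplus>\<^bsub>double_complex d p q\<^esub> koszul_diff p q y"
    unfolding double_complex_add[of d p q] by (auto simp: koszul_diff_def intro!: restrict_ext)
qed

lemma cech_diff_koszul_diff:
  assumes z: "z \<in> carrier (double_complex d p (Suc q))"
  shows "cech_diff p q (koszul_diff p q z) = koszul_diff (Suc p) q (cech_diff p (Suc q) z)"
proof -
  have cl: "\<forall>B\<in>subsets_of_card s p. \<forall>K\<in>subsets_of_card r (Suc q). z (B, K) \<in> carrier (L B)"
    using double_complex_closed[OF z] by blast
  have "cech_d R M g s p (\<lambda>B. koszul_diff p q z (B, J)) A
      = koszul_d R (L A) f r q (\<lambda>K. cech_diff p (Suc q) z (A, K)) J"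
    if A: "A \<in> subsets_of_card s (Suc p)" and J: "J \<in> subsets_of_card r q" for A J
  proof -
    interpret LA: koszul_module R "L A" f r
      by (rule koszul_module_L[OF subsets_of_cardD(1)[OF A]])
    have eq: "koszul_diff p q z (B, J) = koszul_d R (L B) f r q (\<lambda>K. z (B, K)) J"
      if "B \<in> subsets_of_card s p" for B
      using that J by (simp add: koszul_diff_def)
    have "cech_d R M g s p (\<lambda>B. koszul_diff p q z (B, J)) A
        = cech_d R M g s p (\<lambda>B. koszul_d R (L B) f r q (\<lambda>K. z (B, K)) J) A"
      using koszul_module.koszul_d_closed[OF koszul_module_L[OF subsets_of_cardD(1)] J] cl
      by (intro cech_d_cong[OF _ _ A] ballI) (simp_all add: eq)
    also have "\<dots> = koszul_d R (L A) f r q (\<lambda>K. cech_d R M g s p (\<lambda>B. z (B, K)) A) J"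
      by (rule cech_d_koszul_d[OF A J cl])
    also have "\<dots> = koszul_d R (L A) f r q (\<lambda>K. cech_diff p (Suc q) z (A, K)) J"
      using A cl by (intro fun_cong[OF LA.koszul_d_cong]) (auto simp: cech_diff_def intro!: cech_d_closed)
    finally show ?thesis .
  qed
  then show ?thesis
    unfolding cech_diff_def[of p q] koszul_diff_def[of "Suc p"] by (intro restrict_ext) auto
qed

lemma cech_diff_square:
  assumes z: "z \<in> carrier (double_complex d p q)"
  shows "cech_diff (Suc p) q (cech_diff p q z) = \<zero>\<^bsub>double_complex d (Suc (Suc p)) q\<^esub>"
proof -
  have "cech_d R M g s (Suc p) (\<lambda>B. cech_diff p q z (B, J)) A = \<zero>\<^bsub>L A\<^esub>"
    if A: "A \<in> subsets_of_card s (Suc (Suc p))" and J: "J \<in> subsets_of_card r q" for A J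
  proof -
    have cl: "\<forall>B\<in>subsets_of_card s p. z (B, J) \<in> carrier (L B)"
      using double_complex_closed[OF z] J by blast
    have "cech_d R M g s (Suc p) (\<lambda>B. cech_diff p q z (B, J)) A
        = cech_d R M g s (Suc p) (cech_d R M g s p (\<lambda>B. z (B, J))) A"
      using J cl by (intro cech_d_cong[OF _ _ A]) (auto simp: cech_diff_def intro!: cech_d_closed)
    then show ?thesis using cech_d_square[OF A cl] by simp
  qed
  then show ?thesis
    unfolding double_complex_zero cech_diff_def[of "Suc p"] by (intro restrict_ext) auto
qed

lemma koszul_diff_square:
  assumes z: "z \<in> carrier (double_complex d p (Suc (Suc q)))"
  shows "koszul_diff p q (koszul_diff p (Suc q) z) = \<zero>\<^bsub>double_complex d p q\<^esub>"
proof -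
  have "koszul_d R (L A) f r q (\<lambda>K. koszul_diff p (Suc q) z (A, K)) J = \<zero>\<^bsub>L A\<^esub>"
    if A: "A \<in> subsets_of_card s p" and J: "J \<in> subsets_of_card r q" for A J
  proof -
    interpret LA: koszul_module R "L A" f r
      by (rule koszul_module_L[OF subsets_of_cardD(1)[OF A]])
    have cl: "\<forall>K\<in>subsets_of_card r (Suc (Suc q)). z (A, K) \<in> carrier (L A)"
      using double_complex_closed[OF z A] by blast
    have "koszul_d R (L A) f r q (\<lambda>K. koszul_diff p (Suc q) z (A, K)) J
        = koszul_d R (L A) f r q (koszul_d R (L A) f r (Suc q) (\<lambda>K. z (A, K))) J"
      using A cl by (intro fun_cong[OF LA.koszul_d_cong]) (auto simp: koszul_diff_def intro!: LA.koszul_d_closed)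
    then show ?thesis using LA.koszul_d_square[OF J cl] by simp
  qed
  then show ?thesis
    unfolding double_complex_zero koszul_diff_def[of p q] by (intro restrict_ext) auto
qed

lemma gprod_power_in_sum:
  assumes rad: "Idl (g ` {..<s}) \<subseteq> ideal_radical R (set_add R (Idl (f ` {..<r})) (annihilator R M))"
    and A: "A \<subseteq> {..<s}" and t: "t \<in> A"
  shows "\<exists>k::nat. gprod A [^] k \<in> set_add R (Idl (f ` {..<r})) (annihilator R M)"
proof -
  have sub: "g ` {..<s} \<subseteq> carrier R" using g_closed by auto
  interpret B: ideal "Idl (g ` {..<s})" R by (rule R.genideal_ideal[OF sub])
  have "g t \<in> Idl (g ` {..<s})" using R.genideal_self[OF sub] t A by blast
  then have "gprod A \<in> Idl (g ` {..<s})"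
    using B.I_l_closed gprod_factors_closed[OF A t] gprod_remove[OF A t] by metis
  then show ?thesis using rad by (auto simp: ideal_radical_def)
qed

text \<open>
  Homogeneous cycles are boundaries of chains that may be inhomogeneous; their homogeneous
  components of the right degrees have the same boundary.
\<close>

lemma koszul_diff_exact:
  assumes rad: "Idl (g ` {..<s}) \<subseteq> ideal_radical R (set_add R (Idl (f ` {..<r})) (annihilator R M))"
    and z: "z \<in> carrier (double_complex d (Suc p) q)"
    and cyc: "\<And>q'. q = Suc q' \<Longrightarrow> koszul_diff (Suc p) q' z = \<zero>\<^bsub>double_complex d (Suc p) q'\<^esub>"
  shows "z \<in> koszul_diff (Suc p) q ` carrier (double_complex d (Suc p) (Suc q))"
proof -
  have "\<exists>v. (\<forall>K\<in>subsets_of_card r (Suc q). v K \<in> LG A (d - (\<Sum>j\<in>K. \<delta> j))) \<and>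
      (\<forall>J\<in>subsets_of_card r q. koszul_d R (L A) f r q v J = z (A, J))"
    if A: "A \<in> subsets_of_card s (Suc p)" for A
  proof -
    note As = subsets_of_cardD(1)[OF A]
    interpret LA: koszul_module R "L A" f r by (rule koszul_module_L[OF As])
    have "A \<noteq> {}" using subsets_of_cardD(3)[OF A] by auto
    then obtain t where t: "t \<in> A" by blast
    obtain k :: nat where "gprod A [^] k \<in> set_add R (Idl (f ` {..<r})) (annihilator R M)"
      using gprod_power_in_sum[OF rad As t] by blast
    then have k: "gprod A [^] k \<in> set_add R (Idl (f ` {..<r})) (annihilator R (L A))"
      using annihilator_localization[OF gprod_closed[OF As]] unfolding cech_loc_def set_add_def' by blast
    have "LA.koszul_cycle q (\<lambda>J. z (A, J))"
      unfolding LA.koszul_cycle_def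
    proof (intro conjI allI impI ballI)
      show "z (A, J) \<in> carrier (L A)" if "J \<in> subsets_of_card r q" for J
        using double_complex_closed[OF z A that] .
      fix q' J assume q: "q = Suc q'" and J: "J \<in> subsets_of_card r q'"
      have "koszul_diff (Suc p) q' z (A, J) = \<zero>\<^bsub>L A\<^esub>"
        unfolding cyc[OF q] using A J by (simp add: double_complex_zero)
      then show "koszul_d R (L A) f r q' (\<lambda>J. z (A, J)) J = \<zero>\<^bsub>L A\<^esub>"
        using A J by (simp add: koszul_diff_def)
    qed
    then have "LA.koszul_boundary q (\<lambda>J. z (A, J))"
      using bij_betw_smult_pow_localization[OF gprod_closed[OF As], of k] k gprod_closed[OF As]
      by (intro LA.koszul_exact[of "gprod A [^] k"]) (simp_all add: cech_loc_def)
    then obtain v where v: "\<forall>K\<in>subsets_of_card r (Suc q). v K \<in> carrier (L A)"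
      and dv: "\<forall>J\<in>subsets_of_card r q. koszul_d R (L A) f r q v J = z (A, J)"
      unfolding LA.koszul_boundary_def by blast
    have "koszul_d R (L A) f r q (\<lambda>K. Lcomp A (d - (\<Sum>j\<in>K. \<delta> j)) (v K)) J = z (A, J)"
      if J: "J \<in> subsets_of_card r q" for J
      using Lcomp_koszul_d[OF As J v, of d] dv J Lcomp_eq[OF As] z A
      by (simp add: double_complex_carrier)
    then show ?thesis
      using v Lcomp_mem[OF As] by (intro exI[of _ "\<lambda>K. Lcomp A (d - (\<Sum>j\<in>K. \<delta> j)) (v K)"]) auto
  qed
  then have "\<forall>A\<in>subsets_of_card s (Suc p). \<exists>v.
      (\<forall>K\<in>subsets_of_card r (Suc q). v K \<in> LG A (d - (\<Sum>j\<in>K. \<delta> j))) \<and>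
      (\<forall>J\<in>subsets_of_card r q. koszul_d R (L A) f r q v J = z (A, J))" by blast
  from bchoice[OF this] obtain v where v: "\<forall>A\<in>subsets_of_card s (Suc p).
      (\<forall>K\<in>subsets_of_card r (Suc q). v A K \<in> LG A (d - (\<Sum>j\<in>K. \<delta> j))) \<and>
      (\<forall>J\<in>subsets_of_card r q. koszul_d R (L A) f r q (v A) J = z (A, J))" by blast
  define y where "y = (\<lambda>(A, K)\<in>subsets_of_card s (Suc p) \<times> subsets_of_card r (Suc q). v A K)"
  have y: "y \<in> carrier (double_complex d (Suc p) (Suc q))"
    using v by (auto simp: double_complex_carrier y_def)
  have "koszul_diff (Suc p) q y = z"
  proof (rule extensionalityI)
    show "z \<in> extensional (subsets_of_card s (Suc p) \<times> subsets_of_card r q)"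
      using z by (simp add: double_complex_carrier)
    fix i assume "i \<in> subsets_of_card s (Suc p) \<times> subsets_of_card r q"
    then obtain A J where i: "i = (A, J)" and A: "A \<in> subsets_of_card s (Suc p)"
      and J: "J \<in> subsets_of_card r q" by blast
    interpret LA: koszul_module R "L A" f r
      by (rule koszul_module_L[OF subsets_of_cardD(1)[OF A]])
    have "koszul_d R (L A) f r q (\<lambda>K. y (A, K)) J = koszul_d R (L A) f r q (v A) J"
      using A double_complex_closed[OF y A]
      by (intro fun_cong[OF LA.koszul_d_cong] ballI) (simp_all add: y_def)
    then show "koszul_diff (Suc p) q y i = z i"
      using v A J by (simp add: koszul_diff_def i)
  qed (simp add: koszul_diff_def)
  then show ?thesis using y by blast
qed

end

section \<open>Supports of subquotients\<close>

lemma not_in_Supp_subquotientD: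
  assumes N: "abelian_group N" and U: "\<zero>\<^bsub>N\<^esub> \<in> U"
    and d: "d \<notin> Supp (subquotient N Z U) (subquotient_grading N NG Z U)"
    and z: "z \<in> Z" "z \<in> NG d" "z \<in> carrier N"
  shows "z \<in> U"
proof -
  interpret abelian_group N by fact
  have "U +>\<^bsub>N\<^esub> z = U"
    using d z unfolding Supp_def subquotient_grading_def by (auto simp: subquotient_def)
  moreover have "\<zero>\<^bsub>N\<^esub> \<oplus>\<^bsub>N\<^esub> z \<in> U +>\<^bsub>N\<^esub> z"
    using U unfolding a_r_coset_def' by blast
  ultimately show ?thesis using z(3) by simp
qed

lemma not_in_Supp_subquotientI:
  assumes N: "abelian_group N" and U: "subgroup U (add_monoid N)"
    and ne: "\<zero>\<^bsub>N\<^esub> \<in> Z" "\<zero>\<^bsub>N\<^esub> \<in> NG d" and sub: "Z \<inter> NG d \<subseteq> U"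
  shows "d \<notin> Supp (subquotient N Z U) (subquotient_grading N NG Z U)"
proof -
  interpret abelian_group N by fact
  have "U +>\<^bsub>N\<^esub> z = U" if "z \<in> Z \<inter> NG d" for z
    using that sub subgroup.subset[OF U] by (intro a_coset_join2 U) auto
  then have "(\<lambda>z. U +>\<^bsub>N\<^esub> z) ` (Z \<inter> NG d) = {U}"
    using ne by blast
  then show ?thesis by (simp add: Supp_def subquotient_grading_def subquotient_def)
qed

section \<open>Koszul homology and Cech cohomology\<close>

context koszul_cech
begin

abbreviation "cech_vanishes p d \<equiv>
  d \<notin> Supp (cech_cohomology R M g s p) (cech_cohomology_grading R RG M MG g s p)"

lemma abelian_group_cech: "abelian_group (cech R M g s p)"
  unfolding cech_def
  by (intro abelian_group_prod_module module.axioms(2)[OF module_L] subsets_of_cardD(1))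

text \<open>
  The vanishing of cohomology in degree \<open>d - \<Sum>\<^sub>j\<^sub>\<in>\<^sub>J \<delta>\<^sub>j\<close> says that homogeneous cocycles of this degree
  are coboundaries, possibly of inhomogeneous cochains. For positive \<open>p\<close> the cochains are made
  homogeneous in the next lemma.
\<close>

lemma cech_diff_exact:
  assumes van: "\<forall>J\<in>subsets_of_card r q. cech_vanishes p (d - (\<Sum>j\<in>J. \<delta> j))"
    and z: "z \<in> carrier (double_complex d p q)"
    and dz: "cech_diff p q z = \<zero>\<^bsub>double_complex d (Suc p) q\<^esub>"
    and J: "J \<in> subsets_of_card r q"
  shows "(\<lambda>A\<in>subsets_of_card s p. z (A, J)) \<in> cech_coboundaries R M g s p"
proof -
  let ?N = "cech R M g s p" and ?c = "\<lambda>A\<in>subsets_of_card s p. z (A, J)"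
  have cl: "\<forall>A\<in>subsets_of_card s p. z (A, J) \<in> carrier (L A)"
    using double_complex_closed[OF z _ J] by blast
  have c: "?c \<in> carrier ?N" using cl by (simp add: cech_def)
  have "cech_d R M g s p ?c A = \<zero>\<^bsub>L A\<^esub>" if A: "A \<in> subsets_of_card s (Suc p)" for A
  proof -
    have "cech_d R M g s p ?c A = cech_d R M g s p (\<lambda>A. z (A, J)) A"
      using cl by (intro cech_d_cong[OF _ _ A]) auto
    also have "\<dots> = cech_diff p q z (A, J)" using A J by (simp add: cech_diff_def)
    also have "\<dots> = \<zero>\<^bsub>L A\<^esub>" unfolding dz using A J by (simp add: double_complex_zero)
    finally show ?thesis .
  qed
  then have "cech_d R M g s p ?c = \<zero>\<^bsub>cech R M g s (Suc p)\<^esub>"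
    by (intro extensionalityI[of _ "subsets_of_card s (Suc p)"]) (auto simp: cech_def cech_d_def)
  then have cocycle: "?c \<in> cech_cocycles R M g s p" using c by (simp add: cech_cocycles_def)
  have graded: "?c \<in> cech_grading R RG M MG g s p (d - (\<Sum>j\<in>J. \<delta> j))"
    using z J by (auto simp: cech_grading_def double_complex_carrier)
  have "\<zero>\<^bsub>?N\<^esub> \<in> cech_coboundaries R M g s p"
  proof (cases p)
    case (Suc p')
    have zero: "\<zero>\<^bsub>L A\<^esub> \<in> carrier (L A)" if "A \<in> subsets_of_card s n" for A n
      using abelian_groupE(2)[OF module.axioms(2)[OF module_L[OF subsets_of_cardD(1)[OF that]]]] .
    \<comment> \<open>Zero is a coboundary because the additive \<open>cech_diff\<close> maps zero to zero.\<close>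
    have "cech_diff p' q \<zero>\<^bsub>double_complex d p' q\<^esub> = \<zero>\<^bsub>double_complex d p q\<^esub>"
      using abelian_group_hom.hom_zero[OF cech_diff_hom] Suc by simp
    then have dzero: "cech_d R M g s p' (\<lambda>B. \<zero>\<^bsub>double_complex d p' q\<^esub> (B, J)) A = \<zero>\<^bsub>L A\<^esub>"
      if "A \<in> subsets_of_card s p" for A
      using that J Suc by (auto simp: cech_diff_def double_complex_zero dest!: fun_cong[of _ _ "(A, J)"])
    have "cech_d R M g s p' \<zero>\<^bsub>cech R M g s p'\<^esub> A = \<zero>\<^bsub>L A\<^esub>" if A: "A \<in> subsets_of_card s p" for A
      using dzero[OF A] J zero A Suc
        cech_d_cong[of p' "\<zero>\<^bsub>cech R M g s p'\<^esub>" "\<lambda>B. \<zero>\<^bsub>double_complex d p' q\<^esub> (B, J)" A]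
      by (simp add: cech_def double_complex_zero)
    then have "cech_d R M g s p' \<zero>\<^bsub>cech R M g s p'\<^esub> = \<zero>\<^bsub>?N\<^esub>"
      using Suc by (intro extensionalityI[of _ "subsets_of_card s p"]) (auto simp: cech_def cech_d_def)
    moreover have "\<zero>\<^bsub>cech R M g s p'\<^esub> \<in> carrier (cech R M g s p')"
      using abelian_groupE(2)[OF abelian_group_cech] .
    ultimately show ?thesis unfolding cech_coboundaries_def Suc nat.case by (metis image_eqI Suc)
  qed (simp add: cech_coboundaries_def)
  then show ?thesis
    by (rule not_in_Supp_subquotientD[OF abelian_group_cech _ bspec[OF van J,
          unfolded cech_cohomology_def cech_cohomology_grading_def] cocycle graded c])
qed

lemma cech_diff_exact_Suc:
  assumes van: "\<forall>J\<in>subsets_of_card r q. cech_vanishes (Suc p) (d - (\<Sum>j\<in>J. \<delta> j))"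
    and z: "z \<in> carrier (double_complex d (Suc p) q)"
    and dz: "cech_diff (Suc p) q z = \<zero>\<^bsub>double_complex d (Suc (Suc p)) q\<^esub>"
  shows "z \<in> cech_diff p q ` carrier (double_complex d p q)"
proof -
  have "\<forall>J\<in>subsets_of_card r q. \<exists>c. c \<in> carrier (cech R M g s p) \<and>
      (\<lambda>A\<in>subsets_of_card s (Suc p). z (A, J)) = cech_d R M g s p c"
    using cech_diff_exact[OF van z dz] by (auto simp: cech_coboundaries_def)
  from bchoice[OF this] obtain c where c: "\<forall>J\<in>subsets_of_card r q. c J \<in> carrier (cech R M g s p) \<and>
      (\<lambda>A\<in>subsets_of_card s (Suc p). z (A, J)) = cech_d R M g s p (c J)" by blast
  have cl: "\<forall>A\<in>subsets_of_card s p. c J A \<in> carrier (L A)" if "J \<in> subsets_of_card r q" for J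
    using c that by (auto simp: cech_def)
  define y where "y = (\<lambda>(A, J)\<in>subsets_of_card s p \<times> subsets_of_card r q.
    Lcomp A (d - (\<Sum>j\<in>J. \<delta> j)) (c J A))"
  have y: "y \<in> carrier (double_complex d p q)"
    using cl Lcomp_mem subsets_of_cardD(1) by (auto simp: double_complex_carrier y_def)
  have "cech_diff p q y = z"
  proof (rule extensionalityI)
    show "z \<in> extensional (subsets_of_card s (Suc p) \<times> subsets_of_card r q)"
      using z by (simp add: double_complex_carrier)
    fix i assume "i \<in> subsets_of_card s (Suc p) \<times> subsets_of_card r q"
    then obtain A J where i: "i = (A, J)" and A: "A \<in> subsets_of_card s (Suc p)"
      and J: "J \<in> subsets_of_card r q" by blast
    note As = subsets_of_cardD(1)[OF A]
    have "cech_d R M g s p (\<lambda>B. y (B, J)) A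
        = cech_d R M g s p (\<lambda>B. Lcomp B (d - (\<Sum>j\<in>J. \<delta> j)) (c J B)) A"
      using J double_complex_closed[OF y _ J] by (intro cech_d_cong[OF _ _ A]) (auto simp: y_def)
    also have "\<dots> = Lcomp A (d - (\<Sum>j\<in>J. \<delta> j)) (cech_d R M g s p (c J) A)"
      using Lcomp_cech_d[OF A cl[OF J]] by simp
    also have "cech_d R M g s p (c J) A = z (A, J)"
      using c J A by (metis restrict_apply')
    also have "Lcomp A (d - (\<Sum>j\<in>J. \<delta> j)) (z (A, J)) = z (A, J)"
      using z A J by (intro Lcomp_eq[OF As]) (simp add: double_complex_carrier)
    finally show "cech_diff p q y i = z i" using A J by (simp add: cech_diff_def i)
  qed (simp add: cech_diff_def)
  then show ?thesis using y by blast
qed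

lemma cech_diff_exact_0:
  assumes van: "\<forall>J\<in>subsets_of_card r q. cech_vanishes 0 (d - (\<Sum>j\<in>J. \<delta> j))"
    and z: "z \<in> carrier (double_complex d 0 q)"
    and dz: "cech_diff 0 q z = \<zero>\<^bsub>double_complex d (Suc 0) q\<^esub>"
  shows "z = \<zero>\<^bsub>double_complex d 0 q\<^esub>"
proof (rule extensionalityI)
  show "z \<in> extensional (subsets_of_card s 0 \<times> subsets_of_card r q)"
    using z by (simp add: double_complex_carrier)
  fix i assume "i \<in> subsets_of_card s 0 \<times> subsets_of_card r q"
  then obtain A J where i: "i = (A, J)" and A: "A \<in> subsets_of_card s 0"
    and J: "J \<in> subsets_of_card r q" by blast
  have "(\<lambda>A\<in>subsets_of_card s 0. z (A, J)) = \<zero>\<^bsub>cech R M g s 0\<^esub>"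
    using cech_diff_exact[OF van z dz J] by (simp add: cech_coboundaries_def)
  from fun_cong[OF this, of A] show "z i = \<zero>\<^bsub>double_complex d 0 q\<^esub> i"
    using A J by (simp add: i cech_def double_complex_zero)
qed (simp add: double_complex_zero)

lemma double_complex_bounded:
  assumes "p > s" "z \<in> carrier (double_complex d p q)"
  shows "z = \<zero>\<^bsub>double_complex d p q\<^esub>"
proof -
  have "A \<notin> subsets_of_card s p" for A
  proof
    assume A: "A \<in> subsets_of_card s p"
    show False
      using card_mono[OF finite_lessThan subsets_of_cardD(1)[OF A]] subsets_of_cardD(3)[OF A] assms(1)
      by simp
  qed
  then have "subsets_of_card s p = {}" by blast
  then show ?thesis
    using assms(2) by (auto simp: double_complex_carrier double_complex_zero extensional_def)
qed

lemma subsets_of_card_0: "subsets_of_card n 0 = {{}}"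
proof (intro equalityI subsetI)
  fix A assume "A \<in> subsets_of_card n 0"
  from subsets_of_cardD(2,3)[OF this] show "A \<in> {{}}" by simp
qed (simp add: subsets_of_card_def)

lemma L_empty: "L {} = localization R M \<one>"
  by (simp add: cech_loc_def)

text \<open>
  A Koszul cycle \<open>c\<close> of \<open>M\<close> becomes an element \<open>z\<close> at \<open>(0, j)\<close> of the double complex under the
  isomorphism of \<open>M\<close> with its localization at \<open>1\<close>. A chain with boundary \<open>z\<close>, found by the diagram
  chase, is carried back to \<open>M\<close>.
\<close>

lemma homogeneous_cycle_is_boundary:
  assumes rad: "Idl (g ` {..<s}) \<subseteq> ideal_radical R (set_add R (Idl (f ` {..<r})) (annihilator R M))"
    and van: "\<And>p J. J \<in> subsets_of_card r (j + p) \<Longrightarrow> cech_vanishes p (d - (\<Sum>i\<in>J. \<delta> i))"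
    and c: "c \<in> koszul_cycles R M f r j" "c \<in> koszul_grading MG \<delta> r j d"
  shows "c \<in> koszul_boundaries R M f r j"
proof -
  interpret MK: koszul_module R M f r by (rule koszul_module_M)
  interpret LK: koszul_module R "L {}" f r by (rule koszul_module_L) simp
  define \<iota> where "\<iota> x = loc_frac R M \<one> x 0" for x
  have \<iota>_hom: "abelian_group_hom M (L {}) \<iota>"
    unfolding L_empty \<iota>_def using localization_one_hom .
  interpret \<iota>: abelian_group_hom M "L {}" \<iota> by (rule \<iota>_hom)
  have \<iota>_inj: "x = y" if "\<iota> x = \<iota> y" "x \<in> carrier M" "y \<in> carrier M" for x y
    using that by (simp add: \<iota>_def loc_frac_one_eq_iff)
  have \<iota>_koszul: "\<iota> (koszul_d R M f r q v J) = koszul_d R (L {}) f r q (\<lambda>K. \<iota> (v K)) J"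
    if "J \<in> subsets_of_card r q" "\<forall>K\<in>subsets_of_card r (Suc q). v K \<in> carrier M" for q v J
  proof (rule MK.koszul_d_natural[OF LK.module_axioms _ _ that, of "\<lambda>_. \<iota>"])
    show "\<iota> (f t \<odot>\<^bsub>M\<^esub> x) = f t \<odot>\<^bsub>L {}\<^esub> \<iota> x" if "t \<in> {..<r} - K" "x \<in> carrier M" for K t x
      using that MK.f_closed unfolding L_empty \<iota>_def by (subst loc_frac_smult) auto
  qed (rule \<iota>_hom)
  have c_mem: "c J \<in> MG (d - (\<Sum>i\<in>J. \<delta> i))" if "J \<in> subsets_of_card r j" for J
    using c(2) that by (auto simp: koszul_grading_def)
  then have c_closed: "\<forall>J\<in>subsets_of_card r j. c J \<in> carrier M" using MG_closed by blast
  define z where "z = (\<lambda>(A, J)\<in>subsets_of_card s 0 \<times> subsets_of_card r j. \<iota> (c J))"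
  have \<iota>_mem: "\<iota> x \<in> LG {} e" if "x \<in> MG e" for x e
    using that one_RG by (force simp: localization_grading_def \<iota>_def)
  have z: "z \<in> carrier (double_complex d 0 j)"
    using c_mem \<iota>_mem by (auto simp: double_complex_carrier z_def subsets_of_card_0)
  have cycle: "koszul_diff 0 q z = \<zero>\<^bsub>double_complex d 0 q\<^esub>" if j: "j = Suc q" for q
  proof -
    have "koszul_d R (L {}) f r q (\<lambda>K. z ({}, K)) J = \<zero>\<^bsub>L {}\<^esub>" if J: "J \<in> subsets_of_card r q" for J
    proof -
      have "koszul_d R (L {}) f r q (\<lambda>K. z ({}, K)) J = koszul_d R (L {}) f r q (\<lambda>K. \<iota> (c K)) J"
        using c_closed j by (intro fun_cong[OF LK.koszul_d_cong]) (auto simp: z_def subsets_of_card_0)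
      also have "\<dots> = \<iota> (koszul_d R M f r q c J)"
        using \<iota>_koszul[OF J] c_closed j by simp
      also have "koszul_d R M f r q c = \<zero>\<^bsub>koszul M r q\<^esub>"
        using c(1) j by (simp add: koszul_cycles_def)
      finally show ?thesis using J by (simp add: koszul_def)
    qed
    then show ?thesis
      unfolding double_complex_zero koszul_diff_def
      by (intro restrict_ext) (auto simp: subsets_of_card_0)
  qed
  have "z \<in> koszul_diff 0 j ` carrier (double_complex d 0 (Suc j))"
  proof (rule double_complex_cycle_is_boundary[where C = "double_complex d", OF cech_diff_hom
        koszul_diff_hom cech_diff_koszul_diff cech_diff_square koszul_diff_square
        koszul_diff_exact[OF rad] _ _ double_complex_bounded z cycle])
    show "x = \<zero>\<^bsub>double_complex d 0 j\<^esub>"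
      if "x \<in> carrier (double_complex d 0 j)" "cech_diff 0 j x = \<zero>\<^bsub>double_complex d 1 j\<^esub>" for x
      using van[of _ 0] that by (intro cech_diff_exact_0) auto
    show "x \<in> cech_diff p (j + Suc p) ` carrier (double_complex d p (j + Suc p))"
      if "x \<in> carrier (double_complex d (Suc p) (j + Suc p))"
        "cech_diff (Suc p) (j + Suc p) x = \<zero>\<^bsub>double_complex d (Suc (Suc p)) (j + Suc p)\<^esub>" for p x
      using van[of _ "Suc p"] that by (intro cech_diff_exact_Suc) auto
  qed
  then obtain y where y: "y \<in> carrier (double_complex d 0 (Suc j))" and zy: "z = koszul_diff 0 j y"
    by blast
  have yL: "\<forall>K\<in>subsets_of_card r (Suc j). y ({}, K) \<in> carrier (L {})"
    using double_complex_closed[OF y] by (simp add: subsets_of_card_0)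
  have "\<forall>K\<in>subsets_of_card r (Suc j). \<exists>x. x \<in> carrier M \<and> \<iota> x = y ({}, K)"
  proof
    fix K assume "K \<in> subsets_of_card r (Suc j)"
    then have "y ({}, K) \<in> carrier (localization R M \<one>)"
      using yL unfolding L_empty by blast
    then obtain x k where "x \<in> carrier M" "y ({}, K) = loc_frac R M \<one> x k" by auto
    then show "\<exists>x. x \<in> carrier M \<and> \<iota> x = y ({}, K)" by (intro exI[of _ x]) (simp add: \<iota>_def loc_frac_one_eq_iff)
  qed
  from bchoice[OF this] obtain v
    where v: "\<forall>K\<in>subsets_of_card r (Suc j). v K \<in> carrier M \<and> \<iota> (v K) = y ({}, K)" by blast
  define w where "w = restrict v (subsets_of_card r (Suc j))"
  have w: "w \<in> carrier (koszul M r (Suc j))" using v by (auto simp: koszul_def w_def)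
  have w_closed: "\<forall>K\<in>subsets_of_card r (Suc j). w K \<in> carrier M" using v by (simp add: w_def)
  have "koszul_d R M f r j w = c"
  proof (rule extensionalityI)
    show "c \<in> extensional (subsets_of_card r j)" using c(2) by (auto simp: koszul_grading_def PiE_iff)
    fix J assume J: "J \<in> subsets_of_card r j"
    have "\<iota> (koszul_d R M f r j w J) = koszul_d R (L {}) f r j (\<lambda>K. \<iota> (w K)) J"
      by (rule \<iota>_koszul[OF J w_closed])
    also have "\<dots> = koszul_d R (L {}) f r j (\<lambda>K. y ({}, K)) J"
      using v yL by (intro fun_cong[OF LK.koszul_d_cong]) (simp_all add: w_def)
    also have "\<dots> = z ({}, J)"
      using J unfolding zy by (simp add: koszul_diff_def subsets_of_card_0)
    also have "\<dots> = \<iota> (c J)" using J by (simp add: z_def subsets_of_card_0)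
    finally show "koszul_d R M f r j w J = c J"
      using MK.koszul_d_closed[OF J w_closed] c_closed J by (intro \<iota>_inj) auto
  qed (simp add: koszul_d_def)
  then show ?thesis using w by (auto simp: koszul_boundaries_def)
qed

lemma koszul_d_hom: "abelian_group_hom (koszul M r (Suc q)) (koszul M r q) (koszul_d R M f r q)"
proof (rule abelian_group_homI_add)
  interpret MK: koszul_module R M f r by (rule koszul_module_M)
  show "abelian_group (koszul M r (Suc q))" "abelian_group (koszul M r q)"
    unfolding koszul_def by (intro abelian_group_prod_module M.abelian_group_axioms)+
  show "koszul_d R M f r q c \<in> carrier (koszul M r q)" if "c \<in> carrier (koszul M r (Suc q))" for c
    unfolding koszul_def prod_module_simps
  proof (rule PiE_I)
    show "koszul_d R M f r q c J \<in> carrier M" if "J \<in> subsets_of_card r q" for J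
      using \<open>c \<in> carrier (koszul M r (Suc q))\<close> by (intro MK.koszul_d_closed that) (auto simp: koszul_def)
  qed (simp add: koszul_d_def)
  fix x y assume x: "x \<in> carrier (koszul M r (Suc q))" and y: "y \<in> carrier (koszul M r (Suc q))"
  have cl: "\<forall>K\<in>subsets_of_card r (Suc q). x K \<in> carrier M"
    "\<forall>K\<in>subsets_of_card r (Suc q). y K \<in> carrier M"
    using x y by (auto simp: koszul_def)
  show "koszul_d R M f r q (x \<oplus>\<^bsub>koszul M r (Suc q)\<^esub> y)
      = koszul_d R M f r q x \<oplus>\<^bsub>koszul M r q\<^esub> koszul_d R M f r q y"
  proof (rule extensionalityI[of _ "subsets_of_card r q"])
    fix J assume J: "J \<in> subsets_of_card r q"
    have "koszul_d R M f r q (x \<oplus>\<^bsub>koszul M r (Suc q)\<^esub> y) J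
        = koszul_d R M f r q (\<lambda>K. x K \<oplus>\<^bsub>M\<^esub> y K) J"
      using cl by (intro fun_cong[OF MK.koszul_d_cong]) (auto simp: koszul_def)
    then show "koszul_d R M f r q (x \<oplus>\<^bsub>koszul M r (Suc q)\<^esub> y) J
        = (koszul_d R M f r q x \<oplus>\<^bsub>koszul M r q\<^esub> koszul_d R M f r q y) J"
      using MK.koszul_d_add[OF J cl] J by (simp add: koszul_def)
  qed (auto simp: koszul_def koszul_d_def)
qed

theorem Supp_koszul_homology_subset:
  assumes rad: "Idl (g ` {..<s}) \<subseteq> ideal_radical R (set_add R (Idl (f ` {..<r})) (annihilator R M))"
  shows "Supp (koszul_homology R M f r j) (koszul_homology_grading R M MG f \<delta> r j) \<subseteq>
    (\<Union>k. Supp (cech_cohomology R M g s k) (cech_cohomology_grading R RG M MG g s k)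
          + koszul_shifts \<delta> r (j + k))"
proof (rule subsetI, rule ccontr)
  fix d
  assume d: "d \<in> Supp (koszul_homology R M f r j) (koszul_homology_grading R M MG f \<delta> r j)"
    and notin: "d \<notin> (\<Union>k. Supp (cech_cohomology R M g s k) (cech_cohomology_grading R RG M MG g s k)
          + koszul_shifts \<delta> r (j + k))"
  have van: "cech_vanishes p (d - (\<Sum>i\<in>J. \<delta> i))" if J: "J \<in> subsets_of_card r (j + p)" for p J
  proof
    assume "d - (\<Sum>i\<in>J. \<delta> i) \<in> Supp (cech_cohomology R M g s p) (cech_cohomology_grading R RG M MG g s p)"
    moreover have "(\<Sum>i\<in>J. \<delta> i) \<in> koszul_shifts \<delta> r (j + p)"
      using J by (auto simp: koszul_shifts_def)
    ultimately have "d - (\<Sum>i\<in>J. \<delta> i) + (\<Sum>i\<in>J. \<delta> i) \<in> Supp (cech_cohomology R M g s p)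
        (cech_cohomology_grading R RG M MG g s p) + koszul_shifts \<delta> r (j + p)"
      by (rule set_plus_intro)
    then show False using notin by auto
  qed
  interpret d: abelian_group_hom "koszul M r (Suc q)" "koszul M r q" "koszul_d R M f r q" for q
    by (rule koszul_d_hom)
  have "d \<notin> Supp (koszul_homology R M f r j) (koszul_homology_grading R M MG f \<delta> r j)"
    unfolding koszul_homology_def koszul_homology_grading_def
  proof (rule not_in_Supp_subquotientI)
    show "abelian_group (koszul M r j)" by (rule d.H.abelian_group_axioms)
    show "subgroup (koszul_boundaries R M f r j) (add_monoid (koszul M r j))"
      using group_hom.img_is_subgroup[OF d.a_group_hom] by (simp add: koszul_boundaries_def)
    show "\<zero>\<^bsub>koszul M r j\<^esub> \<in> koszul_cycles R M f r j"
      unfolding koszul_cycles_def by (cases j) simp_all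
    show "\<zero>\<^bsub>koszul M r j\<^esub> \<in> koszul_grading MG \<delta> r j d"
      using zero_MG by (auto simp: koszul_def koszul_grading_def)
    show "koszul_cycles R M f r j \<inter> koszul_grading MG \<delta> r j d \<subseteq> koszul_boundaries R M f r j"
      using homogeneous_cycle_is_boundary[OF rad van] by blast
  qed
  then show False using d by contradiction
qed

end

section \<open>The grading of the polynomial ring\<close>

lemma mpoly_coeff_closed:
  assumes "cring S" "p \<in> carrier (mpoly_ring S n)"
  shows "p m \<in> carrier S"
proof -
  interpret S: cring S by fact
  show ?thesis
    using S.indexed_pset_in_carrier[of "carrier S" p "{..<n}"] assms(2)
    by (auto simp: mpoly_ring_def S.carrier_coeff_def)
qed

lemma mpoly_grading_one:
  assumes "cring S" "cring (mpoly_ring S n)"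
  shows "\<one>\<^bsub>mpoly_ring S n\<^esub> \<in> mpoly_grading S n \<gamma> 0"
proof -
  interpret S: cring S by fact
  interpret R: cring "mpoly_ring S n" by fact
  have "\<one>\<^bsub>mpoly_ring S n\<^esub> m = (if m = {#} then \<one>\<^bsub>S\<^esub> else \<zero>\<^bsub>S\<^esub>)" for m
    by (simp add: mpoly_ring_def S.indexed_const_def)
  then show ?thesis by (simp add: mpoly_grading_def)
qed

lemma mpoly_grading_mult:
  assumes "cring S" "cring (mpoly_ring S n)"
    and p: "p \<in> mpoly_grading S n \<gamma> d" and q: "q \<in> mpoly_grading S n \<gamma> e"
  shows "p \<otimes>\<^bsub>mpoly_ring S n\<^esub> q \<in> mpoly_grading S n \<gamma> (d + e)"
proof -
  interpret S: cring S by fact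
  interpret R: cring "mpoly_ring S n" by fact
  have deg: "(\<Sum>i\<in>#m. \<gamma> i) = d + e" if nz: "(p \<otimes>\<^bsub>mpoly_ring S n\<^esub> q) m \<noteq> \<zero>\<^bsub>S\<^esub>" for m
  proof -
    have prod: "(p \<otimes>\<^bsub>mpoly_ring S n\<^esub> q) m = (\<Oplus>\<^bsub>S\<^esub>a\<in>{a. a \<subseteq># m}. p a \<otimes>\<^bsub>S\<^esub> q (m - a))"
      by (simp add: mpoly_ring_def)
    have cl: "p a \<in> carrier S" "q a \<in> carrier S" for a
      using p q mpoly_coeff_closed[OF assms(1)] by (auto simp: mpoly_grading_def)
    have "\<exists>a. a \<subseteq># m \<and> p a \<otimes>\<^bsub>S\<^esub> q (m - a) \<noteq> \<zero>\<^bsub>S\<^esub>"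
    proof (rule ccontr)
      assume "\<not> ?thesis"
      then have "(\<Oplus>\<^bsub>S\<^esub>a\<in>{a. a \<subseteq># m}. p a \<otimes>\<^bsub>S\<^esub> q (m - a)) = (\<Oplus>\<^bsub>S\<^esub>a\<in>{a. a \<subseteq># m}. \<zero>\<^bsub>S\<^esub>)"
        by (intro S.finsum_cong') auto
      then show False using nz prod by simp
    qed
    then obtain a where a: "a \<subseteq># m" and "p a \<otimes>\<^bsub>S\<^esub> q (m - a) \<noteq> \<zero>\<^bsub>S\<^esub>" by blast
    then have "p a \<noteq> \<zero>\<^bsub>S\<^esub>" "q (m - a) \<noteq> \<zero>\<^bsub>S\<^esub>" using cl by auto
    then have "(\<Sum>i\<in>#a. \<gamma> i) = d" "(\<Sum>i\<in>#m - a. \<gamma> i) = e"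
      using p q by (auto simp: mpoly_grading_def)
    moreover have "(\<Sum>i\<in>#m. \<gamma> i) = (\<Sum>i\<in>#a. \<gamma> i) + (\<Sum>i\<in>#m - a. \<gamma> i)"
      using a by (metis image_mset_union subset_mset.add_diff_inverse sum_mset.union)
    ultimately show ?thesis by simp
  qed
  have "p \<otimes>\<^bsub>mpoly_ring S n\<^esub> q \<in> carrier (mpoly_ring S n)"
    using p q by (auto simp: mpoly_grading_def)
  then show ?thesis using deg by (simp add: mpoly_grading_def)
qed

lemma mpoly_grading_unique:
  assumes "cring S" and p: "p \<in> mpoly_grading S n \<gamma> d" "p \<in> mpoly_grading S n \<gamma> e"
    and nz: "p \<noteq> \<zero>\<^bsub>mpoly_ring S n\<^esub>"
  shows "d = e"
proof -
  interpret S: cring S by fact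
  obtain m where "p m \<noteq> \<zero>\<^bsub>S\<^esub>"
    using nz by (auto simp: mpoly_ring_def S.indexed_zero_def fun_eq_iff)
  then show ?thesis using p by (auto simp: mpoly_grading_def)
qed

theorem theorem3p7:
  fixes S :: "('s, 'z) ring_scheme"
    and R :: "(nat multiset \<Rightarrow> 's) ring"
    and RG :: "'g::ab_group_add \<Rightarrow> (nat multiset \<Rightarrow> 's) set"
    and M :: "(nat multiset \<Rightarrow> 's, 'm, 'b) module_scheme"
    and MG :: "'g \<Rightarrow> 'm set"
    and f g :: "nat \<Rightarrow> nat multiset \<Rightarrow> 's"
    and \<gamma> \<delta> :: "nat \<Rightarrow> 'g"
    and B I :: "(nat multiset \<Rightarrow> 's) set"
    and n r s j :: nat
  assumes G_fin_gen: "\<exists>F :: 'g set. finite F \<and> group_closure F = UNIV"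
    and S: "cring S"
    and R: "R = mpoly_ring S n"
    and RG: "RG = mpoly_grading S n \<gamma>"
    and B_sub: "B \<subseteq> Idl\<^bsub>R\<^esub> (ring.indexed_var S ` {..<n})"
    and B_gen: "B = Idl\<^bsub>R\<^esub> (g ` {..<s})"
    and g_homogeneous: "\<forall>i<s. \<exists>d. g i \<in> RG d"
    and M: "graded_module R RG M MG"
    and f_homogeneous: "\<forall>i<r. f i \<in> RG (\<delta> i)"
    and I: "I = Idl\<^bsub>R\<^esub> (f ` {..<r})"
    and B_radical: "B \<subseteq> ideal_radical R (set_add R I (annihilator R M))"
  shows "Supp (koszul_homology R M f r j) (koszul_homology_grading R M MG f \<delta> r j) \<subseteq>
    (\<Union>k. Supp (cech_cohomology R M g s k) (cech_cohomology_grading R RG M MG g s k)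
          + koszul_shifts \<delta> r (j + k))"
proof -
  from g_homogeneous obtain \<epsilon> where \<epsilon>: "\<And>i. i < s \<Longrightarrow> g i \<in> RG (\<epsilon> i)" by metis
  have mod: "module R M" using M by (simp add: graded_module_def)
  then have cring: "cring (mpoly_ring S n)" unfolding R by (rule module.axioms(1))
  interpret koszul_cech R M RG MG f r \<delta> g s \<epsilon>
  proof (intro koszul_cech.intro koszul_cech_axioms.intro module_over_graded_ring.intro
      module_over_graded_ring_axioms.intro mod M \<epsilon>)
    show "a \<in> carrier R" if "a \<in> RG d" for a d
      using that by (simp add: R RG mpoly_grading_def)
    show "\<one>\<^bsub>R\<^esub> \<in> RG 0" unfolding R RG by (rule mpoly_grading_one[OF S cring])
    show "a \<otimes>\<^bsub>R\<^esub> b \<in> RG (d + e)" if "a \<in> RG d" "b \<in> RG e" for a b d e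
      using that unfolding R RG by (rule mpoly_grading_mult[OF S cring])
    show "d = e" if "a \<in> RG d" "a \<in> RG e" "a \<noteq> \<zero>\<^bsub>R\<^esub>" for a d e
      using that unfolding R RG by (rule mpoly_grading_unique[OF S])
    show "f t \<in> RG (\<delta> t)" if "t < r" for t using f_homogeneous that by blast
  qed
  show ?thesis
    using B_radical unfolding B_gen I by (rule Supp_koszul_homology_subset)
qed

end
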